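(* Let $\Sigma$ be a set-sized relational signature of positive finite arities, and let $\mathbb H$ be a set of universally quantified rules $$\bigwedge_{j=1}^{m}R_j(\mathbf t_j)\ \vdash_{\vec x}\ S(\mathbf t_0),\qquad m\ge0,$$ with $R_j,S\in\Sigma$, whose arguments are variables. Suppose that, in each rule, every variable occurring in a premise occurs in the conclusion tuple $\mathbf t_0$. Then the category $\mathbf{Mod}(\mathbb H)$ of set-based models and relation-preserving functions has a noetherian form inducing the factorization system of surjective homomorphisms (left class) and induced-substructure embeddings (right class), with complete algebraic modular fibres.
   Context: A $\Sigma$-structure is a set with an interpretation of each symbol of $\Sigma$ as a relation of its arity. $\mathbf{Mod}(\mathbb H)$ has as objects the $\Sigma$-structures in which every rule of $\mathbb H$ holds under all assignments of its variables (the empty conjunction is $\top$), and as morphisms (homomorphisms) all functions preserving every relation. An induced-substructure embedding is an injective homomorphism that reflects every relation. A complete lattice is algebraic when each element is a join of compact elements. Conventions: categories are locally small; "set" is relative to a fixed universe. A proper factorization system $(\mathcal E,\mathcal M)$ is an orthogonal factorization system with every morphism in $\mathcal E$ an epimorphism and every morphism in $\mathcal M$ a monomorphism. Forms. An (orean) form $\mathsf F$ on a category $\mathcal C$ assigns to each object $X$ a set-sized bounded lattice $\mathsf F(X)$ (the fibre over $X$; its elements are called clusters) and to each morphism $f:X\to Y$ monotone maps $f_!:\mathsf F(X)\to\mathsf F(Y)$ and $f^*:\mathsf F(Y)\to\mathsf F(X)$ with $f_!S\le T\iff S\le f^*T$, such that $(gf)_!=g_!f_!$, $(gf)^*=f^*g^*$,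 and identities act as identities. Put $\operatorname{Im}f=f_!\top_X$ and $\operatorname{Ker}f=f^*\bot_Y$. A cluster in $\mathsf F(X)$ is conormal if it is the image of some morphism of $\mathcal C$ with codomain $X$, and normal if it is the kernel of some morphism of $\mathcal C$ with domain $X$. An embedding of a conormal $S\in\mathsf F(X)$ is a morphism $\iota$ into $X$ with $\operatorname{Im}\iota=S$ such that every morphism $f$ into $X$ with $\operatorname{Im}f\le S$ factors as $f=\iota h$ for a unique $h$. A quotient of a normal $K\in\mathsf F(X)$ is a morphism $\pi$ out of $X$ with $\operatorname{Ker}\pi=K$ such that every morphism $g$ out of $X$ with $K\le\operatorname{Ker}g$ factors as $g=h\pi$ for a unique $h$. The form is noetherian if: (N1) $f^*f_!S=S\vee\operatorname{Ker}f$ and $f_!f^*T=T\wedge\operatorname{Im}f$ for all $f,S,T$; (N2) every morphism $f$ factors as $f=me$ with $e$ a quotient of $\operatorname{Ker}f$ and $m$ an embedding of $\operatorname{Im}f$; (N3) the join of two normal clusters (in the same fibre) is normal, and the meet of two conormal clusters is conormal. For a noetherian form, the class of all quotients (of normal clusters) and the class of all embeddings (of conormal clusters) form a proper factorization system, the one induced by the form (quotients as left class, embeddings as right class). *)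

theory Defs
  imports
    "HOL-Algebra.Complete_Lattice"
    "HOL-Library.Equipollence"
    "HOL-Library.FuncSet"
begin

section \<open>Set universes\<close>

text \<open>
  A Grothendieck universe, presented by the family \<open>U\<close> of those subsets of the type \<open>'u\<close> that
  count as sets. As the elements of \<open>'u\<close> carry no membership relation, the power set of a
  set is a set only up to bijection. Replacement follows from closure under singletons and unions.
  Infinity is not required: besides the usual universes, the finite subsets of an
  infinite type are admitted.
\<close>

definition universe :: "'u set set \<Rightarrow> bool" where
  "universe U \<longleftrightarrow>
     (\<forall>x. {x} \<in> U) \<and>
     (\<forall>A\<in>U. \<forall>B. B \<subseteq> A \<longrightarrow> B \<in> U) \<and>
     (\<forall>A\<in>U. \<exists>B\<in>U. Pow A \<approx> B) \<and>
     (\<forall>A\<in>U. \<forall>f :: 'u \<Rightarrow> 'u set. f ` A \<subseteq> U \<longrightarrow> (\<Union>x\<in>A. f x) \<in> U)"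

definition small :: "'u set set \<Rightarrow> 'b set \<Rightarrow> bool" where
  "small U A \<longleftrightarrow> (\<exists>B\<in>U. A \<approx> B)"


section \<open>Categories and factorization systems\<close>

record ('o, 'm) cat =
  Obj :: "'o set"
  Arr :: "'m set"
  Dom :: "'m \<Rightarrow> 'o"
  Cod :: "'m \<Rightarrow> 'o"
  Idn :: "'o \<Rightarrow> 'm"
  Cmp :: "'m \<Rightarrow> 'm \<Rightarrow> 'm"  \<comment> \<open>\<open>Cmp C g f\<close> is \<open>g\<close> after \<open>f\<close>\<close>

definition homset :: "('o, 'm) cat \<Rightarrow> 'o \<Rightarrow> 'o \<Rightarrow> 'm set" where
  "homset C X Y = {f \<in> Arr C. Dom C f = X \<and> Cod C f = Y}"

locale category =
  fixes C :: "('o, 'm) cat"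
  assumes dom_obj: "f \<in> Arr C \<Longrightarrow> Dom C f \<in> Obj C"
    and cod_obj: "f \<in> Arr C \<Longrightarrow> Cod C f \<in> Obj C"
    and idn_hom: "X \<in> Obj C \<Longrightarrow> Idn C X \<in> homset C X X"
    and cmp_hom: "\<lbrakk>f \<in> homset C X Y; g \<in> homset C Y Z\<rbrakk> \<Longrightarrow> Cmp C g f \<in> homset C X Z"
    and idn_right: "f \<in> homset C X Y \<Longrightarrow> Cmp C f (Idn C X) = f"
    and idn_left: "f \<in> homset C X Y \<Longrightarrow> Cmp C (Idn C Y) f = f"
    and cmp_assoc: "\<lbrakk>f \<in> homset C W X; g \<in> homset C X Y; h \<in> homset C Y Z\<rbrakk>
           \<Longrightarrow> Cmp C h (Cmp C g f) = Cmp C (Cmp C h g) f"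

definition mono_arr :: "('o, 'm) cat \<Rightarrow> 'm \<Rightarrow> bool" where
  "mono_arr C m \<longleftrightarrow> m \<in> Arr C \<and>
     (\<forall>W. \<forall>f\<in>homset C W (Dom C m). \<forall>g\<in>homset C W (Dom C m). Cmp C m f = Cmp C m g \<longrightarrow> f = g)"

definition epi_arr :: "('o, 'm) cat \<Rightarrow> 'm \<Rightarrow> bool" where
  "epi_arr C e \<longleftrightarrow> e \<in> Arr C \<and>
     (\<forall>W. \<forall>f\<in>homset C (Cod C e) W. \<forall>g\<in>homset C (Cod C e) W. Cmp C f e = Cmp C g e \<longrightarrow> f = g)"

definition iso_arr :: "('o, 'm) cat \<Rightarrow> 'm \<Rightarrow> bool" where
  "iso_arr C f \<longleftrightarrow> f \<in> Arr C \<and>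
     (\<exists>g\<in>homset C (Cod C f) (Dom C f). Cmp C g f = Idn C (Dom C f) \<and> Cmp C f g = Idn C (Cod C f))"

definition orthogonal_factorization_system :: "('o, 'm) cat \<Rightarrow> 'm set \<Rightarrow> 'm set \<Rightarrow> bool" where
  "orthogonal_factorization_system C \<E> \<M> \<longleftrightarrow>
     \<E> \<subseteq> Arr C \<and> \<M> \<subseteq> Arr C \<and>
     (\<forall>f. iso_arr C f \<longrightarrow> f \<in> \<E> \<and> f \<in> \<M>) \<and>
     (\<forall>f\<in>\<E>. \<forall>g\<in>\<E>. Cod C f = Dom C g \<longrightarrow> Cmp C g f \<in> \<E>) \<and>
     (\<forall>f\<in>\<M>. \<forall>g\<in>\<M>. Cod C f = Dom C g \<longrightarrow> Cmp C g f \<in> \<M>) \<and>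
     (\<forall>f\<in>Arr C. \<exists>e\<in>\<E>. \<exists>m\<in>\<M>. Dom C e = Dom C f \<and> Cod C e = Dom C m \<and> Cod C m = Cod C f \<and>
        f = Cmp C m e) \<and>
     (\<forall>e\<in>\<E>. \<forall>m\<in>\<M>. \<forall>u\<in>homset C (Dom C e) (Dom C m). \<forall>v\<in>homset C (Cod C e) (Cod C m).
        Cmp C v e = Cmp C m u \<longrightarrow>
        (\<exists>!d. d \<in> homset C (Cod C e) (Dom C m) \<and> Cmp C d e = u \<and> Cmp C m d = v))"

definition proper_factorization_system :: "('o, 'm) cat \<Rightarrow> 'm set \<Rightarrow> 'm set \<Rightarrow> bool" where
  "proper_factorization_system C \<E> \<M> \<longleftrightarrow>
     orthogonal_factorization_system C \<E> \<M> \<and>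
     (\<forall>e\<in>\<E>. epi_arr C e) \<and> (\<forall>m\<in>\<M>. mono_arr C m)"


section \<open>Forms\<close>

text \<open>\<open>Dir F f\<close> and \<open>Inv F f\<close> are the direct and inverse image maps \<open>f\<^sub>!\<close> and \<open>f\<^sup>*\<close>.\<close>

record ('o, 'm, 'c) form =
  Fib :: "'o \<Rightarrow> 'c gorder"
  Dir :: "'m \<Rightarrow> 'c \<Rightarrow> 'c"
  Inv :: "'m \<Rightarrow> 'c \<Rightarrow> 'c"

text \<open>
  The clusters are elements of the type underlying the universe, and each fibre is one of its sets;
  up to isomorphism this is no restriction on set-sized lattices.
\<close>

locale orean_form = category C
  for C :: "('o, 'm) cat" and U :: "'u set set" and F :: "('o, 'm, 'u) form" +
  assumes fib_set: "X \<in> Obj C \<Longrightarrow> carrier (Fib F X) \<in> U"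
    and fib_lattice: "X \<in> Obj C \<Longrightarrow> bounded_lattice (Fib F X)"
    and dir_closed: "\<lbrakk>f \<in> homset C X Y; S \<in> carrier (Fib F X)\<rbrakk> \<Longrightarrow> Dir F f S \<in> carrier (Fib F Y)"
    and inv_closed: "\<lbrakk>f \<in> homset C X Y; T \<in> carrier (Fib F Y)\<rbrakk> \<Longrightarrow> Inv F f T \<in> carrier (Fib F X)"
    and dir_mono: "\<lbrakk>f \<in> homset C X Y; S \<in> carrier (Fib F X); S' \<in> carrier (Fib F X);
           S \<sqsubseteq>\<^bsub>Fib F X\<^esub> S'\<rbrakk> \<Longrightarrow> Dir F f S \<sqsubseteq>\<^bsub>Fib F Y\<^esub> Dir F f S'"
    and inv_mono: "\<lbrakk>f \<in> homset C X Y; T \<in> carrier (Fib F Y); T' \<in> carrier (Fib F Y);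
           T \<sqsubseteq>\<^bsub>Fib F Y\<^esub> T'\<rbrakk> \<Longrightarrow> Inv F f T \<sqsubseteq>\<^bsub>Fib F X\<^esub> Inv F f T'"
    and adjunction: "\<lbrakk>f \<in> homset C X Y; S \<in> carrier (Fib F X); T \<in> carrier (Fib F Y)\<rbrakk>
           \<Longrightarrow> Dir F f S \<sqsubseteq>\<^bsub>Fib F Y\<^esub> T \<longleftrightarrow> S \<sqsubseteq>\<^bsub>Fib F X\<^esub> Inv F f T"
    and dir_cmp: "\<lbrakk>f \<in> homset C X Y; g \<in> homset C Y Z; S \<in> carrier (Fib F X)\<rbrakk>
           \<Longrightarrow> Dir F (Cmp C g f) S = Dir F g (Dir F f S)"
    and inv_cmp: "\<lbrakk>f \<in> homset C X Y; g \<in> homset C Y Z; T \<in> carrier (Fib F Z)\<rbrakk>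
           \<Longrightarrow> Inv F (Cmp C g f) T = Inv F f (Inv F g T)"
    and dir_idn: "\<lbrakk>X \<in> Obj C; S \<in> carrier (Fib F X)\<rbrakk> \<Longrightarrow> Dir F (Idn C X) S = S"
    and inv_idn: "\<lbrakk>X \<in> Obj C; S \<in> carrier (Fib F X)\<rbrakk> \<Longrightarrow> Inv F (Idn C X) S = S"

definition Im :: "('o, 'm) cat \<Rightarrow> ('o, 'm, 'c) form \<Rightarrow> 'm \<Rightarrow> 'c" where
  "Im C F f = Dir F f \<top>\<^bsub>Fib F (Dom C f)\<^esub>"

definition Ker :: "('o, 'm) cat \<Rightarrow> ('o, 'm, 'c) form \<Rightarrow> 'm \<Rightarrow> 'c" where
  "Ker C F f = Inv F f \<bottom>\<^bsub>Fib F (Cod C f)\<^esub>"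

definition conormal :: "('o, 'm) cat \<Rightarrow> ('o, 'm, 'c) form \<Rightarrow> 'o \<Rightarrow> 'c \<Rightarrow> bool" where
  "conormal C F X S \<longleftrightarrow> (\<exists>f\<in>Arr C. Cod C f = X \<and> Im C F f = S)"

definition normal :: "('o, 'm) cat \<Rightarrow> ('o, 'm, 'c) form \<Rightarrow> 'o \<Rightarrow> 'c \<Rightarrow> bool" where
  "normal C F X K \<longleftrightarrow> (\<exists>f\<in>Arr C. Dom C f = X \<and> Ker C F f = K)"

definition embedding_of :: "('o, 'm) cat \<Rightarrow> ('o, 'm, 'c) form \<Rightarrow> 'o \<Rightarrow> 'c \<Rightarrow> 'm \<Rightarrow> bool" where
  "embedding_of C F X S i \<longleftrightarrow>
     i \<in> Arr C \<and> Cod C i = X \<and> Im C F i = S \<and>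
     (\<forall>f\<in>Arr C. Cod C f = X \<and> Im C F f \<sqsubseteq>\<^bsub>Fib F X\<^esub> S \<longrightarrow>
        (\<exists>!h. h \<in> homset C (Dom C f) (Dom C i) \<and> f = Cmp C i h))"

definition quotient_of :: "('o, 'm) cat \<Rightarrow> ('o, 'm, 'c) form \<Rightarrow> 'o \<Rightarrow> 'c \<Rightarrow> 'm \<Rightarrow> bool" where
  "quotient_of C F X K p \<longleftrightarrow>
     p \<in> Arr C \<and> Dom C p = X \<and> Ker C F p = K \<and>
     (\<forall>g\<in>Arr C. Dom C g = X \<and> K \<sqsubseteq>\<^bsub>Fib F X\<^esub> Ker C F g \<longrightarrow>
        (\<exists>!h. h \<in> homset C (Cod C p) (Cod C g) \<and> g = Cmp C h p))"

locale noetherian_form = orean_form C U F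
  for C :: "('o, 'm) cat" and U :: "'u set set" and F :: "('o, 'm, 'u) form" +
  assumes inv_dir: "\<lbrakk>f \<in> homset C X Y; S \<in> carrier (Fib F X)\<rbrakk>
           \<Longrightarrow> Inv F f (Dir F f S) = S \<squnion>\<^bsub>Fib F X\<^esub> Ker C F f"
    and dir_inv: "\<lbrakk>f \<in> homset C X Y; T \<in> carrier (Fib F Y)\<rbrakk>
           \<Longrightarrow> Dir F f (Inv F f T) = T \<sqinter>\<^bsub>Fib F Y\<^esub> Im C F f"
    and factorization: "f \<in> homset C X Y
           \<Longrightarrow> \<exists>e m. quotient_of C F X (Ker C F f) e \<and> embedding_of C F Y (Im C F f) m \<and>
                 Cod C e = Dom C m \<and> f = Cmp C m e"
    and normal_join: "\<lbrakk>X \<in> Obj C; normal C F X K; normal C F X L\<rbrakk>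
           \<Longrightarrow> normal C F X (K \<squnion>\<^bsub>Fib F X\<^esub> L)"
    and conormal_meet: "\<lbrakk>X \<in> Obj C; conormal C F X S; conormal C F X T\<rbrakk>
           \<Longrightarrow> conormal C F X (S \<sqinter>\<^bsub>Fib F X\<^esub> T)"

definition quotients :: "('o, 'm) cat \<Rightarrow> ('o, 'm, 'c) form \<Rightarrow> 'm set" where
  "quotients C F = {p. \<exists>X\<in>Obj C. \<exists>K. normal C F X K \<and> quotient_of C F X K p}"

definition embeddings :: "('o, 'm) cat \<Rightarrow> ('o, 'm, 'c) form \<Rightarrow> 'm set" where
  "embeddings C F = {i. \<exists>X\<in>Obj C. \<exists>S. conormal C F X S \<and> embedding_of C F X S i}"

definition induces_factorization_system ::
  "('o, 'm) cat \<Rightarrow> ('o, 'm, 'c) form \<Rightarrow> 'm set \<Rightarrow> 'm set \<Rightarrow> bool" where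
  "induces_factorization_system C F \<E> \<M> \<longleftrightarrow>
     proper_factorization_system C \<E> \<M> \<and> quotients C F = \<E> \<and> embeddings C F = \<M>"


section \<open>Algebraic and modular lattices\<close>

definition compact_element :: "'c gorder \<Rightarrow> 'c \<Rightarrow> bool" where
  "compact_element L k \<longleftrightarrow> k \<in> carrier L \<and>
     (\<forall>A. A \<subseteq> carrier L \<and> k \<sqsubseteq>\<^bsub>L\<^esub> \<Squnion>\<^bsub>L\<^esub>A \<longrightarrow> (\<exists>B. B \<subseteq> A \<and> finite B \<and> k \<sqsubseteq>\<^bsub>L\<^esub> \<Squnion>\<^bsub>L\<^esub>B))"

definition complete_algebraic_lattice :: "'c gorder \<Rightarrow> bool" where
  "complete_algebraic_lattice L \<longleftrightarrow> complete_lattice L \<and>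
     (\<forall>x\<in>carrier L. \<exists>A. (\<forall>k\<in>A. compact_element L k) \<and> x = \<Squnion>\<^bsub>L\<^esub>A)"

definition modular_lattice :: "'c gorder \<Rightarrow> bool" where
  "modular_lattice L \<longleftrightarrow> lattice L \<and>
     (\<forall>x\<in>carrier L. \<forall>y\<in>carrier L. \<forall>z\<in>carrier L.
        x \<sqsubseteq>\<^bsub>L\<^esub> z \<longrightarrow> x \<squnion>\<^bsub>L\<^esub> (y \<sqinter>\<^bsub>L\<^esub> z) = (x \<squnion>\<^bsub>L\<^esub> y) \<sqinter>\<^bsub>L\<^esub> z)"


section \<open>Relational structures and rules\<close>

text \<open>A signature is a set \<open>\<Sigma>\<close> of relation symbols together with an arity function \<open>ar\<close>.\<close>

record ('u, 's) struct =
  base :: "'u set"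
  interp :: "'s \<Rightarrow> 'u list set"

definition tuples :: "'u set \<Rightarrow> nat \<Rightarrow> 'u list set" where
  "tuples A n = {t. set t \<subseteq> A \<and> length t = n}"

text \<open>Outside the signature \<open>interp\<close> is empty, so that equal structures are equal as records.\<close>

definition structures :: "'u set set \<Rightarrow> 's set \<Rightarrow> ('s \<Rightarrow> nat) \<Rightarrow> ('u, 's) struct set" where
  "structures U \<Sigma> ar = {A. base A \<in> U \<and>
     (\<forall>R\<in>\<Sigma>. interp A R \<subseteq> tuples (base A) (ar R)) \<and> (\<forall>R. R \<notin> \<Sigma> \<longrightarrow> interp A R = {})}"

text \<open>An atom \<open>(R, ts)\<close> stands for \<open>R(ts)\<close>; \<open>context_vars\<close> is the tuple of variables over which
  the rule is quantified.\<close>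

record ('s, 'v) horn_rule =
  context_vars :: "'v list"
  prems :: "('s \<times> 'v list) list"
  concl :: "'s \<times> 'v list"

definition wf_rule :: "'s set \<Rightarrow> ('s \<Rightarrow> nat) \<Rightarrow> ('s, 'v) horn_rule \<Rightarrow> bool" where
  "wf_rule \<Sigma> ar r \<longleftrightarrow>
     (\<forall>(R, ts) \<in> set (concl r # prems r).
        R \<in> \<Sigma> \<and> length ts = ar R \<and> set ts \<subseteq> set (context_vars r))"

definition holds :: "('u, 's) struct \<Rightarrow> ('s, 'v) horn_rule \<Rightarrow> bool" where
  "holds A r \<longleftrightarrow>
     (\<forall>\<sigma>. \<sigma> ` set (context_vars r) \<subseteq> base A \<longrightarrow>
        (\<forall>(R, ts) \<in> set (prems r). map \<sigma> ts \<in> interp A R) \<longrightarrow>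
        (case concl r of (S, ts) \<Rightarrow> map \<sigma> ts \<in> interp A S))"

type_synonym ('u, 's) struct_arr = "('u, 's) struct \<times> ('u \<Rightarrow> 'u) \<times> ('u, 's) struct"

definition homomorphism :: "'s set \<Rightarrow> ('u, 's) struct \<Rightarrow> ('u, 's) struct \<Rightarrow> ('u \<Rightarrow> 'u) \<Rightarrow> bool" where
  "homomorphism \<Sigma> A B f \<longleftrightarrow>
     f \<in> base A \<rightarrow>\<^sub>E base B \<and> (\<forall>R\<in>\<Sigma>. \<forall>t\<in>interp A R. map f t \<in> interp B R)"

definition Mod :: "'u set set \<Rightarrow> 's set \<Rightarrow> ('s \<Rightarrow> nat) \<Rightarrow> ('s, 'v) horn_rule set \<Rightarrow>
    (('u, 's) struct, ('u, 's) struct_arr) cat" where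
  "Mod U \<Sigma> ar \<H> =
     (let models = {A \<in> structures U \<Sigma> ar. \<forall>r\<in>\<H>. holds A r} in
      \<lparr> Obj = models,
        Arr = {(A, f, B). A \<in> models \<and> B \<in> models \<and> homomorphism \<Sigma> A B f},
        Dom = (\<lambda>(A, f, B). A),
        Cod = (\<lambda>(A, f, B). B),
        Idn = (\<lambda>A. (A, restrict id (base A), A)),
        Cmp = (\<lambda>(B, g, D) (A, f, B'). (A, compose (base A) g f, D)) \<rparr>)"

definition surjective_homs ::
  "('o, ('u, 's) struct_arr) cat \<Rightarrow> ('u, 's) struct_arr set" where
  "surjective_homs C = {(A, f, B) \<in> Arr C. f ` base A = base B}"

definition induced_embeddings :: "'s set \<Rightarrow> ('s \<Rightarrow> nat) \<Rightarrow>
    ('o, ('u, 's) struct_arr) cat \<Rightarrow> ('u, 's) struct_arr set" where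
  "induced_embeddings \<Sigma> ar C = {(A, f, B) \<in> Arr C. inj_on f (base A) \<and>
     (\<forall>R\<in>\<Sigma>. \<forall>t\<in>tuples (base A) (ar R). map f t \<in> interp B R \<longrightarrow> t \<in> interp A R)}"

end

theory Submission
  imports Defs
begin

text \<open>
  For a model \<open>A\<close> let \<open>gens A\<close> be the set of pairs \<open>(p, Z)\<close> of a model \<open>Z\<close> on an initial segment of the
  natural numbers and a homomorphism \<open>p\<close> to \<open>Z\<close> from a finite induced substructure of \<open>A\<close>. A
  homomorphism \<open>f\<close> from \<open>A\<close> to \<open>B\<close> sends \<open>(p, Z)\<close> to \<open>(q, Z)\<close> if \<open>p\<close> descends along \<open>f\<close> to such a
  \<open>q\<close>, and to zero otherwise. The clusters over \<open>A\<close> are the subspaces of the free vector space on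
  \<open>gens A\<close> over the field with two elements, a field that keeps the fibres finite when all sets
  of the universe are. So the fibres are modular and algebraic, and (N1) is linear algebra.
  Surjections induce surjective and induced embeddings injective linear maps, images are spanned
  by the generators supported in the set-theoretic image, and the kernel of a surjection determines
  it. For (N3), the sum of the kernels of two surjections is the kernel of the map to the quotient by the
  generated equivalence, whose relations are those preserved by every partial map into a model \<open>Z\<close>
  that preserves the relations coming from either surjection. It satisfies a rule because its premises only involve
  entries of the conclusion, so that a partial homomorphism defined on the conclusion is defined on
  the premises.
\<close>

section \<open>Small sets\<close>

text \<open>A surjection can do two things, identify points and add relations, and its kernel must
  record both. An equivalence relation shows only the first: a bijective homomorphism that is not an
  isomorphism would get a trivial kernel. A partial homomorphism into a fixed \<open>Z\<close> dies
  as soon as a new relation contradicts it, which detects added relations; two generators that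
  acquire the same image put their difference into the kernel, which detects identifications. The
  maps are partial so that induced embeddings push them forward without having to extend them. They
  are finite so that two generators with the same image in a join are linked by finitely many
  elementary changes, each lying in one of the two given kernels. Targets of size 1 or of the size
  of an arity suffice: one point separates elements, and a relation on a tuple is visible on the
  positions of that tuple. The obstacle in (N3) is that the relations coming from two surjections
  need not satisfy the rules, while every relation added to repair this may kill further generators.
  Adding exactly the relations that no partial homomorphism can refute kills none.\<close>

lemma universe_UN:
  assumes "universe (U :: 'u set set)" "A \<in> U" "\<And>x. x \<in> A \<Longrightarrow> f x \<in> U"
  shows "(\<Union>x\<in>A. f x) \<in> U"
proof -
  have "\<forall>f :: 'u \<Rightarrow> 'u set. f ` A \<subseteq> U \<longrightarrow> (\<Union>x\<in>A. f x) \<in> U"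
    using assms(1,2) by (simp add: universe_def)
  then show ?thesis using assms(3) by (simp add: image_subset_iff)
qed

lemma small_lepoll:
  assumes "universe U" "small U B" "A \<lesssim> B"
  shows "small U A"
proof -
  obtain B' where B': "B' \<in> U" "B \<approx> B'" using assms(2) by (auto simp: small_def)
  have "A \<lesssim> B'" using lepoll_trans2[OF assms(3) B'(2)] .
  then obtain f where f: "inj_on f A" "f ` A \<subseteq> B'" by (auto simp: lepoll_def)
  have "f ` A \<in> U" using assms(1) B'(1) f(2) unfolding universe_def by blast
  moreover have "A \<approx> f ` A" using f(1) by (auto simp: eqpoll_def bij_betw_def)
  ultimately show ?thesis by (auto simp: small_def)
qed

lemma small_subset: "universe U \<Longrightarrow> small U B \<Longrightarrow> A \<subseteq> B \<Longrightarrow> small U A"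
  by (rule small_lepoll) (auto intro: subset_imp_lepoll)

lemma small_image: "universe U \<Longrightarrow> small U A \<Longrightarrow> small U (f ` A)"
  by (rule small_lepoll) (auto intro: image_lepoll)

lemma small_mem: "A \<in> U \<Longrightarrow> small U A"
  by (auto simp: small_def intro: eqpoll_refl)

lemma small_Pow:
  assumes "universe U" "small U A"
  shows "small U (Pow A)"
proof -
  obtain B where B: "B \<in> U" "A \<approx> B" using assms(2) by (auto simp: small_def)
  obtain f where "bij_betw f A B" using B(2) by (auto simp: eqpoll_def)
  then have "Pow A \<approx> Pow B" by (auto simp: eqpoll_def dest: bij_betw_Pow)
  moreover obtain D where "D \<in> U" "Pow B \<approx> D" using assms(1) B(1) unfolding universe_def by blast
  ultimately show ?thesis by (auto simp: small_def intro: eqpoll_trans)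
qed

text \<open>No axiom of infinity is at hand, so finite cardinals come from power sets: the segments
  \<open>{..<i}\<close> with \<open>i \<le> n\<close> are n + 1 distinct subsets of
  \<open>{..<n}\<close>.\<close>

lemma small_lessThan:
  assumes "universe (U :: 'u set set)"
  shows "small U {..<n::nat}"
proof (induction n)
  case 0
  have "{} \<in> U" using assms unfolding universe_def by blast
  then show ?case by (auto simp: small_def eqpoll_def bij_betw_def intro!: bexI[of _ "{}"])
next
  case (Suc n)
  have "inj_on lessThan {..<Suc n}" by (auto simp: inj_on_def)
  then have "{..<Suc n} \<lesssim> Pow {..<n}" unfolding lepoll_def by (intro exI[of _ lessThan]) auto
  then show ?case using small_lepoll[OF assms small_Pow[OF assms Suc.IH]] by blast
qed

lemma universe_Un:
  assumes "universe (U :: 'u set set)" "A \<in> U" "B \<in> U"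
  shows "A \<union> B \<in> U"
proof -
  \<comment> \<open>Unions in \<open>U\<close> are indexed by members of \<open>U\<close>, so a
    two-element index set is obtained first.\<close>
  obtain D where D: "D \<in> U" "{..<2::nat} \<approx> D"
    using small_lessThan[OF assms(1)] by (auto simp: small_def)
  then obtain g where g: "bij_betw g {..<2::nat} D" by (auto simp: eqpoll_def)
  define f where "f = (\<lambda>z. if z = g 0 then A else B)"
  have D2: "D = {g 0, g 1}" using g by (auto simp: bij_betw_def lessThan_def less_2_cases_iff)
  have "g 0 \<noteq> g 1" using g inj_onD[of g "{..<2}" 0 1] by (auto simp: bij_betw_def)
  then have "(\<Union>x\<in>D. f x) = A \<union> B" by (auto simp: D2 f_def)
  moreover have "(\<Union>x\<in>D. f x) \<in> U" using assms(2,3) by (intro universe_UN[OF assms(1) D(1)]) (simp add: f_def)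
  ultimately show ?thesis by simp
qed

lemma small_Times:
  assumes "universe (U :: 'u set set)" "small U A" "small U B"
  shows "small U (A \<times> B)"
proof -
  obtain A' f where A': "A' \<in> U" "bij_betw f A A'" using assms(2) unfolding small_def eqpoll_def by blast
  obtain B' g where B': "B' \<in> U" "bij_betw g B B'" using assms(3) unfolding small_def eqpoll_def by blast
  note fg = A'(2) B'(2)
  \<comment> \<open>Kuratowski pairs: the type \<open>'u\<close> carries no pairing, but a double
    power set has room for one.\<close>
  let ?h = "\<lambda>(a, b). {{f a}, {f a, g b}}"
  have "inj_on ?h (A \<times> B)"
  proof (rule inj_onI)
    have kuratowski: "x = x' \<and> y = y'" if "{{x}, {x, y}} = {{x'}, {x', y'}}" for x y x' y' :: 'u
      using that by (auto simp: doubleton_eq_iff)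
    fix p q assume pq: "p \<in> A \<times> B" "q \<in> A \<times> B" "?h p = ?h q"
    then have "f (fst p) = f (fst q) \<and> g (snd p) = g (snd q)"
      by (intro kuratowski) (simp add: case_prod_beta)
    moreover have "inj_on f A" "inj_on g B" using fg by (simp_all add: bij_betw_def)
    ultimately show "p = q" using pq(1,2) by (auto simp: prod_eq_iff inj_on_eq_iff mem_Times_iff)
  qed
  moreover have "?h ` (A \<times> B) \<subseteq> Pow (Pow (A' \<union> B'))"
    by (auto dest: bij_betw_apply[OF A'(2)] bij_betw_apply[OF B'(2)])
  ultimately have "A \<times> B \<lesssim> Pow (Pow (A' \<union> B'))" unfolding lepoll_def by (intro exI[of _ ?h] conjI)
  moreover have "small U (Pow (Pow (A' \<union> B')))"
    by (intro small_Pow small_mem universe_Un assms(1) A' B')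
  ultimately show ?thesis by (rule small_lepoll[OF assms(1), rotated])
qed

lemma small_UN:
  assumes U: "universe (U :: 'u set set)" and I: "small U I" and T: "\<And>i. i \<in> I \<Longrightarrow> small U (T i)"
  shows "small U (\<Union>i\<in>I. T i)"
proof -
  obtain I' where I': "I' \<in> U" "I' \<approx> I" using I by (auto simp: small_def intro: eqpoll_sym)
  then obtain j where j: "bij_betw j I' I" by (auto simp: eqpoll_def)
  have "\<exists>B f. B \<in> U \<and> bij_betw f (T i) B" if "i \<in> I" for i
    using T[OF that] by (auto simp: small_def eqpoll_def)
  then obtain B f where B: "\<And>i. i \<in> I \<Longrightarrow> B i \<in> U" and f: "\<And>i. i \<in> I \<Longrightarrow> bij_betw (f i) (T i) (B i)"
    by metis
  have V: "(\<Union>x\<in>I'. B (j x)) \<in> U"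
    by (rule universe_UN[OF U I'(1) B[OF bij_betw_apply[OF j]]])
  have jI: "(\<Union>x\<in>I'. B (j x)) = (\<Union>i\<in>I. B i)" using j by (auto simp: bij_betw_def)
  \<comment> \<open>The sets \<open>T i\<close> may overlap, so each element chooses one index; this
    index and the element's code in \<open>B (k x)\<close> determine the element.\<close>
  define k where "k = (\<lambda>x. SOME i. i \<in> I \<and> x \<in> T i)"
  have k: "k x \<in> I \<and> x \<in> T (k x)" if "x \<in> (\<Union>i\<in>I. T i)" for x
    unfolding k_def using that by (auto intro!: someI_ex[of "\<lambda>i. i \<in> I \<and> x \<in> T i"])
  let ?h = "\<lambda>x. (k x, f (k x) x)"
  have "inj_on ?h (\<Union>i\<in>I. T i)"
  proof (rule inj_onI)
    fix x y assume xy: "x \<in> (\<Union>i\<in>I. T i)" "y \<in> (\<Union>i\<in>I. T i)" "?h x = ?h y"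
    then have "k y = k x \<and> f (k x) x = f (k x) y" by (metis prod.inject)
    moreover have "inj_on (f (k x)) (T (k x))" using f k[OF xy(1)] by (simp add: bij_betw_def)
    ultimately show "x = y" using k[OF xy(1)] k[OF xy(2)] by (metis inj_onD)
  qed
  moreover have "?h ` (\<Union>i\<in>I. T i) \<subseteq> I \<times> (\<Union>i\<in>I. B i)"
  proof
    fix z assume "z \<in> ?h ` (\<Union>i\<in>I. T i)"
    then obtain x where x: "x \<in> (\<Union>i\<in>I. T i)" "z = ?h x" by blast
    then show "z \<in> I \<times> (\<Union>i\<in>I. B i)" using k[OF x(1)] bij_betw_apply[OF f, of "k x" x] by blast
  qed
  ultimately have "(\<Union>i\<in>I. T i) \<lesssim> I \<times> (\<Union>i\<in>I. B i)" unfolding lepoll_def by (intro exI[of _ ?h] conjI)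
  moreover have "small U (I \<times> (\<Union>i\<in>I. B i))"
    using small_Times[OF U I small_mem[OF V]] by (simp add: jI)
  ultimately show ?thesis by (rule small_lepoll[OF U, rotated])
qed

lemma small_Un:
  assumes "universe (U :: 'u set set)" "small U A" "small U B"
  shows "small U (A \<union> B)"
proof -
  have "small U (\<Union>i\<in>{..<2::nat}. if i = 0 then A else B)"
    using assms(2,3) by (intro small_UN[OF assms(1) small_lessThan[OF assms(1)]]) simp
  moreover have "{..<2::nat} = {0, 1}" by auto
  ultimately show ?thesis by (simp add: Un_commute)
qed

lemma small_tuples:
  assumes "universe (U :: 'u set set)" "small U A"
  shows "small U (tuples A n)"
proof (induction n)
  case 0
  have "tuples A 0 \<subseteq> (\<lambda>_. []) ` {..<1::nat}" by (auto simp: tuples_def)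
  then show ?case by (rule small_subset[OF assms(1) small_image[OF assms(1) small_lessThan[OF assms(1)]]])
next
  case (Suc n)
  have "tuples A (Suc n) \<subseteq> (\<lambda>(x, t). x # t) ` (A \<times> tuples A n)"
    by (force simp: tuples_def length_Suc_conv)
  then show ?case
    by (rule small_subset[OF assms(1) small_image[OF assms(1) small_Times[OF assms Suc]]])
qed


section \<open>Vector spaces over the two-element field\<close>

text \<open>A finite subset of \<open>G\<close> is a vector of the free vector space on \<open>G\<close> over the field with two
  elements; the symmetric difference is the addition.\<close>

definition xor :: "'g set \<Rightarrow> 'g set \<Rightarrow> 'g set" (infixl \<open>\<oplus>\<close> 65) where
  "A \<oplus> B = (A - B) \<union> (B - A)"

lemma xor_simps [simp]: "A \<oplus> {} = A" "{} \<oplus> A = A" "A \<oplus> A = {}" "A \<oplus> (A \<oplus> B) = B"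
  by (auto simp: xor_def)

lemma xor_commute: "A \<oplus> B = B \<oplus> A" and xor_assoc: "A \<oplus> B \<oplus> D = A \<oplus> (B \<oplus> D)"
  and xor_left_commute: "A \<oplus> (B \<oplus> D) = B \<oplus> (A \<oplus> D)"
  by (auto simp: xor_def)

lemmas xor_ac = xor_assoc xor_commute xor_left_commute

lemma xor_Fpow: "A \<in> Fpow G \<Longrightarrow> B \<in> Fpow G \<Longrightarrow> A \<oplus> B \<in> Fpow G"
  by (auto simp: xor_def Fpow_def)

lemma insert_eq_xor: "a \<notin> A \<Longrightarrow> insert a A = {a} \<oplus> A"
  by (auto simp: xor_def)

lemma odd_card_xor:
  assumes "finite A" "finite B"
  shows "odd (card (A \<oplus> B)) \<longleftrightarrow> odd (card A) \<noteq> odd (card B)"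
proof -
  have "card A = card (A \<inter> B) + card (A - B)" "card B = card (A \<inter> B) + card (B - A)"
    using card_Int_Diff[OF assms(1), of B] card_Int_Diff[OF assms(2), of A] by (simp_all add: Int_commute)
  moreover have "card (A \<oplus> B) = card (A - B) + card (B - A)"
    unfolding xor_def using assms by (intro card_Un_disjoint) auto
  ultimately show ?thesis by presburger
qed

text \<open>The only scalars are 0 and 1, so closure under zero and sums is all that linearity asks
  for.\<close>

definition subspaces :: "'g set \<Rightarrow> 'g set set set" where
  "subspaces G = {W. W \<subseteq> Fpow G \<and> {} \<in> W \<and> (\<forall>A\<in>W. \<forall>B\<in>W. A \<oplus> B \<in> W)}"

lemma subspacesD:
  assumes "W \<in> subspaces G"
  shows "A \<in> W \<Longrightarrow> A \<in> Fpow G" "{} \<in> W" "A \<in> W \<Longrightarrow> B \<in> W \<Longrightarrow> A \<oplus> B \<in> W"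
  using assms by (auto simp: subspaces_def)

lemma subspaces_top: "Fpow G \<in> subspaces G"
  by (auto simp: subspaces_def xor_Fpow empty_in_Fpow)

lemma subspaces_bot: "{{}} \<in> subspaces G"
  by (auto simp: subspaces_def empty_in_Fpow)

lemma subspaces_Inter:
  assumes "\<W> \<subseteq> subspaces G" "\<W> \<noteq> {}"
  shows "\<Inter>\<W> \<in> subspaces G"
proof -
  have W: "W \<subseteq> Fpow G \<and> {} \<in> W \<and> (\<forall>A\<in>W. \<forall>B\<in>W. A \<oplus> B \<in> W)" if "W \<in> \<W>" for W
    using assms(1) that by (auto simp: subspaces_def)
  moreover obtain V where "V \<in> \<W>" using assms(2) by auto
  ultimately have "\<Inter>\<W> \<subseteq> Fpow G" by blast
  then show ?thesis using W by (simp add: subspaces_def)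
qed

lemma subspaces_Int: "V \<in> subspaces G \<Longrightarrow> W \<in> subspaces G \<Longrightarrow> V \<inter> W \<in> subspaces G"
  by (auto simp: subspaces_def)

definition span :: "'g set \<Rightarrow> 'g set set \<Rightarrow> 'g set set" where
  "span G V = \<Inter>{W \<in> subspaces G. V \<subseteq> W}"

lemma span_subspaces: "V \<subseteq> Fpow G \<Longrightarrow> span G V \<in> subspaces G"
  unfolding span_def by (rule subspaces_Inter) (use subspaces_top in auto)

lemma span_upper: "V \<subseteq> span G V"
  by (auto simp: span_def)

lemma span_least: "W \<in> subspaces G \<Longrightarrow> V \<subseteq> W \<Longrightarrow> span G V \<subseteq> W"
  by (auto simp: span_def)

definition ssum :: "'g set set \<Rightarrow> 'g set set \<Rightarrow> 'g set set" where
  "ssum V W = {A \<oplus> B | A B. A \<in> V \<and> B \<in> W}"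

lemma ssumI: "A \<in> V \<Longrightarrow> B \<in> W \<Longrightarrow> A \<oplus> B \<in> ssum V W"
  unfolding ssum_def by blast

lemma ssum_subspaces:
  assumes "V \<in> subspaces G" "W \<in> subspaces G"
  shows "ssum V W \<in> subspaces G"
  unfolding subspaces_def
proof (intro CollectI conjI subsetI ballI)
  note V = subspacesD[OF assms(1)] and W = subspacesD[OF assms(2)]
  show "{} \<in> ssum V W" using ssumI[OF V(2) W(2)] by simp
  fix A assume "A \<in> ssum V W"
  then obtain A1 A2 where A: "A = A1 \<oplus> A2" "A1 \<in> V" "A2 \<in> W" by (auto simp: ssum_def)
  show "A \<in> Fpow G" unfolding A(1) by (rule xor_Fpow[OF V(1)[OF A(2)] W(1)[OF A(3)]])
  fix B assume "B \<in> ssum V W"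
  then obtain B1 B2 where B: "B = B1 \<oplus> B2" "B1 \<in> V" "B2 \<in> W" by (auto simp: ssum_def)
  have "A \<oplus> B = (A1 \<oplus> B1) \<oplus> (A2 \<oplus> B2)" by (simp add: A(1) B(1) xor_ac)
  then show "A \<oplus> B \<in> ssum V W" using ssumI[OF V(3)[OF A(2) B(2)] W(3)[OF A(3) B(3)]] by simp
qed

lemma ssum_upper:
  assumes "V \<in> subspaces G" "W \<in> subspaces G"
  shows "V \<subseteq> ssum V W" "W \<subseteq> ssum V W"
proof -
  show "V \<subseteq> ssum V W" using ssumI[OF _ subspacesD(2)[OF assms(2)], of _ V] by auto
  show "W \<subseteq> ssum V W" using ssumI[OF subspacesD(2)[OF assms(1)], of _ W] by auto
qed

lemma ssum_least: "X \<in> subspaces G \<Longrightarrow> V \<subseteq> X \<Longrightarrow> W \<subseteq> X \<Longrightarrow> ssum V W \<subseteq> X"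
  using subspacesD(3)[of X G] by (auto simp: ssum_def)

lemma span_Un:
  assumes "V \<in> subspaces G" "W \<in> subspaces G"
  shows "span G (V \<union> W) = ssum V W"
proof
  show "span G (V \<union> W) \<subseteq> ssum V W"
    using ssum_upper[OF assms] by (intro span_least ssum_subspaces assms) auto
  have "V \<union> W \<subseteq> Fpow G" using assms by (auto simp: subspaces_def)
  then show "ssum V W \<subseteq> span G (V \<union> W)"
    using span_upper[of "V \<union> W" G] by (intro ssum_least[OF span_subspaces]) auto
qed

lemma ssum_modular:
  assumes "V \<in> subspaces G" "W \<in> subspaces G" "X \<in> subspaces G" "V \<subseteq> X"
  shows "ssum V (W \<inter> X) = ssum V W \<inter> X"
proof
  show "ssum V (W \<inter> X) \<subseteq> ssum V W \<inter> X"
    using assms by (auto simp: ssum_def subspaces_def)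
  show "ssum V W \<inter> X \<subseteq> ssum V (W \<inter> X)"
  proof
    fix D assume "D \<in> ssum V W \<inter> X"
    then obtain A B where D: "A \<in> V" "B \<in> W" "D = A \<oplus> B" "A \<oplus> B \<in> X" by (auto simp: ssum_def)
    \<comment> \<open>\<open>A\<close> lies in \<open>X\<close> because
      \<open>V \<subseteq> X\<close>, and adding it to \<open>A \<oplus> B\<close> gives back
      \<open>B\<close>.\<close>
    then have "B \<in> X" using subspacesD(3)[OF assms(3), of A "A \<oplus> B"] assms(4) by auto
    then show "D \<in> ssum V (W \<inter> X)" using D by (auto simp: ssum_def)
  qed
qed

text \<open>The spans of finite subfamilies form a directed family, so their union \<open>?S\<close>
  is already a subspace. It contains every member of \<open>\<W>\<close>, hence the whole span.
  Compactness of lines will follow from this.\<close>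

lemma span_finitary:
  assumes "\<W> \<subseteq> subspaces G" "A \<in> span G (\<Union>\<W>)"
  obtains \<V> where "\<V> \<subseteq> \<W>" "finite \<V>" "A \<in> span G (\<Union>\<V>)"
proof -
  have F: "\<Union>\<W> \<subseteq> Fpow G" using assms(1) by (auto simp: subspaces_def)
  let ?S = "{A. \<exists>\<V>. \<V> \<subseteq> \<W> \<and> finite \<V> \<and> A \<in> span G (\<Union>\<V>)}"
  have "?S \<in> subspaces G"
    unfolding subspaces_def
  proof (intro CollectI conjI ballI subsetI)
    fix A assume "A \<in> ?S"
    then obtain \<V> where "\<V> \<subseteq> \<W>" "A \<in> span G (\<Union>\<V>)" by auto
    moreover from this F have "span G (\<Union>\<V>) \<in> subspaces G" by (intro span_subspaces) auto
    ultimately show "A \<in> Fpow G" using subspacesD(1) by blast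
  next
    show "\<exists>\<V>. \<V> \<subseteq> \<W> \<and> finite \<V> \<and> {} \<in> span G (\<Union>\<V>)"
      using subspacesD(2)[OF span_subspaces[of "{}" G]] by (intro exI[of _ "{}"]) auto
  next
    fix A B assume "A \<in> ?S" "B \<in> ?S"
    then obtain \<V> \<V>' where V: "\<V> \<subseteq> \<W>" "finite \<V>" "A \<in> span G (\<Union>\<V>)"
      "\<V>' \<subseteq> \<W>" "finite \<V>'" "B \<in> span G (\<Union>\<V>')" by auto
    have sub: "span G (\<Union>(\<V> \<union> \<V>')) \<in> subspaces G" using V F by (intro span_subspaces) auto
    have "A \<in> span G (\<Union>(\<V> \<union> \<V>'))" "B \<in> span G (\<Union>(\<V> \<union> \<V>'))"
      using V(3,6) by (auto simp: span_def)
    then have "A \<oplus> B \<in> span G (\<Union>(\<V> \<union> \<V>'))" using subspacesD(3)[OF sub] by blast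
    then show "\<exists>\<V>. \<V> \<subseteq> \<W> \<and> finite \<V> \<and> A \<oplus> B \<in> span G (\<Union>\<V>)"
      using V by (intro exI[of _ "\<V> \<union> \<V>'"]) auto
  qed
  moreover have "\<Union>\<W> \<subseteq> ?S"
  proof
    fix A assume "A \<in> \<Union>\<W>"
    then obtain W where "A \<in> W" "W \<in> \<W>" by auto
    then show "A \<in> ?S" using span_upper[of W G] by (intro CollectI exI[of _ "{W}"]) auto
  qed
  ultimately have "A \<in> ?S" using assms(2) span_least[of ?S G] by blast
  then show ?thesis using that by blast
qed


subsection \<open>Linear maps given by partial maps of bases\<close>

text \<open>The linear extension of the partial map \<open>\<phi>\<close> of basis vectors: the
  coefficient at \<open>b\<close> is counted modulo 2, and basis vectors on which
  \<open>\<phi>\<close> is undefined go to zero.\<close>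

definition lin :: "('g \<Rightarrow> 'h option) \<Rightarrow> 'g set \<Rightarrow> 'h set" where
  "lin \<phi> A = {b. odd (card {a \<in> A. \<phi> a = Some b})}"

lemma lin_empty [simp]: "lin \<phi> {} = {}"
  by (simp add: lin_def)

lemma lin_singleton: "lin \<phi> {a} = set_option (\<phi> a)"
proof -
  have "{x \<in> {a}. \<phi> x = Some b} = (if \<phi> a = Some b then {a} else {})" for b by auto
  then show ?thesis by (auto simp: lin_def)
qed

lemma lin_memD: "b \<in> lin \<phi> A \<Longrightarrow> \<exists>a\<in>A. \<phi> a = Some b"
  unfolding lin_def by (metis (mono_tags, lifting) card.empty empty_Collect_eq even_zero mem_Collect_eq)

lemma lin_xor:
  assumes "finite A" "finite B"
  shows "lin \<phi> (A \<oplus> B) = lin \<phi> A \<oplus> lin \<phi> B"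
proof -
  have "{a \<in> A \<oplus> B. \<phi> a = Some b} = {a \<in> A. \<phi> a = Some b} \<oplus> {a \<in> B. \<phi> a = Some b}" for b
    by (auto simp: xor_def)
  then show ?thesis using assms by (auto simp: lin_def odd_card_xor) (auto simp: xor_def)
qed

lemma finite_lin: "finite A \<Longrightarrow> finite (lin \<phi> A)"
  by (rule finite_subset[of _ "(\<lambda>a. the (\<phi> a)) ` A"]) (auto dest!: lin_memD intro: rev_image_eqI)

lemma lin_Fpow:
  assumes "\<And>a b. a \<in> G \<Longrightarrow> \<phi> a = Some b \<Longrightarrow> b \<in> H" "A \<in> Fpow G"
  shows "lin \<phi> A \<in> Fpow H"
  using assms finite_lin[of A \<phi>] by (auto simp: Fpow_def dest!: lin_memD)

lemma Fpow_induct [consumes 1, case_names empty add]: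
  assumes "A \<in> Fpow G" "P {}" "\<And>a A. a \<in> G \<Longrightarrow> A \<in> Fpow G \<Longrightarrow> P A \<Longrightarrow> P ({a} \<oplus> A)"
  shows "P A"
proof -
  have "finite A" "A \<subseteq> G" using assms(1) by (auto simp: Fpow_def)
  then show ?thesis
  proof (induction A)
    case (insert a A)
    then have "P ({a} \<oplus> A)" by (intro assms(3)) (auto simp: Fpow_def)
    then show ?case by (metis insert.hyps(2) insert_eq_xor)
  qed (rule assms(2))
qed

lemma lin_add: "A \<in> Fpow G \<Longrightarrow> lin \<phi> ({a} \<oplus> A) = set_option (\<phi> a) \<oplus> lin \<phi> A"
  by (simp add: lin_xor lin_singleton Fpow_def)

lemma lin_comp:
  assumes "\<And>a. a \<in> G \<Longrightarrow> \<chi> a = Option.bind (\<phi> a) \<psi>" "A \<in> Fpow G"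
  shows "lin \<psi> (lin \<phi> A) = lin \<chi> A"
  using assms(2)
proof (induction rule: Fpow_induct)
  case (add a A)
  have "lin \<psi> (set_option (\<phi> a)) = set_option (\<chi> a)"
    using assms(1)[OF add(1)] by (cases "\<phi> a") (simp_all add: lin_singleton)
  moreover have "finite (lin \<phi> A)" using add(2) by (simp add: Fpow_def finite_lin)
  ultimately show ?case by (simp add: lin_add[OF add(2)] lin_xor add(3))
qed simp

lemma lin_id:
  assumes "\<And>a. a \<in> G \<Longrightarrow> \<phi> a = Some a" "A \<in> Fpow G"
  shows "lin \<phi> A = A"
  using assms(2)
proof (induction rule: Fpow_induct)
  case (add a A)
  then show ?case by (simp add: lin_add[OF add(2)] assms(1))
qed simp

lemma lin_onto:
  assumes "\<And>b. b \<in> H \<Longrightarrow> \<exists>a\<in>G. \<phi> a = Some b" "B \<in> Fpow H"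
  shows "\<exists>A\<in>Fpow G. lin \<phi> A = B"
  using assms(2)
proof (induction rule: Fpow_induct)
  case empty
  then show ?case using empty_in_Fpow lin_empty by metis
next
  case (add b B)
  then obtain A a where A: "A \<in> Fpow G" "lin \<phi> A = B" "a \<in> G" "\<phi> a = Some b" using assms(1) by blast
  have "{a} \<oplus> A \<in> Fpow G" using A(1,3) by (intro xor_Fpow) (simp_all add: Fpow_def)
  moreover have "lin \<phi> ({a} \<oplus> A) = {b} \<oplus> B" by (simp add: lin_add[OF A(1)] A)
  ultimately show ?case by blast
qed

text \<open>Choosing a section of \<open>\<phi>\<close> gives a linear map \<open>s\<close> such that \<open>A - s (lin \<phi> A)\<close> lies in \<open>W\<close>
  for every basis vector \<open>A\<close>, hence for every vector.\<close>

lemma kernel_lin_subset: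
  assumes W: "W \<in> subspaces G"
    and undef: "\<And>a. a \<in> G \<Longrightarrow> \<phi> a = None \<Longrightarrow> {a} \<in> W"
    and merge: "\<And>a b c. a \<in> G \<Longrightarrow> b \<in> G \<Longrightarrow> \<phi> a = Some c \<Longrightarrow> \<phi> b = Some c \<Longrightarrow> {a} \<oplus> {b} \<in> W"
    and A: "A \<in> Fpow G" "lin \<phi> A = {}"
  shows "A \<in> W"
proof -
  define s where "s = (\<lambda>c. Some (SOME b. b \<in> G \<and> \<phi> b = Some c))"
  have "A \<oplus> lin s (lin \<phi> A) \<in> W"
    using A(1)
  proof (induction rule: Fpow_induct)
    case empty
    then show ?case using subspacesD(2)[OF W] by simp
  next
    case (add a A)
    have single: "{a} \<oplus> lin s (set_option (\<phi> a)) \<in> W"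
    proof (cases "\<phi> a")
      case None
      then show ?thesis using undef add by simp
    next
      case (Some c)
      then have "\<exists>b. b \<in> G \<and> \<phi> b = Some c" using add by blast
      from someI_ex[OF this] show ?thesis
        using merge[OF add(1) _ Some] Some by (simp add: s_def lin_singleton)
    qed
    have lin: "lin s (lin \<phi> ({a} \<oplus> A)) = lin s (set_option (\<phi> a)) \<oplus> lin s (lin \<phi> A)"
      using add(2) by (simp add: lin_add[OF add(2)] lin_xor finite_lin Fpow_def)
    have "{a} \<oplus> A \<oplus> lin s (lin \<phi> ({a} \<oplus> A)) =
        ({a} \<oplus> lin s (set_option (\<phi> a))) \<oplus> (A \<oplus> lin s (lin \<phi> A))"
      unfolding lin by (simp only: xor_ac)
    then show ?case using subspacesD(3)[OF W single add(3)] by simp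
  qed
  then show ?thesis using A(2) by simp
qed

lemma lin_image_subspaces:
  assumes "\<And>a b. a \<in> G \<Longrightarrow> \<phi> a = Some b \<Longrightarrow> b \<in> H" "W \<in> subspaces G"
  shows "lin \<phi> ` W \<in> subspaces H"
  unfolding subspaces_def
proof (intro CollectI conjI subsetI ballI)
  fix B assume "B \<in> lin \<phi> ` W"
  then obtain A where "A \<in> W" "B = lin \<phi> A" by blast
  then show "B \<in> Fpow H" using lin_Fpow[OF assms(1) subspacesD(1)[OF assms(2)]] by simp
next
  show "{} \<in> lin \<phi> ` W" using subspacesD(2)[OF assms(2)] by (rule rev_image_eqI) simp
next
  fix A B assume "A \<in> lin \<phi> ` W" "B \<in> lin \<phi> ` W"
  then obtain A' B' where A': "A' \<in> W" "B' \<in> W" "A = lin \<phi> A'" "B = lin \<phi> B'" by blast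
  then have "finite A'" "finite B'" using subspacesD(1)[OF assms(2)] by (auto simp: Fpow_def)
  then have "A \<oplus> B = lin \<phi> (A' \<oplus> B')" by (simp add: A' lin_xor)
  then show "A \<oplus> B \<in> lin \<phi> ` W" by (rule image_eqI) (rule subspacesD(3)[OF assms(2) A'(1,2)])
qed

lemma lin_preimage_subspaces:
  assumes "W \<in> subspaces H"
  shows "{A \<in> Fpow G. lin \<phi> A \<in> W} \<in> subspaces G"
proof -
  have "lin \<phi> (A \<oplus> B) = lin \<phi> A \<oplus> lin \<phi> B" if "A \<in> Fpow G" "B \<in> Fpow G" for A B
    using that by (simp add: Fpow_def lin_xor)
  then show ?thesis
    using subspacesD(2,3)[OF assms] by (auto simp: subspaces_def xor_Fpow empty_in_Fpow)
qed

text \<open>The linear algebra behind the first half of (N1): two vectors with the same image differ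
  by a kernel vector.\<close>

lemma lin_preimage_image:
  assumes "W \<in> subspaces G"
  shows "{A \<in> Fpow G. lin \<phi> A \<in> lin \<phi> ` W} = ssum W {A \<in> Fpow G. lin \<phi> A = {}}"
proof (intro equalityI subsetI)
  have lin: "lin \<phi> (A \<oplus> B) = lin \<phi> A \<oplus> lin \<phi> B" if "A \<in> Fpow G" "B \<in> Fpow G" for A B
    using that by (simp add: Fpow_def lin_xor)
  fix A
  {
    assume "A \<in> {A \<in> Fpow G. lin \<phi> A \<in> lin \<phi> ` W}"
    then obtain B where B: "A \<in> Fpow G" "B \<in> W" "lin \<phi> A = lin \<phi> B" by blast
    note BG = subspacesD(1)[OF assms B(2)]
    have "A \<oplus> B \<in> {A \<in> Fpow G. lin \<phi> A = {}}" using B(3) lin[OF B(1) BG] xor_Fpow[OF B(1) BG] by simp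
    moreover have "A = B \<oplus> (A \<oplus> B)" by (simp add: xor_ac)
    ultimately show "A \<in> ssum W {A \<in> Fpow G. lin \<phi> A = {}}" using B(2) unfolding ssum_def by blast
  next
    assume "A \<in> ssum W {A \<in> Fpow G. lin \<phi> A = {}}"
    then obtain B D where A: "A = B \<oplus> D" "B \<in> W" "D \<in> Fpow G" "lin \<phi> D = {}" by (auto simp: ssum_def)
    note BG = subspacesD(1)[OF assms A(2)]
    show "A \<in> {A \<in> Fpow G. lin \<phi> A \<in> lin \<phi> ` W}"
      using A(2) by (simp add: A(1) lin[OF BG A(3)] xor_Fpow[OF BG A(3)] A(4))
  }
qed

subsection \<open>Subspace lattices with coded elements\<close>

text \<open>Clusters have to be elements of \<open>'u\<close>, so the lattice of subspaces is
  transported to that type along an injection \<open>e\<close>.\<close>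

locale coded_subspaces =
  fixes e :: "'g set set \<Rightarrow> 'u" and G :: "'g set"
  assumes inj_code: "inj_on e (subspaces G)"
begin

definition decode :: "'u \<Rightarrow> 'g set set" where
  "decode = inv_into (subspaces G) e"

definition lat :: "'u gorder" where
  "lat = \<lparr>carrier = e ` subspaces G, eq = (=), le = (\<lambda>a b. decode a \<subseteq> decode b)\<rparr>"

lemma decode_code [simp]: "W \<in> subspaces G \<Longrightarrow> decode (e W) = W"
  by (simp add: decode_def inj_code)

lemma lat_simps [simp]: "carrier lat = e ` subspaces G" "eq lat = (=)"
  "a \<sqsubseteq>\<^bsub>lat\<^esub> b \<longleftrightarrow> decode a \<subseteq> decode b"
  by (simp_all add: lat_def)

lemma decode_subspaces: "a \<in> carrier lat \<Longrightarrow> decode a \<in> subspaces G"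
  by auto

lemma lat_partial_order: "partial_order lat"
  by unfold_locales auto

sublocale lat: partial_order lat
  by (rule lat_partial_order)

lemma least_Upper:
  assumes "A \<subseteq> carrier lat"
  shows "least lat (e (span G (\<Union>(decode ` A)))) (Upper lat A)"
proof -
  have "decode a \<subseteq> Fpow G" if "a \<in> A" for a
    using that assms decode_subspaces[of a] by (auto simp: subspaces_def)
  then have "\<Union>(decode ` A) \<subseteq> Fpow G" by blast
  note S = span_subspaces[OF this]
  have upper: "decode a \<subseteq> span G (\<Union>(decode ` A))" if "a \<in> A" for a
    using span_upper[of "\<Union>(decode ` A)" G] that by blast
  have least: "span G (\<Union>(decode ` A)) \<subseteq> decode x" if "x \<in> Upper lat A" for x
  proof (rule span_least)
    have "x \<in> carrier lat" using that by (simp add: Upper_def)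
    then show "decode x \<in> subspaces G" by (rule decode_subspaces)
    have "decode a \<subseteq> decode x" if "a \<in> A" for a
      using Upper_memD[OF \<open>x \<in> Upper lat A\<close> that assms] by simp
    then show "\<Union>(decode ` A) \<subseteq> decode x" by blast
  qed
  show ?thesis
  proof (rule least_UpperI)
    show "x \<sqsubseteq>\<^bsub>lat\<^esub> e (span G (\<Union>(decode ` A)))" if "x \<in> A" for x
      using upper[OF that] S by simp
    show "e (span G (\<Union>(decode ` A))) \<sqsubseteq>\<^bsub>lat\<^esub> x" if "x \<in> Upper lat A" for x
      using least[OF that] S by simp
  qed (use assms S in simp_all)
qed

lemma greatest_Lower:
  assumes "A \<subseteq> carrier lat" "A \<noteq> {}"
  shows "greatest lat (e (\<Inter>(decode ` A))) (Lower lat A)"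
proof -
  have S: "\<Inter>(decode ` A) \<in> subspaces G"
    using assms decode_subspaces by (intro subspaces_Inter) auto
  show ?thesis
  proof (rule greatest_LowerI)
    show "e (\<Inter>(decode ` A)) \<sqsubseteq>\<^bsub>lat\<^esub> x" if "x \<in> A" for x
      using that S by auto
    show "x \<sqsubseteq>\<^bsub>lat\<^esub> e (\<Inter>(decode ` A))" if "x \<in> Lower lat A" for x
      using that S assms by (auto simp: Lower_def)
  qed (use assms S in simp_all)
qed

lemma greatest_top: "greatest lat (e (Fpow G)) (carrier lat)"
proof -
  have "decode x \<subseteq> Fpow G" if "x \<in> carrier lat" for x
    using decode_subspaces[OF that] unfolding subspaces_def by blast
  then show ?thesis using subspaces_top[of G] by (simp add: greatest_def del: lat_simps(1)) simp
qed

lemma least_bot: "least lat (e {{}}) (carrier lat)"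
proof -
  have "{{}} \<subseteq> decode x" if "x \<in> carrier lat" for x
    using subspacesD(2)[OF decode_subspaces[OF that]] by blast
  then show ?thesis using subspaces_bot[of G] by (simp add: least_def del: lat_simps(1)) simp
qed

lemma lat_complete: "complete_lattice lat"
proof (rule lat.complete_latticeI)
  fix A assume A: "A \<subseteq> carrier lat"
  then show "\<exists>s. least lat s (Upper lat A)" using least_Upper by blast
  show "\<exists>i. greatest lat i (Lower lat A)"
  \<comment> \<open>The intersection of the empty family is the universal set rather than
    \<open>Fpow G\<close>, so the empty infimum is supplied by the top element.\<close>
  proof (cases "A = {}")
    case True
    then show ?thesis using greatest_top by (auto simp: Lower_def)
  next
    case False
    then show ?thesis using greatest_Lower[OF A] by blast
  qed
qed

sublocale lat: complete_lattice lat
  by (rule lat_complete)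

lemma lat_bounded: "bounded_lattice lat"
  by unfold_locales

lemma sup_lat:
  assumes "A \<subseteq> carrier lat"
  shows "\<Squnion>\<^bsub>lat\<^esub>A = e (span G (\<Union>(decode ` A)))"
  unfolding sup_def
  by (rule some_equality, rule least_Upper[OF assms], rule lat.least_unique, assumption, rule least_Upper[OF assms])

lemma top_lat: "\<top>\<^bsub>lat\<^esub> = e (Fpow G)"
  unfolding top_def
  by (rule some_equality, rule greatest_top, rule lat.greatest_unique, assumption, rule greatest_top)

lemma bottom_lat: "\<bottom>\<^bsub>lat\<^esub> = e {{}}"
  unfolding bottom_def
  by (rule some_equality, rule least_bot, rule lat.least_unique, assumption, rule least_bot)

lemma join_lat:
  assumes "V \<in> subspaces G" "W \<in> subspaces G"
  shows "e V \<squnion>\<^bsub>lat\<^esub> e W = e (ssum V W)"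
  using assms by (simp add: join_def sup_lat flip: span_Un)

lemma meet_lat:
  assumes "V \<in> subspaces G" "W \<in> subspaces G"
  shows "e V \<sqinter>\<^bsub>lat\<^esub> e W = e (V \<inter> W)"
proof -
  have "greatest lat (e (V \<inter> W)) (Lower lat {e V, e W})"
    using greatest_Lower[of "{e V, e W}"] assms by simp
  then show ?thesis
    unfolding meet_def inf_def by (intro some_equality) (auto intro: lat.greatest_unique)
qed

lemma lat_modular: "modular_lattice lat"
  unfolding modular_lattice_def
proof (intro conjI ballI impI)
  show "lattice lat" by unfold_locales
  fix x y z assume "x \<in> carrier lat" "y \<in> carrier lat" "z \<in> carrier lat" "x \<sqsubseteq>\<^bsub>lat\<^esub> z"
  then show "x \<squnion>\<^bsub>lat\<^esub> (y \<sqinter>\<^bsub>lat\<^esub> z) = (x \<squnion>\<^bsub>lat\<^esub> y) \<sqinter>\<^bsub>lat\<^esub> z"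
    by (auto simp: join_lat meet_lat subspaces_Int ssum_subspaces ssum_modular)
qed

lemma principal_subspaces: "A \<in> Fpow G \<Longrightarrow> {{}, A} \<in> subspaces G"
  by (auto simp: subspaces_def empty_in_Fpow)

text \<open>Over the two-element field the line through \<open>A\<close> is \<open>{{}, A}\<close>.
  Lying above it means containing the single vector \<open>A\<close>, and
  \<open>span_finitary\<close> places that vector in a finite join.\<close>

lemma principal_compact:
  assumes "A \<in> Fpow G"
  shows "compact_element lat (e {{}, A})"
  unfolding compact_element_def
proof (intro conjI allI impI)
  show "e {{}, A} \<in> carrier lat" using principal_subspaces[OF assms] by simp
  fix B assume B: "B \<subseteq> carrier lat \<and> e {{}, A} \<sqsubseteq>\<^bsub>lat\<^esub> \<Squnion>\<^bsub>lat\<^esub>B"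
  have F: "\<Union>(decode ` B') \<subseteq> Fpow G" if "B' \<subseteq> B" for B'
    using B decode_subspaces that by (force simp: subspaces_def)
  have dec: "decode ` B \<subseteq> subspaces G" using B decode_subspaces by blast
  have "A \<in> span G (\<Union>(decode ` B))"
    using B by (auto simp: sup_lat principal_subspaces[OF assms] span_subspaces[OF F])
  from span_finitary[OF dec this] obtain \<V> where V: "\<V> \<subseteq> decode ` B" "finite \<V>" "A \<in> span G (\<Union>\<V>)" .
  then obtain B' where B': "B' \<subseteq> B" "finite B'" "\<V> = decode ` B'" by (metis finite_subset_image)
  have "{} \<in> span G (\<Union>(decode ` B'))" using subspacesD(2)[OF span_subspaces[OF F[OF B'(1)]]] .
  moreover have "B' \<subseteq> carrier lat" using B B' by blast
  ultimately have "e {{}, A} \<sqsubseteq>\<^bsub>lat\<^esub> \<Squnion>\<^bsub>lat\<^esub>B'"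
    using V B' by (simp add: sup_lat principal_subspaces[OF assms] span_subspaces[OF F])
  then show "\<exists>B'\<subseteq>B. finite B' \<and> e {{}, A} \<sqsubseteq>\<^bsub>lat\<^esub> \<Squnion>\<^bsub>lat\<^esub>B'" using B' by blast
qed

lemma lat_algebraic: "complete_algebraic_lattice lat"
  unfolding complete_algebraic_lattice_def
proof (intro conjI ballI lat_complete)
  fix x assume x: "x \<in> carrier lat"
  then obtain W where W: "W \<in> subspaces G" "x = e W" by auto
  let ?A = "(\<lambda>A. e {{}, A}) ` W"
  have F: "{{}, A} \<in> subspaces G" if "A \<in> W" for A
    using subspacesD(1)[OF W(1) that] by (rule principal_subspaces)
  have "\<Union>(decode ` ?A) = W" using F subspacesD(2)[OF W(1)] by auto
  moreover have "span G W = W"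
    using span_upper[of W G] span_least[OF W(1) order_refl] by blast
  moreover have "?A \<subseteq> carrier lat" using F by auto
  ultimately have "x = \<Squnion>\<^bsub>lat\<^esub>?A" using W by (simp add: sup_lat)
  moreover have "\<forall>k\<in>?A. compact_element lat k"
    using principal_compact subspacesD(1)[OF W(1)] by blast
  ultimately show "\<exists>A. (\<forall>k\<in>A. compact_element lat k) \<and> x = \<Squnion>\<^bsub>lat\<^esub>A" by blast
qed

end


section \<open>Forms of subspaces\<close>

text \<open>A functor to sets and partial maps induces, through free vector spaces, an orean form
  satisfying (N1).\<close>

locale partial_action = category C
  for C :: "('o, 'm) cat" +
  fixes U :: "'u set set" and G :: "'o \<Rightarrow> 'g set" and \<phi> :: "'m \<Rightarrow> 'g \<Rightarrow> 'g option"
  assumes univ: "universe U"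
    and small_G: "X \<in> Obj C \<Longrightarrow> small U (G X)"
    and act_closed: "\<lbrakk>f \<in> homset C X Y; a \<in> G X; \<phi> f a = Some b\<rbrakk> \<Longrightarrow> b \<in> G Y"
    and act_idn: "\<lbrakk>X \<in> Obj C; a \<in> G X\<rbrakk> \<Longrightarrow> \<phi> (Idn C X) a = Some a"
    and act_cmp: "\<lbrakk>f \<in> homset C X Y; g \<in> homset C Y Z; a \<in> G X\<rbrakk>
           \<Longrightarrow> \<phi> (Cmp C g f) a = Option.bind (\<phi> f a) (\<phi> g)"
begin

text \<open>Such an injection exists because the subspaces form a subset of the double power set of
  the small set \<open>G X\<close>.\<close>

definition code :: "'o \<Rightarrow> 'g set set \<Rightarrow> 'u" where
  "code X = (SOME e. inj_on e (subspaces (G X)) \<and> e ` subspaces (G X) \<in> U)"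

abbreviation dec :: "'o \<Rightarrow> 'u \<Rightarrow> 'g set set" where
  "dec X \<equiv> coded_subspaces.decode (code X) (G X)"

definition F :: "('o, 'm, 'u) form" where
  "F = \<lparr>Fib = (\<lambda>X. coded_subspaces.lat (code X) (G X)),
        Dir = (\<lambda>f S. code (Cod C f) (lin (\<phi> f) ` dec (Dom C f) S)),
        Inv = (\<lambda>f T. code (Dom C f) {A \<in> Fpow (G (Dom C f)). lin (\<phi> f) A \<in> dec (Cod C f) T})\<rparr>"

lemma code:
  assumes "X \<in> Obj C"
  shows "inj_on (code X) (subspaces (G X)) \<and> code X ` subspaces (G X) \<in> U"
proof -
  have "subspaces (G X) \<subseteq> Pow (Pow (G X))" by (auto simp: subspaces_def Fpow_def)
  then have "small U (subspaces (G X))"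
    by (rule small_subset[OF univ small_Pow[OF univ small_Pow[OF univ small_G[OF assms]]]])
  then obtain B e where "B \<in> U" "bij_betw e (subspaces (G X)) B"
    unfolding small_def eqpoll_def by blast
  then have "\<exists>e. inj_on e (subspaces (G X)) \<and> e ` subspaces (G X) \<in> U" by (auto simp: bij_betw_def)
  then show ?thesis unfolding code_def by (rule someI_ex)
qed

lemma coded: "X \<in> Obj C \<Longrightarrow> coded_subspaces (code X) (G X)"
  by (simp add: coded_subspaces_def code)

lemma Fib_F: "Fib F X = coded_subspaces.lat (code X) (G X)"
  by (simp add: F_def)

lemma carrier_Fib: "X \<in> Obj C \<Longrightarrow> carrier (Fib F X) = code X ` subspaces (G X)"
  by (simp add: Fib_F coded_subspaces.lat_simps[OF coded])

lemma le_Fib: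
  assumes "X \<in> Obj C" "V \<in> subspaces (G X)" "W \<in> subspaces (G X)"
  shows "code X V \<sqsubseteq>\<^bsub>Fib F X\<^esub> code X W \<longleftrightarrow> V \<subseteq> W"
  using assms
  by (simp add: Fib_F coded_subspaces.lat_simps[OF coded] coded_subspaces.decode_code[OF coded])

lemma homset_obj: "f \<in> homset C X Y \<Longrightarrow> X \<in> Obj C" "f \<in> homset C X Y \<Longrightarrow> Y \<in> Obj C"
  using dom_obj cod_obj by (auto simp: homset_def)

lemma homsetD: "f \<in> homset C X Y \<Longrightarrow> Dom C f = X" "f \<in> homset C X Y \<Longrightarrow> Cod C f = Y"
  by (simp_all add: homset_def)

lemma image_subspaces:
  assumes "f \<in> homset C X Y" "W \<in> subspaces (G X)"
  shows "lin (\<phi> f) ` W \<in> subspaces (G Y)"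
  by (rule lin_image_subspaces[OF act_closed[OF assms(1)] assms(2)])

lemma Dir_code:
  assumes "f \<in> homset C X Y" "W \<in> subspaces (G X)"
  shows "Dir F f (code X W) = code Y (lin (\<phi> f) ` W)"
  using assms by (simp add: F_def homset_def coded_subspaces.decode_code[OF coded[OF homset_obj(1)[OF assms(1)]]])

lemma Inv_code:
  assumes "f \<in> homset C X Y" "W \<in> subspaces (G Y)"
  shows "Inv F f (code Y W) = code X {A \<in> Fpow (G X). lin (\<phi> f) A \<in> W}"
  using assms by (simp add: F_def homset_def coded_subspaces.decode_code[OF coded[OF homset_obj(2)[OF assms(1)]]])

definition ker :: "'m \<Rightarrow> 'g set set" where
  "ker f = {A \<in> Fpow (G (Dom C f)). lin (\<phi> f) A = {}}"

definition img :: "'m \<Rightarrow> 'g set set" where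
  "img f = lin (\<phi> f) ` Fpow (G (Dom C f))"

lemma ker_subspaces: "ker f \<in> subspaces (G (Dom C f))"
  using lin_preimage_subspaces[OF subspaces_bot] by (simp add: ker_def)

lemma img_subspaces:
  assumes "f \<in> homset C X Y"
  shows "img f \<in> subspaces (G Y)"
  unfolding img_def homsetD[OF assms] by (rule image_subspaces[OF assms subspaces_top])

lemma Ker_code:
  assumes "f \<in> homset C X Y"
  shows "Ker C F f = code X (ker f)"
  unfolding Ker_def Fib_F ker_def homsetD[OF assms]
    coded_subspaces.bottom_lat[OF coded[OF homset_obj(2)[OF assms]]]
  by (simp add: Inv_code[OF assms subspaces_bot])

lemma Im_code:
  assumes "f \<in> homset C X Y"
  shows "Im C F f = code Y (img f)"
  unfolding Im_def Fib_F img_def homsetD[OF assms]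
    coded_subspaces.top_lat[OF coded[OF homset_obj(1)[OF assms]]]
  by (rule Dir_code[OF assms subspaces_top])

lemma lin_cmp:
  assumes "f \<in> homset C X Y" "g \<in> homset C Y Z" "A \<in> Fpow (G X)"
  shows "lin (\<phi> (Cmp C g f)) A = lin (\<phi> g) (lin (\<phi> f) A)"
  by (rule lin_comp[OF act_cmp[OF assms(1,2)] assms(3), symmetric])

lemma lin_closed:
  assumes "f \<in> homset C X Y" "A \<in> Fpow (G X)"
  shows "lin (\<phi> f) A \<in> Fpow (G Y)"
  by (rule lin_Fpow[OF act_closed[OF assms(1)] assms(2)])

lemma ker_cmp_subset:
  assumes "f \<in> homset C X Y" "g \<in> homset C Y Z"
  shows "ker f \<subseteq> ker (Cmp C g f)"
proof
  fix A assume "A \<in> ker f"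
  then have "A \<in> Fpow (G X)" "lin (\<phi> f) A = {}" by (simp_all add: ker_def homsetD[OF assms(1)])
  then show "A \<in> ker (Cmp C g f)"
    by (simp add: ker_def homsetD[OF cmp_hom[OF assms]] lin_cmp[OF assms])
qed

lemma orean: "orean_form C U F"
proof (intro orean_form.intro orean_form_axioms.intro category_axioms)
  fix X assume X: "X \<in> Obj C"
  show "carrier (Fib F X) \<in> U" using code[OF X] by (simp add: carrier_Fib[OF X])
  show "bounded_lattice (Fib F X)" unfolding Fib_F by (rule coded_subspaces.lat_bounded[OF coded[OF X]])
  fix S assume "S \<in> carrier (Fib F X)"
  then obtain W where W: "W \<in> subspaces (G X)" "S = code X W" unfolding carrier_Fib[OF X] by blast
  have id: "lin (\<phi> (Idn C X)) A = A" if "A \<in> Fpow (G X)" for A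
    using lin_id[OF act_idn[OF X] that] by simp
  have "lin (\<phi> (Idn C X)) ` W = W" using id subspacesD(1)[OF W(1)] by force
  then show "Dir F (Idn C X) S = S" by (simp add: W Dir_code[OF idn_hom[OF X]])
  have "{A \<in> Fpow (G X). lin (\<phi> (Idn C X)) A \<in> W} = W"
    using id subspacesD(1)[OF W(1)] by force
  then show "Inv F (Idn C X) S = S" by (simp add: W Inv_code[OF idn_hom[OF X]])
next
  fix f X Y assume f: "f \<in> homset C X Y"
  note X = homset_obj(1)[OF f] and Y = homset_obj(2)[OF f]
  note pre = lin_preimage_subspaces[of _ "G Y" "G X" "\<phi> f"]
  {
    fix S assume "S \<in> carrier (Fib F X)"
    then obtain W where W: "W \<in> subspaces (G X)" "S = code X W" unfolding carrier_Fib[OF X] by blast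
    show "Dir F f S \<in> carrier (Fib F Y)"
      using image_subspaces[OF f W(1)] by (simp add: W Dir_code[OF f] carrier_Fib[OF Y])
    {
      fix S' assume "S' \<in> carrier (Fib F X)" and le: "S \<sqsubseteq>\<^bsub>Fib F X\<^esub> S'"
      then obtain W' where W': "W' \<in> subspaces (G X)" "S' = code X W'" unfolding carrier_Fib[OF X] by blast
      have "W \<subseteq> W'" using le by (simp add: W W' le_Fib[OF X])
      then show "Dir F f S \<sqsubseteq>\<^bsub>Fib F Y\<^esub> Dir F f S'"
        by (simp add: W W' Dir_code[OF f] le_Fib[OF Y] image_subspaces[OF f] image_mono)
    next
      fix T assume "T \<in> carrier (Fib F Y)"
      then obtain V where V: "V \<in> subspaces (G Y)" "T = code Y V" unfolding carrier_Fib[OF Y] by blast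
      have "lin (\<phi> f) ` W \<subseteq> V \<longleftrightarrow> W \<subseteq> {A \<in> Fpow (G X). lin (\<phi> f) A \<in> V}"
        using subspacesD(1)[OF W(1)] by blast
      then show "Dir F f S \<sqsubseteq>\<^bsub>Fib F Y\<^esub> T \<longleftrightarrow> S \<sqsubseteq>\<^bsub>Fib F X\<^esub> Inv F f T"
        by (simp add: W V Dir_code[OF f] Inv_code[OF f] le_Fib[OF X] le_Fib[OF Y] image_subspaces[OF f] pre)
    next
      fix g Z assume g: "g \<in> homset C Y Z"
      have "lin (\<phi> (Cmp C g f)) ` W = lin (\<phi> g) ` lin (\<phi> f) ` W"
        unfolding image_image by (rule image_cong[OF refl lin_cmp[OF f g subspacesD(1)[OF W(1)]]])
      then show "Dir F (Cmp C g f) S = Dir F g (Dir F f S)"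
        by (simp add: W Dir_code[OF f] Dir_code[OF g] Dir_code[OF cmp_hom[OF f g]] image_subspaces[OF f])
    }
  next
    fix T assume "T \<in> carrier (Fib F Y)"
    then obtain V where V: "V \<in> subspaces (G Y)" "T = code Y V" unfolding carrier_Fib[OF Y] by blast
    show "Inv F f T \<in> carrier (Fib F X)"
      using pre[OF V(1)] by (simp add: V Inv_code[OF f] carrier_Fib[OF X])
    fix T' assume "T' \<in> carrier (Fib F Y)" and le: "T \<sqsubseteq>\<^bsub>Fib F Y\<^esub> T'"
    then obtain V' where V': "V' \<in> subspaces (G Y)" "T' = code Y V'" unfolding carrier_Fib[OF Y] by blast
    have "V \<subseteq> V'" using le by (simp add: V V' le_Fib[OF Y])
    then show "Inv F f T \<sqsubseteq>\<^bsub>Fib F X\<^esub> Inv F f T'"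
      by (simp add: V V' Inv_code[OF f] le_Fib[OF X] pre) blast
  next
    fix g Z T assume g: "g \<in> homset C Y Z" and "T \<in> carrier (Fib F Z)"
    then obtain V where V: "V \<in> subspaces (G Z)" "T = code Z V"
      unfolding carrier_Fib[OF homset_obj(2)[OF g]] by blast
    have "{A \<in> Fpow (G X). lin (\<phi> (Cmp C g f)) A \<in> V} =
        {A \<in> Fpow (G X). lin (\<phi> f) A \<in> {B \<in> Fpow (G Y). lin (\<phi> g) B \<in> V}}"
      using lin_cmp[OF f g] lin_closed[OF f] by auto
    then show "Inv F (Cmp C g f) T = Inv F f (Inv F g T)"
      using V by (simp add: Inv_code[OF f] Inv_code[OF g] Inv_code[OF cmp_hom[OF f g]] lin_preimage_subspaces)
  }
qed

section \<open>Joins, meets and the identities (N1)\<close>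

lemma join_Fib:
  assumes "X \<in> Obj C" "V \<in> subspaces (G X)" "W \<in> subspaces (G X)"
  shows "code X V \<squnion>\<^bsub>Fib F X\<^esub> code X W = code X (ssum V W)"
  unfolding Fib_F by (rule coded_subspaces.join_lat[OF coded[OF assms(1)] assms(2,3)])

lemma meet_Fib:
  assumes "X \<in> Obj C" "V \<in> subspaces (G X)" "W \<in> subspaces (G X)"
  shows "code X V \<sqinter>\<^bsub>Fib F X\<^esub> code X W = code X (V \<inter> W)"
  unfolding Fib_F by (rule coded_subspaces.meet_lat[OF coded[OF assms(1)] assms(2,3)])

lemma Inv_Dir:
  assumes f: "f \<in> homset C X Y" and "S \<in> carrier (Fib F X)"
  shows "Inv F f (Dir F f S) = S \<squnion>\<^bsub>Fib F X\<^esub> Ker C F f"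
proof -
  note X = homset_obj(1)[OF f]
  obtain W where W: "W \<in> subspaces (G X)" "S = code X W"
    using assms(2) unfolding carrier_Fib[OF X] by blast
  have D: "Dom C f = X" using f by (simp add: homset_def)
  show ?thesis
    using ker_subspaces[of f] lin_preimage_image[OF W(1), of "\<phi> f"]
    by (simp add: W Dir_code[OF f] Inv_code[OF f] Ker_code[OF f] image_subspaces[OF f] join_Fib[OF X] D ker_def)
qed

lemma Dir_Inv:
  assumes f: "f \<in> homset C X Y" and "T \<in> carrier (Fib F Y)"
  shows "Dir F f (Inv F f T) = T \<sqinter>\<^bsub>Fib F Y\<^esub> Im C F f"
proof -
  note Y = homset_obj(2)[OF f]
  obtain W where W: "W \<in> subspaces (G Y)" "T = code Y W"
    using assms(2) unfolding carrier_Fib[OF Y] by blast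
  have D: "Dom C f = X" using f by (simp add: homset_def)
  have "lin (\<phi> f) ` {A \<in> Fpow (G X). lin (\<phi> f) A \<in> W} = W \<inter> img f"
    unfolding img_def D by blast
  then show ?thesis
    using lin_preimage_subspaces[OF W(1), of "G X" "\<phi> f"]
    by (simp add: W Dir_code[OF f] Inv_code[OF f] Im_code[OF f] img_subspaces[OF f] meet_Fib[OF Y])
qed

lemma Fib_algebraic: "X \<in> Obj C \<Longrightarrow> complete_algebraic_lattice (Fib F X)"
  unfolding Fib_F by (rule coded_subspaces.lat_algebraic[OF coded])

lemma Fib_modular: "X \<in> Obj C \<Longrightarrow> modular_lattice (Fib F X)"
  unfolding Fib_F by (rule coded_subspaces.lat_modular[OF coded])

text \<open>With \<open>img_cmp_epi\<close>, this compares a homomorphism with the two halves of its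
  image factorization: an injective second half leaves the kernel alone, a surjective first half
  leaves the image alone.\<close>

lemma ker_cmp_mono:
  assumes f: "f \<in> homset C X Y" and g: "g \<in> homset C Y Z" and "ker g = {{}}"
  shows "ker (Cmp C g f) = ker f"
proof -
  have "lin (\<phi> g) B = {} \<longleftrightarrow> B = {}" if "B \<in> Fpow (G Y)" for B
  proof
    assume "lin (\<phi> g) B = {}"
    then have "B \<in> ker g" using that by (simp add: ker_def homsetD[OF g])
    then show "B = {}" by (simp add: assms(3))
  qed simp
  from this[OF lin_closed[OF f]] show ?thesis
    unfolding ker_def homsetD[OF f] homsetD[OF cmp_hom[OF f g]]
    by (intro Collect_cong conj_cong refl) (simp add: lin_cmp[OF f g])
qed

lemma img_cmp_epi:
  assumes f: "f \<in> homset C X Y" and g: "g \<in> homset C Y Z" and "img f = Fpow (G Y)"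
  shows "img (Cmp C g f) = img g"
proof -
  have "lin (\<phi> (Cmp C g f)) ` Fpow (G X) = lin (\<phi> g) ` lin (\<phi> f) ` Fpow (G X)"
    unfolding image_image by (rule image_cong[OF refl lin_cmp[OF f g]])
  then show ?thesis
    using assms(3) unfolding img_def homsetD[OF f] homsetD[OF g] homsetD[OF cmp_hom[OF f g]] by simp
qed

end


section \<open>Models of Horn rules\<close>

definition pullback :: "('s \<Rightarrow> nat) \<Rightarrow> ('a \<Rightarrow> 'b) \<Rightarrow> 'a set \<Rightarrow> ('b, 's) struct \<Rightarrow> ('a, 's) struct" where
  "pullback ar \<tau> D B = \<lparr>base = D, interp = (\<lambda>R. {t \<in> tuples D (ar R). map \<tau> t \<in> interp B R})\<rparr>"

lemma pullback_simps [simp]: "base (pullback ar \<tau> D B) = D"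
  "interp (pullback ar \<tau> D B) R = {t \<in> tuples D (ar R). map \<tau> t \<in> interp B R}"
  by (simp_all add: pullback_def)

definition full :: "'s set \<Rightarrow> ('s \<Rightarrow> nat) \<Rightarrow> 'a set \<Rightarrow> ('a, 's) struct" where
  "full \<Sigma> ar D = \<lparr>base = D, interp = (\<lambda>R. if R \<in> \<Sigma> then tuples D (ar R) else {})\<rparr>"

lemma full_simps [simp]: "base (full \<Sigma> ar D) = D"
  "interp (full \<Sigma> ar D) R = (if R \<in> \<Sigma> then tuples D (ar R) else {})"
  by (simp_all add: full_def)

text \<open>The map is given by its graph, so that its image along a homomorphism makes sense before
  it is known to be single-valued. A list \<open>w\<close> of pairs from the graph holds a tuple and
  its value at once, as \<open>map fst w\<close> and \<open>map snd w\<close>.\<close>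

definition partial_hom :: "('a, 's) struct \<Rightarrow> ('a \<times> 'b) set \<Rightarrow> ('b, 's) struct \<Rightarrow> bool" where
  "partial_hom A p Z \<longleftrightarrow> finite p \<and> p \<subseteq> base A \<times> base Z \<and> single_valued p \<and>
     (\<forall>R w. set w \<subseteq> p \<longrightarrow> map fst w \<in> interp A R \<longrightarrow> map snd w \<in> interp Z R)"

text \<open>Both single-valuedness and preservation can be tested after applying \<open>f\<close>.
  Used for the second of two homomorphisms, this shows that a generator surviving the composite
  survives the first one; functoriality of \<open>act\<close> rests on it.\<close>

lemma partial_hom_vimage:
  assumes "\<And>R t. t \<in> interp A R \<Longrightarrow> map f t \<in> interp B R"
    and "finite p" "p \<subseteq> base A \<times> base Z" "partial_hom B (map_prod f id ` p) Z"
  shows "partial_hom A p Z"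
  unfolding partial_hom_def
proof (intro conjI allI impI assms(2,3))
  have "single_valued (map_prod f id ` p)" using assms(4) by (simp add: partial_hom_def)
  then show "single_valued p" by (force simp: single_valued_def)
  fix R w assume w: "set w \<subseteq> p" "map fst w \<in> interp A R"
  have "set (map (map_prod f id) w) \<subseteq> map_prod f id ` p" using w(1) by auto
  moreover have "map fst (map (map_prod f id) w) \<in> interp B R"
    using assms(1)[OF w(2)] by (simp add: comp_def)
  ultimately have "map snd (map (map_prod f id) w) \<in> interp Z R"
    using assms(4) unfolding partial_hom_def by blast
  then show "map snd w \<in> interp Z R" by (simp add: comp_def)
qed

locale horn_theory =
  fixes U :: "'u set set" and \<Sigma> :: "'s set" and ar :: "'s \<Rightarrow> nat"
    and \<H> :: "('s, 'v) horn_rule set"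
  assumes univ: "universe U" and small_sig: "small U \<Sigma>"
    and ar_pos: "R \<in> \<Sigma> \<Longrightarrow> 0 < ar R"
    and wf: "r \<in> \<H> \<Longrightarrow> wf_rule \<Sigma> ar r"
    and prem_vars: "r \<in> \<H> \<Longrightarrow> (R, ts) \<in> set (prems r) \<Longrightarrow> set ts \<subseteq> set (snd (concl r))"
begin

abbreviation M :: "(('u, 's) struct, ('u, 's) struct_arr) cat" where
  "M \<equiv> Mod U \<Sigma> ar \<H>"

text \<open>Stated for an arbitrary base type, as both models on \<open>'u\<close> and targets on
  the natural numbers occur.\<close>

definition model :: "('a, 's) struct \<Rightarrow> bool" where
  "model A \<longleftrightarrow> (\<forall>R\<in>\<Sigma>. interp A R \<subseteq> tuples (base A) (ar R)) \<and> (\<forall>R. R \<notin> \<Sigma> \<longrightarrow> interp A R = {}) \<and>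
     (\<forall>r\<in>\<H>. holds A r)"

lemma modelD:
  assumes "model A" "t \<in> interp A R"
  shows "R \<in> \<Sigma>" "set t \<subseteq> base A" "length t = ar R"
  using assms by (auto simp: model_def tuples_def)

lemma wf_concl:
  assumes "r \<in> \<H>" "concl r = (S, ts)"
  shows "S \<in> \<Sigma>" "length ts = ar S" "set ts \<subseteq> set (context_vars r)"
  using wf[OF assms(1)] assms(2) by (auto simp: wf_rule_def)

lemma model_holds:
  assumes "model A" "r \<in> \<H>" "concl r = (S, ts)" "\<sigma> ` set (context_vars r) \<subseteq> base A"
    "\<And>R ts'. (R, ts') \<in> set (prems r) \<Longrightarrow> map \<sigma> ts' \<in> interp A R"
  shows "map \<sigma> ts \<in> interp A S"
proof -
  have "holds A r" using assms(1,2) by (simp add: model_def)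
  moreover have "\<forall>(R, ts)\<in>set (prems r). map \<sigma> ts \<in> interp A R" using assms(5) by blast
  ultimately show ?thesis using assms(3,4) unfolding holds_def by (metis case_prod_conv)
qed

lemma modelI:
  assumes "\<And>R t. t \<in> interp A R \<Longrightarrow> R \<in> \<Sigma> \<and> t \<in> tuples (base A) (ar R)"
    and "\<And>r S ts \<sigma>. \<lbrakk>r \<in> \<H>; concl r = (S, ts); \<sigma> ` set (context_vars r) \<subseteq> base A;
      \<And>R ts'. (R, ts') \<in> set (prems r) \<Longrightarrow> map \<sigma> ts' \<in> interp A R\<rbrakk> \<Longrightarrow> map \<sigma> ts \<in> interp A S"
  shows "model A"
proof -
  have "holds A r" if "r \<in> \<H>" for r
    unfolding holds_def
  proof (intro allI impI)
    fix \<sigma> assume \<sigma>: "\<sigma> ` set (context_vars r) \<subseteq> base A" "\<forall>(R, ts)\<in>set (prems r). map \<sigma> ts \<in> interp A R"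
    obtain S ts where "concl r = (S, ts)" by (cases "concl r")
    moreover from assms(2)[OF that this \<sigma>(1)] \<sigma>(2) have "map \<sigma> ts \<in> interp A S" by blast
    ultimately show "case concl r of (S, ts) \<Rightarrow> map \<sigma> ts \<in> interp A S" by simp
  qed
  moreover have "interp A R = {}" if "R \<notin> \<Sigma>" for R using assms(1) that by blast
  moreover have "interp A R \<subseteq> tuples (base A) (ar R)" for R using assms(1) by blast
  ultimately show ?thesis by (simp add: model_def)
qed

text \<open>Rules contain no equality, so \<open>\<tau>\<close> may identify elements: an assignment
  \<open>\<sigma>\<close> into \<open>D\<close> is judged by \<open>\<tau> \<circ> \<sigma>\<close>
  in \<open>B\<close>.\<close>

lemma model_pullback:
  assumes "model B" "\<tau> ` D \<subseteq> base B"
  shows "model (pullback ar \<tau> D B)"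
proof (rule modelI)
  fix R t assume "t \<in> interp (pullback ar \<tau> D B) R"
  then show "R \<in> \<Sigma> \<and> t \<in> tuples (base (pullback ar \<tau> D B)) (ar R)"
    using modelD(1)[OF assms(1), of "map \<tau> t" R] by simp
next
  fix r S ts \<sigma>
  assume r: "r \<in> \<H>" "concl r = (S, ts)"
    and \<sigma>: "\<sigma> ` set (context_vars r) \<subseteq> base (pullback ar \<tau> D B)"
    and prems: "\<And>R ts'. (R, ts') \<in> set (prems r) \<Longrightarrow> map \<sigma> ts' \<in> interp (pullback ar \<tau> D B) R"
  have "map (\<tau> \<circ> \<sigma>) ts \<in> interp B S"
  proof (rule model_holds[OF assms(1) r])
    show "(\<tau> \<circ> \<sigma>) ` set (context_vars r) \<subseteq> base B" using assms(2) \<sigma> by fastforce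
    show "map (\<tau> \<circ> \<sigma>) ts' \<in> interp B R" if "(R, ts') \<in> set (prems r)" for R ts'
      using prems[OF that] by simp
  qed
  moreover have "map \<sigma> ts \<in> tuples D (ar S)"
    using wf_concl[OF r] \<sigma> by (auto simp: tuples_def)
  ultimately show "map \<sigma> ts \<in> interp (pullback ar \<tau> D B) S" by simp
qed

lemma model_full: "model (full \<Sigma> ar D)"
proof (rule modelI)
  fix R t assume "t \<in> interp (full \<Sigma> ar D) R"
  then show "R \<in> \<Sigma> \<and> t \<in> tuples (base (full \<Sigma> ar D)) (ar R)" by (simp split: if_splits)
next
  fix r S ts \<sigma>
  assume r: "r \<in> \<H>" "concl r = (S, ts)"
    and \<sigma>: "\<sigma> ` set (context_vars r) \<subseteq> base (full \<Sigma> ar D)"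
  show "map \<sigma> ts \<in> interp (full \<Sigma> ar D) S" using wf_concl[OF r] \<sigma> by (auto simp: tuples_def)
qed

section \<open>The category of models\<close>

lemma Obj_M: "A \<in> Obj M \<longleftrightarrow> base A \<in> U \<and> model A"
  by (auto simp: Mod_def Let_def structures_def model_def)

definition hom :: "('u, 's) struct \<Rightarrow> ('u, 's) struct \<Rightarrow> ('u \<Rightarrow> 'u) \<Rightarrow> bool" where
  "hom A B f \<longleftrightarrow> A \<in> Obj M \<and> B \<in> Obj M \<and> f \<in> base A \<rightarrow>\<^sub>E base B \<and>
     (\<forall>R t. t \<in> interp A R \<longrightarrow> map f t \<in> interp B R)"

lemma homD:
  assumes "hom A B f"
  shows "A \<in> Obj M" "B \<in> Obj M" "model A" "model B" "f \<in> base A \<rightarrow>\<^sub>E base B"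
    "x \<in> base A \<Longrightarrow> f x \<in> base B" "t \<in> interp A R \<Longrightarrow> map f t \<in> interp B R"
  using assms by (auto simp: hom_def Obj_M)

lemma Arr_M: "(A, f, B) \<in> Arr M \<longleftrightarrow> hom A B f"
proof -
  have "(\<forall>R\<in>\<Sigma>. \<forall>t\<in>interp A R. map f t \<in> interp B R) \<longleftrightarrow> (\<forall>R t. t \<in> interp A R \<longrightarrow> map f t \<in> interp B R)"
    if "model A" using modelD(1)[OF that] by blast
  moreover have "(A, f, B) \<in> Arr M \<longleftrightarrow> A \<in> Obj M \<and> B \<in> Obj M \<and> homomorphism \<Sigma> A B f"
    by (simp add: Mod_def Let_def)
  ultimately show ?thesis by (auto simp: hom_def homomorphism_def Obj_M)
qed

lemma M_simps [simp]: "Dom M (A, f, B) = A" "Cod M (A, f, B) = B" "Idn M A = (A, restrict id (base A), A)"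
  "Cmp M (B, g, D) (A, f, B') = (A, compose (base A) g f, D)"
  by (simp_all add: Mod_def Let_def)

lemma homset_M: "h \<in> homset M A B \<longleftrightarrow> (\<exists>f. h = (A, f, B) \<and> hom A B f)"
  by (cases h) (auto simp: homset_def Arr_M)

lemma homset_homI: "hom A B f \<Longrightarrow> (A, f, B) \<in> homset M A B"
  by (simp add: homset_M)

lemma map_compose: "set t \<subseteq> A \<Longrightarrow> map (compose A g f) t = map g (map f t)"
  by (auto simp: compose_eq)

lemma hom_compose: "hom A B f \<Longrightarrow> hom B D g \<Longrightarrow> hom A D (compose (base A) g f)"
proof -
  assume f: "hom A B f" and g: "hom B D g"
  have "map (compose (base A) g f) t \<in> interp D R" if "t \<in> interp A R" for R t
    unfolding map_compose[OF modelD(2)[OF homD(3)[OF f] that]] by (rule homD(7)[OF g homD(7)[OF f that]])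
  moreover have "compose (base A) g f \<in> base A \<rightarrow>\<^sub>E base D"
    using homD(6)[OF f] homD(6)[OF g] by (auto simp: compose_def)
  ultimately show ?thesis using f g by (simp add: hom_def)
qed

lemma hom_id: "A \<in> Obj M \<Longrightarrow> hom A A (restrict id (base A))"
proof -
  assume A: "A \<in> Obj M"
  have "map (restrict id (base A)) t = t" if "t \<in> interp A R" for R t
    using modelD(2)[OF _ that] A by (intro map_idI) (auto simp: Obj_M)
  then show ?thesis using A by (auto simp: hom_def)
qed

lemma category_M: "category M"
proof
  fix h assume h: "h \<in> Arr M"
  obtain A f B where "h = (A, f, B)" by (cases h)
  then show "Dom M h \<in> Obj M" "Cod M h \<in> Obj M" using h homD(1,2) by (auto simp: Arr_M)
next
  fix A assume "A \<in> Obj M"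
  then show "Idn M A \<in> homset M A A" using hom_id by (simp add: homset_M)
next
  fix h k A B D assume "h \<in> homset M A B" "k \<in> homset M B D"
  then show "Cmp M k h \<in> homset M A D" using hom_compose by (auto simp: homset_M)
next
  fix h A B assume "h \<in> homset M A B"
  then obtain f where f: "h = (A, f, B)" "hom A B f" by (auto simp: homset_M)
  have "compose (base A) f (restrict id (base A)) = f" "compose (base A) (restrict id (base B)) f = f"
    using homD(5)[OF f(2)] by (auto simp: compose_def fun_eq_iff extensional_def PiE_iff)
  then show "Cmp M h (Idn M A) = h" "Cmp M (Idn M B) h = h" using f(1) by simp_all
next
  fix h k l A B D E assume "h \<in> homset M A B" "k \<in> homset M B D" "l \<in> homset M D E"
  then obtain f g j where f: "h = (A, f, B)" "k = (B, g, D)" "l = (D, j, E)" "hom A B f"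
    by (auto simp: homset_M)
  have "compose (base A) j (compose (base A) g f) = compose (base A) (compose (base B) j g) f"
    using homD(6)[OF f(4)] by (auto simp: compose_def fun_eq_iff)
  then show "Cmp M l (Cmp M k h) = Cmp M (Cmp M l k) h" using f by simp
qed


subsection \<open>Partial homomorphisms into finite models\<close>

text \<open>Fixed bases of natural numbers keep the targets set-sized. Size 1 is there for
  \<open>pt\<close>, which separates elements; the sizes \<open>ar R\<close> are there for
  \<open>gens_detect\<close>, where the positions of a tuple form the target.\<close>

definition targets :: "(nat, 's) struct set" where
  "targets = {Z. model Z \<and> (\<exists>n\<in>insert 1 (ar ` \<Sigma>). base Z = {..<n})}"

definition gens :: "('u, 's) struct \<Rightarrow> (('u \<times> nat) set \<times> (nat, 's) struct) set" where
  "gens A = {(p, Z). Z \<in> targets \<and> partial_hom A p Z}"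

definition act :: "('u, 's) struct_arr \<Rightarrow> ('u \<times> nat) set \<times> (nat, 's) struct \<Rightarrow>
    (('u \<times> nat) set \<times> (nat, 's) struct) option" where
  "act = (\<lambda>(A, f, B) (p, Z). if (map_prod f id ` p, Z) \<in> gens B then Some (map_prod f id ` p, Z) else None)"

lemma act_Some: "act (A, f, B) (p, Z) = Some c \<longleftrightarrow> c = (map_prod f id ` p, Z) \<and> c \<in> gens B"
  by (auto simp: act_def)

lemma act_None: "act (A, f, B) (p, Z) = None \<longleftrightarrow> (map_prod f id ` p, Z) \<notin> gens B"
  by (simp add: act_def)

lemma gensD:
  assumes "(p, Z) \<in> gens A"
  shows "Z \<in> targets" "finite p" "p \<subseteq> base A \<times> base Z" "single_valued p"
    "set w \<subseteq> p \<Longrightarrow> map fst w \<in> interp A R \<Longrightarrow> map snd w \<in> interp Z R"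
  using assms by (auto simp: gens_def partial_hom_def)

lemma gens_vimage:
  assumes "hom A B f" "finite p" "p \<subseteq> base A \<times> base Z" "(map_prod f id ` p, Z) \<in> gens B"
  shows "(p, Z) \<in> gens A"
  using assms partial_hom_vimage[of A f B p Z] homD(7)[OF assms(1)] by (simp add: gens_def)

text \<open>On a fixed base a model is determined by the graph of \<open>interp\<close>, a subset of
  the disjoint union of the sets of tuples over all symbols.\<close>

lemma small_models: "small U {Z. model Z \<and> base Z = {..<n::nat}}"
proof -
  let ?h = "\<lambda>Z. {(R, t). t \<in> interp Z R}"
  have "inj_on ?h {Z. model Z \<and> base Z = {..<n}}"
  proof (rule inj_onI)
    fix Y Z :: "(nat, 's) struct" assume *: "Y \<in> {Z. model Z \<and> base Z = {..<n}}" "Z \<in> {Z. model Z \<and> base Z = {..<n}}" "?h Y = ?h Z"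
    have "t \<in> interp Y R \<longleftrightarrow> t \<in> interp Z R" for R t using *(3) by (metis (mono_tags, lifting) case_prodI case_prodD mem_Collect_eq)
    then have "interp Y = interp Z" by blast
    then show "Y = Z" using * by simp
  qed
  moreover have "?h ` {Z. model Z \<and> base Z = {..<n}} \<subseteq> Pow (\<Union>R\<in>\<Sigma>. Pair R ` tuples {..<n} (ar R))"
  proof -
    have "(R, t) \<in> (\<Union>R\<in>\<Sigma>. Pair R ` tuples {..<n} (ar R))"
      if "model Z" "base Z = {..<n}" "t \<in> interp Z R" for Z R t
      using modelD[OF that(1,3)] that(2) by (auto simp: tuples_def)
    then show ?thesis by blast
  qed
  ultimately have lepoll: "{Z. model Z \<and> base Z = {..<n}} \<lesssim> Pow (\<Union>R\<in>\<Sigma>. Pair R ` tuples {..<n} (ar R))"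
    unfolding lepoll_def by (intro exI[of _ ?h] conjI)
  have "small U (Pair R ` tuples {..<n} (ar R))" for R :: 's
    by (rule small_image[OF univ small_tuples[OF univ small_lessThan[OF univ]]])
  then have small: "small U (Pow (\<Union>R\<in>\<Sigma>. Pair R ` tuples {..<n} (ar R)))"
    by (rule small_Pow[OF univ small_UN[OF univ small_sig]])
  show ?thesis by (rule small_lepoll[OF univ small lepoll])
qed

lemma small_gens:
  assumes "A \<in> Obj M"
  shows "small U (gens A)"
proof -
  let ?N = "insert 1 (ar ` \<Sigma>)"
  \<comment> \<open>This presents the singleton of 1 as a subset of a segment, whose smallness is
    known.\<close>
  have "?N = {..<2} - {0} \<union> ar ` \<Sigma>" by auto
  then have "small U ?N"
    using small_Un[OF univ small_subset[OF univ small_lessThan[OF univ]] small_image[OF univ small_sig]]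
    by (metis Diff_subset)
  moreover have "small U (Pow (base A \<times> {..<n}) \<times> {Z. model Z \<and> base Z = {..<n}})" for n :: nat
    using assms by (intro small_Times[OF univ] small_Pow[OF univ] small_mem small_lessThan[OF univ] small_models)
      (simp add: Obj_M)
  moreover have "gens A \<subseteq> (\<Union>n\<in>?N. Pow (base A \<times> {..<n}) \<times> {Z. model Z \<and> base Z = {..<n}})"
    by (auto simp: gens_def targets_def partial_hom_def)
  ultimately show ?thesis
    by (rule small_subset[OF univ small_UN[OF univ]])
qed

lemma partial_action_M: "partial_action M U gens act"
proof (intro partial_action.intro partial_action_axioms.intro category_M univ small_gens)
  fix h A B a b assume "h \<in> homset M A B" "act h a = Some b"
  then show "b \<in> gens B" by (cases a) (auto simp: homset_M act_Some)
next
  fix A a assume "A \<in> Obj M" and a: "a \<in> gens A"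
  obtain p Z where pZ: "a = (p, Z)" by (cases a)
  have "p \<subseteq> base A \<times> base Z" using gensD(3) a pZ by blast
  then have "map_prod (restrict id (base A)) id ` p = id ` p" by (intro image_cong refl) auto
  then show "act (Idn M A) a = Some a" using a by (simp add: act_Some pZ)
next
  fix h k A B D a assume "h \<in> homset M A B" "k \<in> homset M B D" and a: "a \<in> gens A"
  then obtain f g where f: "h = (A, f, B)" "k = (B, g, D)" "hom A B f" "hom B D g" by (auto simp: homset_M)
  obtain p Z where pZ: "a = (p, Z)" by (cases a)
  note p = gensD[OF a[unfolded pZ]]
  have eq: "map_prod (compose (base A) g f) id ` p = map_prod g id ` map_prod f id ` p"
    unfolding image_image using p(3) by (intro image_cong refl) (auto simp: compose_eq)
  have "(map_prod f id ` p, Z) \<in> gens B" if "(map_prod g id ` map_prod f id ` p, Z) \<in> gens D"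
    using p homD(6)[OF f(3)] by (intro gens_vimage[OF f(4) _ _ that]) auto
  then show "act (Cmp M k h) a = Option.bind (act h a) (act k)"
    by (simp add: f(1,2) pZ act_def eq)
qed

sublocale partial_action M U gens act
  by (rule partial_action_M)


subsection \<open>Kernels and images\<close>

text \<open>A tracer for the element \<open>x\<close>: as every relation holds in its one-point
  target, it is a generator over any model containing \<open>x\<close>, and no homomorphism sends it
  to zero.\<close>

definition pt :: "'u \<Rightarrow> ('u \<times> nat) set \<times> (nat, 's) struct" where
  "pt x = ({(x, 0)}, full \<Sigma> ar {..<1})"

lemma pt_gens:
  assumes "A \<in> Obj M" "x \<in> base A"
  shows "pt x \<in> gens A"
proof -
  have "map snd w \<in> interp (full \<Sigma> ar {..<1}) R"
    if "set w \<subseteq> {(x, 0)}" "map fst w \<in> interp A R" for R and w :: "('u \<times> nat) list"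
    using that modelD[OF _ that(2)] assms(1) by (auto simp: Obj_M tuples_def)
  then have "partial_hom A {(x, 0 :: nat)} (full \<Sigma> ar {..<1})"
    unfolding partial_hom_def using assms(2)
    by (intro conjI allI impI) (simp_all add: single_valued_def del: full_simps(2))
  then show ?thesis
    by (simp add: model_full pt_def gens_def targets_def)
qed

lemma act_pt:
  assumes "hom A B f" "x \<in> base A"
  shows "act (A, f, B) (pt x) = Some (pt (f x))"
  using pt_gens[OF homD(2)[OF assms(1)] homD(6)[OF assms]] by (simp add: act_def pt_def)

lemma lin_pt: "hom A B f \<Longrightarrow> x \<in> base A \<Longrightarrow> lin (act (A, f, B)) {pt x} = {pt (f x)}"
  by (simp add: lin_singleton act_pt)

lemma pt_inject: "pt x = pt y \<longleftrightarrow> x = y"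
  by (simp add: pt_def)

lemma xor_eq_empty: "A \<oplus> B = {} \<longleftrightarrow> A = B"
  by (auto simp: xor_def)

lemma pt_xor_ker:
  assumes "hom A B f" "x \<in> base A" "y \<in> base A"
  shows "{pt x} \<oplus> {pt y} \<in> ker (A, f, B) \<longleftrightarrow> f x = f y"
proof -
  have "{pt x} \<in> Fpow (gens A)" "{pt y} \<in> Fpow (gens A)"
    using pt_gens[OF homD(1)[OF assms(1)]] assms(2,3) by (simp_all add: Fpow_def)
  then show ?thesis
    using assms by (simp add: ker_def xor_Fpow lin_xor lin_pt xor_eq_empty pt_inject)
qed

text \<open>Whether \<open>R(g t)\<close> holds in \<open>B\<close> is detected by the generator with target the substructure on
  \<open>t\<close>, pulled back to the indices of \<open>t\<close>, which maps each entry of \<open>g t\<close> to its first position.\<close>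

lemma gens_detect:
  assumes g: "hom A B g" and R: "R \<in> \<Sigma>" and t: "set t \<subseteq> base A" "length t = ar R"
  obtains p Z q where "(p, Z) \<in> gens A" "act (A, g, B) (p, Z) \<noteq> None"
    "set q \<subseteq> p" "map fst q = t" "map snd q \<in> interp Z R \<Longrightarrow> map g t \<in> interp B R"
proof -
  define v where "v = map g t"
  define idx where "idx z = (LEAST i. i < length v \<and> v ! i = z)" for z
  have idx: "idx z < length v \<and> v ! idx z = z" if z: "z \<in> set v" for z
  proof -
    obtain i where "i < length v \<and> v ! i = z" using z by (auto simp: in_set_conv_nth)
    then show ?thesis unfolding idx_def by (rule LeastI)
  qed
  have v: "set v \<subseteq> base B" "length v = ar R" using t homD(6)[OF g] by (auto simp: v_def)
  define Z where "Z = pullback ar ((!) v) {..<ar R} B"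
  have "(!) v ` {..<ar R} \<subseteq> base B" using v nth_mem[of _ v] by fastforce
  then have Z: "Z \<in> targets"
    using model_pullback[OF homD(4)[OF g]] R by (auto simp: targets_def Z_def)
  define p where "p = (\<lambda>x. (x, idx (g x))) ` set t"
  have gp: "map_prod g id ` p = (\<lambda>z. (z, idx z)) ` set v"
    by (auto simp: p_def v_def image_image)
  have "map snd w \<in> interp Z R'"
    if w: "set w \<subseteq> (\<lambda>z. (z, idx z)) ` set v" "map fst w \<in> interp B R'" for w R'
  proof -
    have "v ! snd y = fst y \<and> snd y < ar R" if "y \<in> set w" for y
      using w(1) that idx v(2) by auto
    \<comment> \<open>Looking up the position \<open>idx z\<close> in \<open>v\<close> returns
      \<open>z\<close>; hence a relation on \<open>map fst w\<close> in \<open>B\<close> is, by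
      definition of the pullback, a relation on \<open>map snd w\<close> in
      \<open>Z\<close>.\<close>
    then have "map ((!) v) (map snd w) = map fst w" "set (map snd w) \<subseteq> {..<ar R}" by auto
    then show ?thesis
      using w(2) modelD(3)[OF homD(4)[OF g] w(2)] by (simp add: Z_def tuples_def del: map_map)
  qed
  then have "partial_hom B (map_prod g id ` p) Z"
    unfolding partial_hom_def gp using v idx by (auto simp: single_valued_def Z_def)
  then have gB: "(map_prod g id ` p, Z) \<in> gens B" using Z by (simp add: gens_def)
  have "p \<subseteq> base A \<times> base Z"
    using t v idx by (auto simp: p_def Z_def v_def)
  then have "(p, Z) \<in> gens A" by (intro gens_vimage[OF g _ _ gB]) (simp_all add: p_def)
  moreover have "act (A, g, B) (p, Z) \<noteq> None" using gB by (simp add: act_def)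
  moreover have "map g t \<in> interp B R" if "map snd (map (\<lambda>x. (x, idx (g x))) t) \<in> interp Z R"
  proof -
    have "v ! idx (g x) = g x" if "x \<in> set t" for x
    proof -
      have "g x \<in> set v" using that by (simp add: v_def)
      then show ?thesis using idx by blast
    qed
    then have "map ((!) v) (map snd (map (\<lambda>x. (x, idx (g x))) t)) = map g t" by simp
    then show ?thesis using that by (simp add: Z_def del: map_map)
  qed
  moreover have "set (map (\<lambda>x. (x, idx (g x))) t) \<subseteq> p" by (auto simp: p_def)
  moreover have "map fst (map (\<lambda>x. (x, idx (g x))) t) = t" by (simp add: comp_def)
  ultimately show ?thesis using that by blast
qed

text \<open>Differences of tracers \<open>pt\<close> show that \<open>g\<close> is constant on the
  fibres of \<open>e\<close>, which defines \<open>h\<close>. For a relation \<open>u\<close> of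
  \<open>Y\<close>, lift \<open>u\<close> to a tuple \<open>t\<close> of \<open>X\<close> and take
  the generator detecting \<open>R(g t)\<close>. It survives along \<open>g\<close>, so by the
  inclusion of kernels it survives along \<open>e\<close>; its image over \<open>Y\<close> preserves
  the relation on \<open>u\<close>, and this is what detection needs.\<close>

lemma ker_subset_factor:
  assumes e: "hom X Y e" and surj: "e ` base X = base Y" and g: "hom X B g"
    and ker: "ker (X, e, Y) \<subseteq> ker (X, g, B)"
  obtains h where "hom Y B h" "g = compose (base X) h e"
proof -
  define s where "s = inv_into (base X) e"
  have s: "s y \<in> base X" "e (s y) = y" if "y \<in> base Y" for y
    using that surj by (auto simp: s_def inv_into_into f_inv_into_f)
  define h where "h = (\<lambda>y\<in>base Y. g (s y))"
  have he: "h (e x) = g x" if x: "x \<in> base X" for x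
  proof -
    note ex = homD(6)[OF e x]
    have "{pt (s (e x))} \<oplus> {pt x} \<in> ker (X, e, Y)" using s[OF ex] x by (simp add: pt_xor_ker[OF e])
    then have "{pt (s (e x))} \<oplus> {pt x} \<in> ker (X, g, B)" using ker by blast
    then show ?thesis using s[OF ex] x ex by (simp add: h_def pt_xor_ker[OF g])
  qed
  have "map h u \<in> interp B R" if u: "u \<in> interp Y R" for R u
  proof -
    note uY = modelD[OF homD(4)[OF e] u]
    define t where "t = map s u"
    have t: "set t \<subseteq> base X" "length t = ar R" "map e t = u"
      using uY(2,3) s by (auto simp: t_def intro!: map_idI)
    obtain p Z q where *: "(p, Z) \<in> gens X" "act (X, g, B) (p, Z) \<noteq> None" "set q \<subseteq> p" "map fst q = t"
      "map snd q \<in> interp Z R \<Longrightarrow> map g t \<in> interp B R"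
      using gens_detect[OF g uY(1) t(1,2)] by metis
    have "{(p, Z)} \<notin> ker (X, g, B)" using *(2) by (auto simp: ker_def lin_singleton)
    then have "{(p, Z)} \<notin> ker (X, e, Y)" using ker by blast
    then have "act (X, e, Y) (p, Z) \<noteq> None" using *(1) by (auto simp: ker_def lin_singleton Fpow_def)
    then have "(map_prod e id ` p, Z) \<in> gens Y" by (simp add: act_None)
    moreover have "set (map (map_prod e id) q) \<subseteq> map_prod e id ` p" using *(3) by auto
    moreover have "map fst (map (map_prod e id) q) \<in> interp Y R"
    proof -
      have "map fst (map (map_prod e id) q) = map e (map fst q)" by simp
      then show ?thesis using u t(3) *(4) by simp
    qed
    ultimately have "map snd (map (map_prod e id) q) \<in> interp Z R" by (rule gensD(5))
    then have "map g t \<in> interp B R" using *(5) by (simp add: comp_def)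
    moreover have "map h u = map g t" using t(1) he by (auto simp flip: t(3))
    ultimately show ?thesis by simp
  qed
  moreover have "h \<in> base Y \<rightarrow>\<^sub>E base B" using s homD(6)[OF g] by (auto simp: h_def)
  ultimately have "hom Y B h" using homD(2)[OF e] homD(2)[OF g] by (simp add: hom_def)
  moreover have "g = compose (base X) h e"
    using he homD(5)[OF g] by (auto simp: compose_def fun_eq_iff PiE_iff extensional_def)
  ultimately show ?thesis using that by blast
qed

lemma img_eq:
  assumes f: "hom X Y f"
  shows "img (X, f, Y) = Fpow {(p, Z) \<in> gens Y. fst ` p \<subseteq> f ` base X}"
proof (intro equalityI subsetI)
  fix B assume "B \<in> img (X, f, Y)"
  then obtain A where A: "A \<in> Fpow (gens X)" "B = lin (act (X, f, Y)) A" by (auto simp: img_def)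
  have "b \<in> {(p, Z) \<in> gens Y. fst ` p \<subseteq> f ` base X}" if b: "b \<in> B" for b
  proof -
    obtain p Z where pZ: "(p, Z) \<in> A" "act (X, f, Y) (p, Z) = Some b"
      using lin_memD[of b "act (X, f, Y)" A] b A(2) by auto
    then have "(p, Z) \<in> gens X" using A(1) by (auto simp: Fpow_def)
    then have "fst ` p \<subseteq> base X" using gensD(3) by fastforce
    then show ?thesis using pZ(2) by (auto simp: act_Some)
  qed
  then have "B \<subseteq> {(p, Z) \<in> gens Y. fst ` p \<subseteq> f ` base X}" by (rule subsetI)
  moreover have "finite B" using A finite_lin by (auto simp: Fpow_def)
  ultimately show "B \<in> Fpow {(p, Z) \<in> gens Y. fst ` p \<subseteq> f ` base X}" by (simp add: Fpow_def)
next
  fix B assume B: "B \<in> Fpow {(p, Z) \<in> gens Y. fst ` p \<subseteq> f ` base X}"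
  have "\<exists>a\<in>gens X. act (X, f, Y) a = Some b" if b: "b \<in> {(p, Z) \<in> gens Y. fst ` p \<subseteq> f ` base X}" for b
  proof -
    obtain q Z where q: "b = (q, Z)" "(q, Z) \<in> gens Y" "fst ` q \<subseteq> f ` base X" using b by auto
    \<comment> \<open>Any choice of preimages will do: the lift has image \<open>q\<close>, and
      \<open>gens_vimage\<close> makes it a generator.\<close>
    define p where "p = map_prod (inv_into (base X) f) id ` q"
    have "map_prod f id ` p = id ` q"
      unfolding p_def image_image using q(3) by (intro image_cong refl) (auto simp: f_inv_into_f)
    then have fp: "map_prod f id ` p = q" by simp
    have "inv_into (base X) f y \<in> base X \<and> c \<in> base Z" if "(y, c) \<in> q" for y c
      using that q(3) gensD(3)[OF q(2)] inv_into_into[of y f "base X"] by force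
    then have "p \<subseteq> base X \<times> base Z" by (auto simp: p_def)
    then have "(p, Z) \<in> gens X"
      using q(2) gensD(2)[OF q(2)] fp by (intro gens_vimage[OF f]) (auto simp: p_def)
    then show ?thesis using fp q by (intro bexI[of _ "(p, Z)"]) (auto simp: act_Some)
  qed
  from lin_onto[OF this B] show "B \<in> img (X, f, Y)" by (auto simp: img_def)
qed

lemma img_surj:
  assumes "hom X Y f" "f ` base X = base Y"
  shows "img (X, f, Y) = Fpow (gens Y)"
proof -
  have "fst ` p \<subseteq> base Y" if "(p, Z) \<in> gens Y" for p Z using gensD(3)[OF that] by fastforce
  then have "{(p, Z) \<in> gens Y. fst ` p \<subseteq> f ` base X} = gens Y" using assms(2) by auto
  then show ?thesis by (simp add: img_eq[OF assms(1)])
qed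

lemma img_subset_range:
  assumes "hom X Y f" "hom A Y m" "img (X, f, Y) \<subseteq> img (A, m, Y)"
  shows "f ` base X \<subseteq> m ` base A"
proof
  fix y assume "y \<in> f ` base X"
  then obtain x where x: "x \<in> base X" "y = f x" by blast
  have "{pt y} \<in> img (X, f, Y)"
    using pt_gens[OF homD(2)[OF assms(1)] homD(6)[OF assms(1) x(1)]] x
    by (auto simp: img_eq[OF assms(1)] Fpow_def pt_def)
  then have "{pt y} \<in> img (A, m, Y)" using assms(3) by blast
  then show "y \<in> m ` base A" by (auto simp: img_eq[OF assms(2)] Fpow_def pt_def)
qed

definition reflects :: "('u, 's) struct \<Rightarrow> ('u, 's) struct \<Rightarrow> ('u \<Rightarrow> 'u) \<Rightarrow> bool" where
  "reflects A B m \<longleftrightarrow> inj_on m (base A) \<and>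
     (\<forall>R t. set t \<subseteq> base A \<longrightarrow> map m t \<in> interp B R \<longrightarrow> t \<in> interp A R)"

lemma reflectsD:
  assumes "reflects A B m"
  shows "inj_on m (base A)" "set t \<subseteq> base A \<Longrightarrow> map m t \<in> interp B R \<Longrightarrow> t \<in> interp A R"
  using assms by (auto simp: reflects_def)

text \<open>Between points of the image, \<open>B\<close> has no relations beyond those of
  \<open>A\<close>, so there is nothing that could violate the pushed-forward map.\<close>

lemma reflects_gens:
  assumes m: "hom A B m" "reflects A B m" and p: "(p, Z) \<in> gens A"
  shows "(map_prod m id ` p, Z) \<in> gens B"
proof -
  note pD = gensD[OF p] and inj = reflectsD(1)[OF m(2)]
  define s where "s = inv_into (base A) m"
  have s: "s (m x) = x" if "x \<in> base A" for x using that inj by (simp add: s_def)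
  have "map snd w \<in> interp Z R" if w: "set w \<subseteq> map_prod m id ` p" "map fst w \<in> interp B R" for R w
  proof -
    have sub: "map_prod s id y \<in> p \<and> m (fst (map_prod s id y)) = fst y" if y: "y \<in> set w" for y
    proof -
      obtain x c where "(x, c) \<in> p" "y = (m x, c)" using w(1) y by auto
      moreover from this have "x \<in> base A" using pD(3) by blast
      ultimately show ?thesis by (simp add: s)
    qed
    let ?t = "map fst (map (map_prod s id) w)"
    have wp: "set (map (map_prod s id) w) \<subseteq> p" using sub by auto
    then have "set ?t \<subseteq> base A" using pD(3) by fastforce
    moreover have "map m ?t = map fst w" using sub by auto
    ultimately have "?t \<in> interp A R" using reflectsD(2)[OF m(2)] w(2) by metis
    from pD(5)[OF wp this] show ?thesis by (simp add: comp_def)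
  qed
  moreover have "single_valued (map_prod m id ` p)"
  proof (rule single_valuedI)
    fix y c d assume "(y, c) \<in> map_prod m id ` p" "(y, d) \<in> map_prod m id ` p"
    then obtain x x' where x: "(x, c) \<in> p" "(x', d) \<in> p" "y = m x" "y = m x'" by auto
    moreover from this have "x = x'" using pD(3) inj by (auto dest: inj_onD)
    ultimately show "c = d" using pD(4) by (auto simp: single_valued_def)
  qed
  moreover have "map_prod m id ` p \<subseteq> base B \<times> base Z" using pD(3) homD(6)[OF m(1)] by auto
  ultimately have "partial_hom B (map_prod m id ` p) Z"
    unfolding partial_hom_def using pD(2) by simp
  then show ?thesis using pD(1) by (simp add: gens_def)
qed

text \<open>No generator is killed and, \<open>m\<close> being injective, no two are identified; so
  the induced linear map is injective.\<close>

lemma ker_reflects: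
  assumes m: "hom A B m" "reflects A B m"
  shows "ker (A, m, B) = {{}}"
proof (intro equalityI subsetI)
  fix V assume "V \<in> ker (A, m, B)"
  then have V: "V \<in> Fpow (gens A)" "lin (act (A, m, B)) V = {}" by (simp_all add: ker_def)
  have inj: "inj_on (map_prod m (id :: nat \<Rightarrow> nat)) (base A \<times> UNIV)"
    using reflectsD(1)[OF m(2)] by (auto simp: inj_on_def)
  show "V \<in> {{}}"
  proof (rule kernel_lin_subset[OF subspaces_bot _ _ V])
    fix a assume "a \<in> gens A" "act (A, m, B) a = None"
    then show "{a} \<in> {{}}" using reflects_gens[OF m] by (cases a) (simp add: act_None)
  next
    fix a b c assume *: "a \<in> gens A" "b \<in> gens A" "act (A, m, B) a = Some c" "act (A, m, B) b = Some c"
    obtain p Z q Y where ab: "a = (p, Z)" "b = (q, Y)" by (cases a, cases b) blast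
    have "map_prod m id ` p = map_prod m id ` q" "Z = Y" using *(3,4) ab by (auto simp: act_Some)
    moreover have "p \<subseteq> base A \<times> UNIV" "q \<subseteq> base A \<times> UNIV"
      using gensD(3)[of p Z A] gensD(3)[of q Y A] *(1,2) ab by blast+
    ultimately have "p = q" using inj_on_image_eq_iff[OF inj] by blast
    then show "{a} \<oplus> {b} \<in> {{}}" using ab \<open>Z = Y\<close> by simp
  qed
qed (simp add: ker_def empty_in_Fpow)


subsection \<open>Surjections and induced embeddings\<close>

lemma hom_ext: "hom A B f \<Longrightarrow> hom A B g \<Longrightarrow> (\<And>x. x \<in> base A \<Longrightarrow> f x = g x) \<Longrightarrow> f = g"
  using homD(5) by (metis PiE_ext)

lemma compose_apply: "x \<in> D \<Longrightarrow> compose D g f x = g (f x)"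
  by (simp add: compose_def)

lemma surj_cancel:
  assumes "hom X Y e" "e ` base X = base Y" "hom Y B h" "hom Y B k"
    and eq: "compose (base X) h e = compose (base X) k e"
  shows "h = k"
proof (rule hom_ext[OF assms(3,4)])
  fix y assume "y \<in> base Y"
  then obtain x where "x \<in> base X" "y = e x" using assms(2) by blast
  then show "h y = k y" using fun_cong[OF eq, of x] by (simp add: compose_apply)
qed

lemma inj_cancel:
  assumes "inj_on m (base A)" "hom B A h" "hom B A k"
    and eq: "compose (base B) m h = compose (base B) m k"
  shows "h = k"
proof (rule hom_ext[OF assms(2,3)])
  fix x assume x: "x \<in> base B"
  then have "m (h x) = m (k x)" using fun_cong[OF eq, of x] by (simp add: compose_apply)
  then show "h x = k x" using inj_onD[OF assms(1)] homD(6)[OF assms(2) x] homD(6)[OF assms(3) x] by blast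
qed

lemma reflects_factor:
  assumes m: "hom A Y m" "reflects A Y m" and f: "hom B Y f" and sub: "f ` base B \<subseteq> m ` base A"
  obtains h where "hom B A h" "f = compose (base B) m h"
proof -
  define h where "h = (\<lambda>z\<in>base B. inv_into (base A) m (f z))"
  have h: "h z \<in> base A" "m (h z) = f z" if "z \<in> base B" for z
  proof -
    have "f z \<in> m ` base A" using sub that by blast
    then show "h z \<in> base A" "m (h z) = f z"
      using that by (simp_all add: h_def inv_into_into f_inv_into_f)
  qed
  have "map h t \<in> interp A R" if t: "t \<in> interp B R" for R t
  proof (rule reflectsD(2)[OF m(2)])
    have tB: "set t \<subseteq> base B" using modelD(2)[OF homD(3)[OF f] t] .
    then show "set (map h t) \<subseteq> base A" using h by auto
    have "map m (map h t) = map f t" using tB h by auto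
    then show "map m (map h t) \<in> interp Y R" using homD(7)[OF f t] by (simp only:)
  qed
  moreover have "h \<in> base B \<rightarrow>\<^sub>E base A" using h by (auto simp: h_def)
  ultimately have "hom B A h" using homD(1)[OF f] homD(1)[OF m(1)] by (simp add: hom_def)
  moreover have "f = compose (base B) m h"
    using h homD(5)[OF f] by (auto simp: compose_def fun_eq_iff PiE_iff extensional_def)
  ultimately show ?thesis using that by blast
qed

definition sub :: "('u, 's) struct \<Rightarrow> 'u set \<Rightarrow> ('u, 's) struct" where
  "sub Y D = pullback ar id D Y"

lemma base_sub [simp]: "base (sub Y D) = D"
  by (simp add: sub_def)

lemma hom_sub:
  assumes Y: "Y \<in> Obj M" and D: "D \<subseteq> base Y"
  shows "hom (sub Y D) Y (restrict id D)" "reflects (sub Y D) Y (restrict id D)"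
proof -
  have id: "map (restrict id D) t = t" if "set t \<subseteq> D" for t
    using that by (intro map_idI) auto
  have "base Y \<in> U" using Y by (simp add: Obj_M)
  then have "D \<in> U" using D univ unfolding universe_def by blast
  then have "sub Y D \<in> Obj M" using model_pullback[of Y id D] Y D by (simp add: Obj_M sub_def)
  then show "hom (sub Y D) Y (restrict id D)"
    using Y D id by (auto simp: hom_def sub_def tuples_def)
  show "reflects (sub Y D) Y (restrict id D)"
    using id modelD(3)[of Y] Y by (auto simp: reflects_def sub_def tuples_def Obj_M)
qed

lemma image_factor:
  assumes f: "hom X Y f"
  shows "hom X (sub Y (f ` base X)) f"
    "hom (sub Y (f ` base X)) Y (restrict id (f ` base X))"
    "reflects (sub Y (f ` base X)) Y (restrict id (f ` base X))"
    "compose (base X) (restrict id (f ` base X)) f = f"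
proof -
  have D: "f ` base X \<subseteq> base Y" using homD(6)[OF f] by blast
  note s = hom_sub[OF homD(2)[OF f] D]
  show "hom (sub Y (f ` base X)) Y (restrict id (f ` base X))"
    "reflects (sub Y (f ` base X)) Y (restrict id (f ` base X))"
    by (rule s)+
  have "map f t \<in> interp (sub Y (f ` base X)) R" if t: "t \<in> interp X R" for R t
    using homD(7)[OF f t] modelD[OF homD(3)[OF f] t] by (auto simp: sub_def tuples_def)
  moreover have "f \<in> base X \<rightarrow>\<^sub>E f ` base X" using homD(5)[OF f] by (auto simp: PiE_iff)
  ultimately show "hom X (sub Y (f ` base X)) f"
    using homD(1)[OF f] homD(1)[OF s(1)] by (simp add: hom_def)
  show "compose (base X) (restrict id (f ` base X)) f = f"
    using homD(5)[OF f] by (auto simp: compose_def fun_eq_iff PiE_iff extensional_def)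
qed

section \<open>Universal properties of surjections and induced embeddings\<close>

lemma ker_subspaces': "ker (X, f, Y) \<in> subspaces (gens X)"
  using ker_subspaces[of "(X, f, Y)"] by simp

lemma Ker_M: "hom X Y f \<Longrightarrow> Ker M F (X, f, Y) = code X (ker (X, f, Y))"
  by (rule Ker_code[OF homset_homI])

lemma Im_M: "hom X Y f \<Longrightarrow> Im M F (X, f, Y) = code Y (img (X, f, Y))"
  by (rule Im_code[OF homset_homI])

lemma Ker_le:
  assumes "hom X Y f" "hom X B g"
  shows "Ker M F (X, f, Y) \<sqsubseteq>\<^bsub>Fib F X\<^esub> Ker M F (X, g, B) \<longleftrightarrow> ker (X, f, Y) \<subseteq> ker (X, g, B)"
  using le_Fib[OF homD(1)[OF assms(1)]] by (simp add: Ker_M[OF assms(1)] Ker_M[OF assms(2)] ker_subspaces')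

lemma Im_le:
  assumes "hom A Y f" "hom B Y g"
  shows "Im M F (A, f, Y) \<sqsubseteq>\<^bsub>Fib F Y\<^esub> Im M F (B, g, Y) \<longleftrightarrow> img (A, f, Y) \<subseteq> img (B, g, Y)"
  using le_Fib[OF homD(2)[OF assms(1)] img_subspaces[OF homset_homI[OF assms(1)]]
    img_subspaces[OF homset_homI[OF assms(2)]]]
  by (simp add: Im_M[OF assms(1)] Im_M[OF assms(2)])

lemma quotient_surj:
  assumes e: "hom X Y e" "e ` base X = base Y"
  shows "quotient_of M F X (Ker M F (X, e, Y)) (X, e, Y)"
  unfolding quotient_of_def
proof (intro conjI ballI impI)
  show "(X, e, Y) \<in> Arr M" using e(1) by (simp add: Arr_M)
  fix k assume "k \<in> Arr M" and k: "Dom M k = X \<and> Ker M F (X, e, Y) \<sqsubseteq>\<^bsub>Fib F X\<^esub> Ker M F k"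
  then obtain g B where g: "k = (X, g, B)" "hom X B g" by (cases k) (auto simp: Arr_M)
  then obtain h where h: "hom Y B h" "g = compose (base X) h e"
    using k ker_subset_factor[OF e g(2)] by (auto simp: Ker_le[OF e(1) g(2)])
  show "\<exists>!h. h \<in> homset M (Cod M (X, e, Y)) (Cod M k) \<and> k = Cmp M h (X, e, Y)"
  proof (rule ex1I[of _ "(Y, h, B)"])
    show "(Y, h, B) \<in> homset M (Cod M (X, e, Y)) (Cod M k) \<and> k = Cmp M (Y, h, B) (X, e, Y)"
      using h g by (simp add: homset_M)
    fix l assume "l \<in> homset M (Cod M (X, e, Y)) (Cod M k) \<and> k = Cmp M l (X, e, Y)"
    then obtain j where j: "l = (Y, j, B)" "hom Y B j" "g = compose (base X) j e"
      using g by (auto simp: homset_M)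
    then have "j = h" using h by (intro surj_cancel[OF e j(2) h(1)]) simp
    then show "l = (Y, h, B)" using j by simp
  qed
qed simp_all

lemma embedding_reflects:
  assumes m: "hom A Y m" "reflects A Y m"
  shows "embedding_of M F Y (Im M F (A, m, Y)) (A, m, Y)"
  unfolding embedding_of_def
proof (intro conjI ballI impI)
  show "(A, m, Y) \<in> Arr M" using m(1) by (simp add: Arr_M)
  fix k assume "k \<in> Arr M" and k: "Cod M k = Y \<and> Im M F k \<sqsubseteq>\<^bsub>Fib F Y\<^esub> Im M F (A, m, Y)"
  then obtain f B where f: "k = (B, f, Y)" "hom B Y f" by (cases k) (auto simp: Arr_M)
  then have "f ` base B \<subseteq> m ` base A"
    using k by (intro img_subset_range[OF _ m(1)]) (simp_all add: Im_le[OF f(2) m(1)])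
  then obtain h where h: "hom B A h" "f = compose (base B) m h"
    using reflects_factor[OF m f(2)] by metis
  show "\<exists>!h. h \<in> homset M (Dom M k) (Dom M (A, m, Y)) \<and> k = Cmp M (A, m, Y) h"
  proof (rule ex1I[of _ "(B, h, A)"])
    show "(B, h, A) \<in> homset M (Dom M k) (Dom M (A, m, Y)) \<and> k = Cmp M (A, m, Y) (B, h, A)"
      using h f by (simp add: homset_M)
    fix l assume "l \<in> homset M (Dom M k) (Dom M (A, m, Y)) \<and> k = Cmp M (A, m, Y) l"
    then obtain j where j: "l = (B, j, A)" "hom B A j" "f = compose (base B) m j"
      using f by (auto simp: homset_M)
    then have "j = h" using h by (intro inj_cancel[OF reflectsD(1)[OF m(2)] j(2) h(1)]) simp
    then show "l = (B, h, A)" using j by simp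
  qed
qed simp_all

lemma Ker_image_factor:
  assumes f: "hom X Y f"
  shows "Ker M F (X, f, sub Y (f ` base X)) = Ker M F (X, f, Y)"
proof -
  note i = image_factor[OF f]
  from ker_cmp_mono[OF homset_homI[OF i(1)] homset_homI[OF i(2)] ker_reflects[OF i(2,3)]]
  show ?thesis by (simp add: Ker_M[OF f] Ker_M[OF i(1)] i(4))
qed

lemma Im_image_factor:
  assumes f: "hom X Y f"
  shows "Im M F (sub Y (f ` base X), restrict id (f ` base X), Y) = Im M F (X, f, Y)"
proof -
  note i = image_factor[OF f]
  have "img (X, f, sub Y (f ` base X)) = Fpow (gens (sub Y (f ` base X)))"
    by (rule img_surj[OF i(1)]) simp
  from img_cmp_epi[OF homset_homI[OF i(1)] homset_homI[OF i(2)] this]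
  show ?thesis by (simp add: Im_M[OF f] Im_M[OF i(2)] i(4))
qed

lemma form_factorization:
  assumes "k \<in> homset M X Y"
  shows "\<exists>e m. quotient_of M F X (Ker M F k) e \<and> embedding_of M F Y (Im M F k) m \<and>
    Cod M e = Dom M m \<and> k = Cmp M m e"
proof -
  obtain f where f: "k = (X, f, Y)" "hom X Y f" using assms by (auto simp: homset_M)
  note i = image_factor[OF f(2)]
  show ?thesis
  proof (intro exI conjI)
    show "quotient_of M F X (Ker M F k) (X, f, sub Y (f ` base X))"
      using quotient_surj[OF i(1)] by (simp add: f Ker_image_factor)
    show "embedding_of M F Y (Im M F k) (sub Y (f ` base X), restrict id (f ` base X), Y)"
      using embedding_reflects[OF i(2,3)] by (simp add: f Im_image_factor)
  qed (simp_all add: f i(4))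
qed

text \<open>Conormal clusters come from subsets: a homomorphism contributes its range, and a subset
  \<open>D\<close> is the range of the inclusion of the induced substructure on it. Meets thereby
  reduce to intersections of subsets.\<close>

lemma conormal_iff:
  assumes X: "X \<in> Obj M"
  shows "conormal M F X S \<longleftrightarrow> (\<exists>D\<subseteq>base X. S = code X (Fpow {(p, Z) \<in> gens X. fst ` p \<subseteq> D}))"
proof
  assume "conormal M F X S"
  then obtain A f where f: "hom A X f" "S = Im M F (A, f, X)" by (force simp: conormal_def Arr_M)
  then show "\<exists>D\<subseteq>base X. S = code X (Fpow {(p, Z) \<in> gens X. fst ` p \<subseteq> D})"
    using homD(6)[OF f(1)] by (intro exI[of _ "f ` base A"]) (auto simp: Im_M img_eq)
next
  assume "\<exists>D\<subseteq>base X. S = code X (Fpow {(p, Z) \<in> gens X. fst ` p \<subseteq> D})"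
  then obtain D where D: "D \<subseteq> base X" "S = code X (Fpow {(p, Z) \<in> gens X. fst ` p \<subseteq> D})" by blast
  note s = hom_sub(1)[OF X D(1)]
  have "S = Im M F (sub X D, restrict id D, X)" by (simp add: D(2) Im_M[OF s] img_eq[OF s])
  then show "conormal M F X S"
    unfolding conormal_def using s by (intro bexI[of _ "(sub X D, restrict id D, X)"]) (simp_all add: Arr_M)
qed

lemma form_conormal_meet:
  assumes X: "X \<in> Obj M" and "conormal M F X S" "conormal M F X T"
  shows "conormal M F X (S \<sqinter>\<^bsub>Fib F X\<^esub> T)"
proof -
  let ?W = "\<lambda>D. Fpow {(p, Z) \<in> gens X. fst ` p \<subseteq> D}"
  obtain D E where D: "D \<subseteq> base X" "S = code X (?W D)" and E: "E \<subseteq> base X" "T = code X (?W E)"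
    using assms by (auto simp: conormal_iff)
  have W: "?W B \<in> subspaces (gens X)" for B
  proof -
    have "?W B \<subseteq> Fpow (gens X)" by (auto simp: Fpow_def)
    moreover have "?W B \<in> subspaces {(p, Z) \<in> gens X. fst ` p \<subseteq> B}" by (rule subspaces_top)
    ultimately show ?thesis by (auto simp: subspaces_def)
  qed
  have "?W D \<inter> ?W E = Fpow ({(p, Z) \<in> gens X. fst ` p \<subseteq> D} \<inter> {(p, Z) \<in> gens X. fst ` p \<subseteq> E})"
    unfolding Fpow_def by blast
  also have "\<dots> = ?W (D \<inter> E)" by (rule arg_cong[where f = Fpow]) auto
  finally have "?W D \<inter> ?W E = ?W (D \<inter> E)" .
  then have "S \<sqinter>\<^bsub>Fib F X\<^esub> T = code X (?W (D \<inter> E))" by (simp add: D E meet_Fib[OF X W W])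
  then show ?thesis using D E unfolding conormal_iff[OF X] by blast
qed

text \<open>Restricting the codomain to the range keeps the kernel, because the inclusion of an
  induced substructure has kernel zero. So (N3) only concerns surjections.\<close>

lemma normal_surj:
  assumes "normal M F X K"
  obtains Y e where "hom X Y e" "e ` base X = base Y" "K = code X (ker (X, e, Y))"
proof -
  obtain Y f where f: "hom X Y f" "K = Ker M F (X, f, Y)"
    using assms by (force simp: normal_def Arr_M)
  note i = image_factor(1)[OF f(1)]
  have "K = code X (ker (X, f, sub Y (f ` base X)))"
    using Ker_image_factor[OF f(1)] by (simp add: f(2) Ker_M[OF i])
  then show ?thesis using that[OF i] by simp
qed


subsection \<open>The induced factorization system\<close>

lemma surjective_homs_M: "(A, f, B) \<in> surjective_homs M \<longleftrightarrow> hom A B f \<and> f ` base A = base B"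
  by (simp add: surjective_homs_def Arr_M)

lemma induced_embeddings_M: "(A, m, B) \<in> induced_embeddings \<Sigma> ar M \<longleftrightarrow> hom A B m \<and> reflects A B m"
proof -
  have "(\<forall>R\<in>\<Sigma>. \<forall>t\<in>tuples (base A) (ar R). map m t \<in> interp B R \<longrightarrow> t \<in> interp A R) \<longleftrightarrow>
      (\<forall>R t. set t \<subseteq> base A \<longrightarrow> map m t \<in> interp B R \<longrightarrow> t \<in> interp A R)" if "hom A B m"
    using modelD(1,3)[OF homD(4)[OF that]] by (fastforce simp: tuples_def)
  then show ?thesis by (auto simp: induced_embeddings_def Arr_M reflects_def)
qed

text \<open>The left inverse \<open>g\<close> is itself a homomorphism and carries relations back
  from \<open>B\<close> to \<open>A\<close>.\<close>

lemma retraction_reflects: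
  assumes f: "hom A B f" and g: "hom B A g" and gf: "compose (base A) g f = restrict id (base A)"
  shows "reflects A B f"
proof -
  have id: "g (f x) = x" if "x \<in> base A" for x
    using fun_cong[OF gf, of x] that by (simp add: compose_apply)
  have "t \<in> interp A R" if t: "set t \<subseteq> base A" "map f t \<in> interp B R" for R t
  proof -
    have "map g (map f t) = t" using t(1) id by (auto intro!: map_idI)
    then show ?thesis using homD(7)[OF g t(2)] by simp
  qed
  then show ?thesis unfolding reflects_def using id by (metis inj_onI)
qed

lemma surjective_homs_cases:
  assumes "k \<in> surjective_homs M"
  obtains A f B where "k = (A, f, B)" "hom A B f" "f ` base A = base B"
  using assms by (cases k) (simp add: surjective_homs_M)

lemma induced_embeddings_cases:
  assumes "k \<in> induced_embeddings \<Sigma> ar M"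
  obtains A m B where "k = (A, m, B)" "hom A B m" "reflects A B m"
  using assms by (cases k) (simp add: induced_embeddings_M)

lemma iso_surjective_embedding:
  assumes "iso_arr M k"
  shows "k \<in> surjective_homs M \<and> k \<in> induced_embeddings \<Sigma> ar M"
proof -
  obtain A f B where f: "k = (A, f, B)" by (cases k)
  obtain g where g: "hom A B f" "hom B A g" "compose (base A) g f = restrict id (base A)"
    "compose (base B) f g = restrict id (base B)"
    using assms by (auto simp: iso_arr_def f Arr_M homset_M)
  have "y \<in> f ` base A" if y: "y \<in> base B" for y
  proof -
    have "f (g y) = y" using fun_cong[OF g(4), of y] y by (simp add: compose_apply)
    then show ?thesis using homD(6)[OF g(2) y] by force
  qed
  then have "f ` base A = base B" using homD(6)[OF g(1)] by blast
  then show ?thesis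
    using g(1) retraction_reflects[OF g(1-3)] by (simp add: f surjective_homs_M induced_embeddings_M)
qed

lemma surjective_homs_compose:
  assumes "k \<in> surjective_homs M" "l \<in> surjective_homs M" "Cod M k = Dom M l"
  shows "Cmp M l k \<in> surjective_homs M"
proof -
  obtain A f B where f: "k = (A, f, B)" "hom A B f" "f ` base A = base B"
    using assms(1) by (rule surjective_homs_cases)
  obtain B' g D where g: "l = (B', g, D)" "hom B' D g" "g ` base B' = base D"
    using assms(2) by (rule surjective_homs_cases)
  have B: "B' = B" using assms(3) f(1) g(1) by simp
  have "compose (base A) g f ` base A = g ` f ` base A" by (auto simp: compose_def)
  then show ?thesis using hom_compose[OF f(2)] f g B by (simp add: surjective_homs_M)
qed

lemma induced_embeddings_compose:
  assumes "k \<in> induced_embeddings \<Sigma> ar M" "l \<in> induced_embeddings \<Sigma> ar M" "Cod M k = Dom M l"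
  shows "Cmp M l k \<in> induced_embeddings \<Sigma> ar M"
proof -
  obtain A f B where f: "k = (A, f, B)" "hom A B f" "reflects A B f"
    using assms(1) by (rule induced_embeddings_cases)
  obtain B' g D where g: "l = (B', g, D)" "hom B' D g" "reflects B' D g"
    using assms(2) by (rule induced_embeddings_cases)
  have B: "B' = B" using assms(3) f(1) g(1) by simp
  have "reflects A D (compose (base A) g f)"
    unfolding reflects_def
  proof (intro conjI allI impI)
    have "f ` base A \<subseteq> base B" using homD(6)[OF f(2)] by blast
    then have "inj_on g (f ` base A)" using inj_on_subset reflectsD(1)[OF g(3)] B by blast
    then have "inj_on (g \<circ> f) (base A)" by (rule comp_inj_on[OF reflectsD(1)[OF f(3)]])
    then show "inj_on (compose (base A) g f) (base A)" by (simp add: inj_on_def compose_apply)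
    fix R t assume t: "set t \<subseteq> base A" "map (compose (base A) g f) t \<in> interp D R"
    then have "map g (map f t) \<in> interp D R" using map_compose[OF t(1), of g f] by simp
    moreover have "set (map f t) \<subseteq> base B'" using t(1) homD(6)[OF f(2)] B by auto
    ultimately have "map f t \<in> interp B' R" by (intro reflectsD(2)[OF g(3)])
    then show "t \<in> interp A R" using reflectsD(2)[OF f(3) t(1)] B by simp
  qed
  then show ?thesis using hom_compose[OF f(2)] f g B by (simp add: induced_embeddings_M)
qed

lemma surjection_embedding_factorization:
  assumes "k \<in> Arr M"
  shows "\<exists>e\<in>surjective_homs M. \<exists>m\<in>induced_embeddings \<Sigma> ar M.
      Dom M e = Dom M k \<and> Cod M e = Dom M m \<and> Cod M m = Cod M k \<and> k = Cmp M m e"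
proof -
  obtain X f Y where f: "k = (X, f, Y)" by (cases k)
  then have "hom X Y f" using assms by (simp add: Arr_M)
  note i = image_factor[OF this]
  show ?thesis
  proof (intro bexI conjI)
    show "(X, f, sub Y (f ` base X)) \<in> surjective_homs M" using i(1) by (simp add: surjective_homs_M)
    show "(sub Y (f ` base X), restrict id (f ` base X), Y) \<in> induced_embeddings \<Sigma> ar M"
      using i(2,3) by (simp add: induced_embeddings_M)
  qed (simp_all add: f i(4))
qed

text \<open>As \<open>e\<close> is onto, the square forces the range of \<open>v\<close> into that
  of \<open>m\<close>, so \<open>v\<close> factors through \<open>m\<close>. Injectivity of
  \<open>m\<close> gives the other triangle and uniqueness.\<close>

lemma surjection_embedding_diagonal:
  assumes "k \<in> surjective_homs M" "l \<in> induced_embeddings \<Sigma> ar M"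
    and a: "a \<in> homset M (Dom M k) (Dom M l)" and b: "b \<in> homset M (Cod M k) (Cod M l)"
    and sq: "Cmp M b k = Cmp M l a"
  shows "\<exists>!d. d \<in> homset M (Cod M k) (Dom M l) \<and> Cmp M d k = a \<and> Cmp M l d = b"
proof -
  obtain X e Y where e: "k = (X, e, Y)" "hom X Y e" "e ` base X = base Y"
    using assms(1) by (rule surjective_homs_cases)
  obtain A m B where m: "l = (A, m, B)" "hom A B m" "reflects A B m"
    using assms(2) by (rule induced_embeddings_cases)
  obtain u where u: "a = (X, u, A)" "hom X A u" using a by (auto simp: homset_M e(1) m(1))
  obtain v where v: "b = (Y, v, B)" "hom Y B v" using b by (auto simp: homset_M e(1) m(1))
  have sq': "compose (base X) v e = compose (base X) m u" using sq by (simp add: e(1) m(1) u(1) v(1))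
  have ve: "v (e x) = m (u x)" if "x \<in> base X" for x
    using fun_cong[OF sq', of x] that by (simp add: compose_apply)
  have "v ` base Y \<subseteq> m ` base A"
  proof
    fix z assume "z \<in> v ` base Y"
    then obtain y where y: "y \<in> base Y" "z = v y" by blast
    then obtain x where x: "x \<in> base X" "y = e x" using e(3) by blast
    then have "z = m (u x)" using ve y(2) by simp
    then show "z \<in> m ` base A" using homD(6)[OF u(2) x(1)] by blast
  qed
  then obtain d where d: "hom Y A d" "v = compose (base Y) m d"
    by (rule reflects_factor[OF m(2,3) v(2)])
  have md: "m (d (e x)) = m (u x)" if "x \<in> base X" for x
    using ve[OF that] homD(6)[OF e(2) that] by (simp add: d(2) compose_apply)
  have "compose (base X) m (compose (base X) d e) = compose (base X) m u"
    by (rule ext) (simp add: compose_def md)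
  then have de: "compose (base X) d e = u"
    by (rule inj_cancel[OF reflectsD(1)[OF m(3)] hom_compose[OF e(2) d(1)] u(2)])
  show ?thesis
  proof (rule ex1I[of _ "(Y, d, A)"])
    show "(Y, d, A) \<in> homset M (Cod M k) (Dom M l) \<and> Cmp M (Y, d, A) k = a \<and> Cmp M l (Y, d, A) = b"
      using d(1) by (simp add: homset_M e(1) m(1) u(1) v(1) de d(2))
    fix c assume c: "c \<in> homset M (Cod M k) (Dom M l) \<and> Cmp M c k = a \<and> Cmp M l c = b"
    then obtain j where j: "c = (Y, j, A)" "hom Y A j" by (auto simp: homset_M e(1) m(1))
    have "compose (base Y) m j = compose (base Y) m d"
      using c by (simp add: j(1) m(1) v(1) flip: d(2))
    then show "c = (Y, d, A)" using inj_cancel[OF reflectsD(1)[OF m(3)] j(2) d(1)] j(1) by simp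
  qed
qed

lemma surjective_hom_epi:
  assumes "k \<in> surjective_homs M"
  shows "epi_arr M k"
proof -
  obtain X e Y where e: "k = (X, e, Y)" "hom X Y e" "e ` base X = base Y"
    using assms by (rule surjective_homs_cases)
  show ?thesis
    unfolding epi_arr_def e(1) M_simps
  proof (intro conjI allI ballI impI)
    fix W f g assume "f \<in> homset M Y W" "g \<in> homset M Y W" "Cmp M f (X, e, Y) = Cmp M g (X, e, Y)"
    moreover from this obtain h j where "f = (Y, h, W)" "hom Y W h" "g = (Y, j, W)" "hom Y W j"
      unfolding homset_M by blast
    ultimately show "f = g" using surj_cancel[OF e(2,3)] by simp
  qed (simp add: Arr_M e(2))
qed

lemma induced_embedding_mono:
  assumes "k \<in> induced_embeddings \<Sigma> ar M"
  shows "mono_arr M k"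
proof -
  obtain A m B where m: "k = (A, m, B)" "hom A B m" "reflects A B m"
    using assms by (rule induced_embeddings_cases)
  show ?thesis
    unfolding mono_arr_def m(1) M_simps
  proof (intro conjI allI ballI impI)
    fix W f g assume "f \<in> homset M W A" "g \<in> homset M W A" "Cmp M (A, m, B) f = Cmp M (A, m, B) g"
    moreover from this obtain h j where "f = (W, h, A)" "hom W A h" "g = (W, j, A)" "hom W A j"
      unfolding homset_M by blast
    ultimately show "f = g" using inj_cancel[OF reflectsD(1)[OF m(3)]] by simp
  qed (simp add: Arr_M m(2))
qed

lemma proper_factorization_system_M:
  "proper_factorization_system M (surjective_homs M) (induced_embeddings \<Sigma> ar M)"
proof -
  have "surjective_homs M \<subseteq> Arr M" "induced_embeddings \<Sigma> ar M \<subseteq> Arr M"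
    unfolding surjective_homs_def induced_embeddings_def by auto
  moreover note iso_surjective_embedding[THEN conjunct1] iso_surjective_embedding[THEN conjunct2] surjective_homs_compose induced_embeddings_compose
    surjection_embedding_factorization surjection_embedding_diagonal surjective_hom_epi induced_embedding_mono
  ultimately show ?thesis
    unfolding proper_factorization_system_def orthogonal_factorization_system_def
    by (intro conjI allI ballI impI)
qed

text \<open>For the harder inclusion, let \<open>f\<close> be a quotient. Its corestriction to its
  range has the same kernel and hence factors through \<open>f\<close>, say by \<open>h\<close>.
  Then \<open>h\<close> followed by the inclusion fixes \<open>f\<close>, so by uniqueness it is the
  identity of \<open>Y\<close>, and every point of \<open>Y\<close> lies in the range.\<close>

lemma quotients_M: "quotients M F = surjective_homs M"
proof (intro equalityI subsetI)
  fix k assume "k \<in> surjective_homs M"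
  then obtain X e Y where e: "k = (X, e, Y)" "hom X Y e" "e ` base X = base Y"
    by (cases k) (auto simp: surjective_homs_M)
  then have "normal M F X (Ker M F k)" unfolding normal_def by (intro bexI[of _ k]) (simp_all add: Arr_M)
  then show "k \<in> quotients M F"
    using quotient_surj[OF e(2,3)] homD(1)[OF e(2)] e(1) unfolding quotients_def by blast
next
  fix k assume "k \<in> quotients M F"
  then obtain X K where k: "quotient_of M F X K k" by (auto simp: quotients_def)
  then obtain f Y where f: "k = (X, f, Y)" "hom X Y f" by (cases k) (auto simp: quotient_of_def Arr_M)
  have univ_k: "\<exists>!h. h \<in> homset M Y (Cod M g) \<and> g = Cmp M h k"
    if "g \<in> Arr M" "Dom M g = X" "Ker M F k \<sqsubseteq>\<^bsub>Fib F X\<^esub> Ker M F g" for g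
    using k that f(1) by (auto simp: quotient_of_def)
  note i = image_factor[OF f(2)]
  let ?I = "sub Y (f ` base X)" and ?\<iota> = "restrict id (f ` base X)"
  have le: "Ker M F k \<sqsubseteq>\<^bsub>Fib F X\<^esub> Ker M F k" by (simp add: f(1) Ker_le[OF f(2) f(2)])
  have "\<exists>!h. h \<in> homset M Y ?I \<and> (X, f, ?I) = Cmp M h k"
    using univ_k[of "(X, f, ?I)"] i(1) le Ker_image_factor[OF f(2)] by (simp add: Arr_M f(1))
  then obtain l where l: "l \<in> homset M Y ?I" "(X, f, ?I) = Cmp M l k" by blast
  then obtain h where h: "l = (Y, h, ?I)" "hom Y ?I h" unfolding homset_M by blast
  have "(X, f, ?I) = (X, compose (base X) h f, ?I)" using l(2) unfolding f(1) h(1) M_simps .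
  then have hf: "h (f x) = f x" if "x \<in> base X" for x
    using that by (metis prod.inject compose_apply)
  define j where "j = compose (base Y) ?\<iota> h"
  have j: "hom Y Y j" unfolding j_def using hom_compose[OF h(2) i(2)] by simp
  have jf: "compose (base X) j f = f"
  proof (rule hom_ext[OF hom_compose[OF f(2) j] f(2)])
    fix x assume x: "x \<in> base X"
    then show "compose (base X) j f x = f x"
      using homD(6)[OF f(2) x] hf[OF x] by (simp add: j_def compose_apply)
  qed
  have "compose (base X) (restrict id (base Y)) f = f"
    using idn_left[OF homset_homI[OF f(2)]] by simp
  then have id: "(Y, restrict id (base Y), Y) \<in> homset M Y Y \<and> k = Cmp M (Y, restrict id (base Y), Y) k"
    using hom_id[OF homD(2)[OF f(2)]] by (simp add: homset_M f(1))
  have "(Y, j, Y) \<in> homset M Y Y \<and> k = Cmp M (Y, j, Y) k"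
    using j by (simp add: homset_M f(1) jf)
  moreover have "\<exists>!h. h \<in> homset M Y Y \<and> k = Cmp M h k"
    using univ_k[of k] f le by (simp add: Arr_M)
  ultimately have "(Y, j, Y) = (Y, restrict id (base Y), Y)"
    using id by (metis (no_types, lifting))
  then have eq: "j = restrict id (base Y)" unfolding prod.inject by blast
  have "y \<in> f ` base X" if y: "y \<in> base Y" for y
  proof -
    have hy: "h y \<in> f ` base X" using homD(6)[OF h(2) y] by simp
    have "j y = y" using y by (simp add: eq)
    moreover have "j y = h y" using y hy by (simp add: j_def compose_apply)
    ultimately show ?thesis using hy by metis
  qed
  then have "f ` base X = base Y" using homD(6)[OF f(2)] by blast
  then show "k \<in> surjective_homs M" using f by (simp add: surjective_homs_M)
qed

text \<open>For the harder inclusion, let \<open>f\<close> be an embedding. The inclusion of its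
  range has the same image and hence factors through \<open>f\<close> by some \<open>h\<close>.
  Uniqueness makes \<open>h\<close> after \<open>f\<close> the identity, so \<open>f\<close>
  reflects relations onto its range by \<open>retraction_reflects\<close>; composing with the
  inclusion finishes.\<close>

lemma embeddings_M: "embeddings M F = induced_embeddings \<Sigma> ar M"
proof (intro equalityI subsetI)
  fix k assume "k \<in> induced_embeddings \<Sigma> ar M"
  then obtain A m Y where m: "k = (A, m, Y)" "hom A Y m" "reflects A Y m"
    by (cases k) (auto simp: induced_embeddings_M)
  then have "conormal M F Y (Im M F k)" unfolding conormal_def by (intro bexI[of _ k]) (simp_all add: Arr_M)
  then show "k \<in> embeddings M F"
    using embedding_reflects[OF m(2,3)] homD(2)[OF m(2)] m(1) unfolding embeddings_def by blast
next
  fix k assume "k \<in> embeddings M F"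
  then obtain Y S where k: "embedding_of M F Y S k" by (auto simp: embeddings_def)
  then obtain A f where f: "k = (A, f, Y)" "hom A Y f" by (cases k) (auto simp: embedding_of_def Arr_M)
  have univ_k: "\<exists>!h. h \<in> homset M (Dom M g) A \<and> g = Cmp M k h"
    if "g \<in> Arr M" "Cod M g = Y" "Im M F g \<sqsubseteq>\<^bsub>Fib F Y\<^esub> Im M F k" for g
    using k that f(1) by (auto simp: embedding_of_def)
  note i = image_factor[OF f(2)]
  let ?I = "sub Y (f ` base A)" and ?\<iota> = "restrict id (f ` base A)"
  have le: "Im M F k \<sqsubseteq>\<^bsub>Fib F Y\<^esub> Im M F k" by (simp add: f(1) Im_le[OF f(2) f(2)])
  have "\<exists>!h. h \<in> homset M ?I A \<and> (?I, ?\<iota>, Y) = Cmp M k h"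
    using univ_k[of "(?I, ?\<iota>, Y)"] i(2) le Im_image_factor[OF f(2)] by (simp add: Arr_M f(1))
  then obtain l where l: "l \<in> homset M ?I A" "(?I, ?\<iota>, Y) = Cmp M k l" by blast
  then obtain h where h: "l = (?I, h, A)" "hom ?I A h" unfolding homset_M by blast
  have "(?I, ?\<iota>, Y) = (?I, compose (base ?I) f h, Y)" using l(2) unfolding f(1) h(1) M_simps .
  then have \<iota>: "?\<iota> = compose (f ` base A) f h" by simp
  have fh: "f (h (f x)) = f x" if "x \<in> base A" for x
    using fun_cong[OF \<iota>, of "f x"] that by (simp add: compose_apply)
  define j where "j = compose (base A) h f"
  have j: "hom A A j" unfolding j_def using hom_compose[OF i(1) h(2)] by simp
  have fj: "compose (base A) f j = f"
    by (rule hom_ext[OF hom_compose[OF j f(2)] f(2)]) (simp add: compose_apply j_def fh)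
  have "compose (base A) f (restrict id (base A)) = f"
    using idn_right[OF homset_homI[OF f(2)]] by simp
  then have id: "(A, restrict id (base A), A) \<in> homset M A A \<and> k = Cmp M k (A, restrict id (base A), A)"
    using hom_id[OF homD(1)[OF f(2)]] by (simp add: homset_M f(1))
  have "(A, j, A) \<in> homset M A A \<and> k = Cmp M k (A, j, A)"
    using j by (simp add: homset_M f(1) fj)
  moreover have "\<exists>!h. h \<in> homset M A A \<and> k = Cmp M k h"
    using univ_k[of k] f le by (simp add: Arr_M)
  ultimately have "(A, j, A) = (A, restrict id (base A), A)"
    using id by (metis (no_types, lifting))
  then have "compose (base A) h f = restrict id (base A)" unfolding prod.inject j_def by blast
  then have "reflects A ?I f" by (rule retraction_reflects[OF i(1) h(2)])
  then have e: "(A, f, ?I) \<in> induced_embeddings \<Sigma> ar M" using i(1) by (simp add: induced_embeddings_M)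
  have m: "(?I, ?\<iota>, Y) \<in> induced_embeddings \<Sigma> ar M" using i(2,3) by (simp add: induced_embeddings_M)
  have "Cmp M (?I, ?\<iota>, Y) (A, f, ?I) \<in> induced_embeddings \<Sigma> ar M"
    by (rule induced_embeddings_compose[OF e m]) simp
  then show "k \<in> induced_embeddings \<Sigma> ar M" by (simp add: f(1) i(4))
qed


subsection \<open>Joins of kernels\<close>

text \<open>Reading non-generators as zero turns every finite relation \<open>p\<close> into a
  vector. Pairs can then be added one at a time, even through stages that are not partial
  homomorphisms.\<close>

definition vec :: "('u, 's) struct \<Rightarrow> (nat, 's) struct \<Rightarrow> ('u \<times> nat) set \<Rightarrow>
    (('u \<times> nat) set \<times> (nat, 's) struct) set" where
  "vec A Z p = (if (p, Z) \<in> gens A then {(p, Z)} else {})"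

lemma vec_Fpow: "vec A Z p \<in> Fpow (gens A)"
  by (simp add: vec_def Fpow_def)

lemma finite_vec: "finite (vec A Z p)"
  by (simp add: vec_def)

text \<open>The zero convention is respected: by \<open>gens_vimage\<close>, a non-generator never
  has a generator as its image.\<close>

lemma lin_vec:
  assumes "hom A B f" "finite p" "p \<subseteq> base A \<times> base Z"
  shows "lin (act (A, f, B)) (vec A Z p) = vec B Z (map_prod f id ` p)"
  using gens_vimage[OF assms] by (auto simp: vec_def lin_singleton act_def)

text \<open>The two relations have the same image under \<open>f\<close>, so their vectors do
  too.\<close>

lemma vec_step:
  assumes f: "hom A B f" and p: "finite p" "p \<subseteq> base A \<times> base Z" "(x, c) \<in> p"
    and y: "y \<in> base A" "f x = f y"
  shows "vec A Z p \<oplus> vec A Z (insert (y, c) p) \<in> ker (A, f, B)"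
proof -
  have q: "finite (insert (y, c) p)" "insert (y, c) p \<subseteq> base A \<times> base Z" using p y by auto
  have "(f y, c) \<in> map_prod f id ` p" using image_eqI[OF _ p(3), of "(f y, c)" "map_prod f id"] y(2) by simp
  then have "map_prod f id ` insert (y, c) p = map_prod f id ` p" by (simp add: insert_absorb)
  then have "lin (act (A, f, B)) (vec A Z p \<oplus> vec A Z (insert (y, c) p)) = {}"
    by (simp add: lin_xor finite_vec lin_vec[OF f p(1,2)] lin_vec[OF f q])
  then show ?thesis by (simp add: ker_def xor_Fpow vec_Fpow)
qed

text \<open>The conditions \<open>eq\<close> and \<open>rel\<close> make \<open>g\<close> factor
  through the surjection \<open>f\<close>, and kernels grow under further composition.\<close>

lemma ker_subset_hom:
  assumes f: "hom X Y f" "f ` base X = base Y" and g: "hom X J g"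
    and eq: "\<And>x y. x \<in> base X \<Longrightarrow> y \<in> base X \<Longrightarrow> f x = f y \<Longrightarrow> g x = g y"
    and rel: "\<And>R t. set t \<subseteq> base X \<Longrightarrow> map f t \<in> interp Y R \<Longrightarrow> map g t \<in> interp J R"
  shows "ker (X, f, Y) \<subseteq> ker (X, g, J)"
proof -
  define s where "s = inv_into (base X) f"
  have s: "s y \<in> base X" "f (s y) = y" if "y \<in> base Y" for y
    using that f(2) by (simp_all add: s_def inv_into_into f_inv_into_f)
  define h where "h = (\<lambda>y\<in>base Y. g (s y))"
  have hf: "h (f x) = g x" if x: "x \<in> base X" for x
    using eq[OF s(1) x s(2)] homD(6)[OF f(1) x] by (simp add: h_def)
  have "map h u \<in> interp J R" if u: "u \<in> interp Y R" for R u
  proof -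
    have uY: "set u \<subseteq> base Y" using modelD(2)[OF homD(4)[OF f(1)] u] .
    have "map f (map s u) = u" using uY s(2) by (auto intro!: map_idI)
    then have "map g (map s u) \<in> interp J R" using rel[of "map s u" R] u uY s(1) by auto
    moreover have "map h u = map g (map s u)" using uY by (auto simp: h_def)
    ultimately show ?thesis by (simp only:)
  qed
  moreover have "h \<in> base Y \<rightarrow>\<^sub>E base J" using s homD(6)[OF g] by (auto simp: h_def)
  ultimately have "hom Y J h" using homD(2)[OF f(1)] homD(2)[OF g] by (simp add: hom_def)
  from ker_cmp_subset[OF homset_homI[OF f(1)] homset_homI[OF this]]
  have "ker (X, f, Y) \<subseteq> ker (X, compose (base X) h f, J)" by simp
  moreover have "compose (base X) h f = g"
    using hf homD(5)[OF g] by (auto simp: compose_def fun_eq_iff PiE_iff extensional_def)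
  ultimately show ?thesis by simp
qed

end

section \<open>The common quotient of two surjections\<close>

locale quotient_pair = horn_theory U \<Sigma> ar \<H>
  for U :: "'u set set" and \<Sigma> :: "'s set" and ar :: "'s \<Rightarrow> nat" and \<H> :: "('s, 'v) horn_rule set" +
  fixes X Y1 Y2 :: "('u, 's) struct" and f1 f2 :: "'u \<Rightarrow> 'u"
  assumes f1: "hom X Y1 f1" and surj1: "f1 ` base X = base Y1"
    and f2: "hom X Y2 f2" and surj2: "f2 ` base X = base Y2"
begin

definition step :: "('u \<times> 'u) set" where
  "step = {(x, y). x \<in> base X \<and> y \<in> base X \<and> (f1 x = f1 y \<or> f2 x = f2 y)}"

text \<open>The quotient set has to live in \<open>'u\<close>, so a class is named by a chosen
  member. The predicate under \<open>SOME\<close> depends only on the class, hence equivalent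
  elements choose alike.\<close>

definition rep :: "'u \<Rightarrow> 'u" where
  "rep x = (SOME y. (x, y) \<in> step\<^sup>*)"

lemma step_closed: "(x, y) \<in> step\<^sup>* \<Longrightarrow> x \<in> base X \<Longrightarrow> y \<in> base X"
  by (induction rule: rtrancl_induct) (auto simp: step_def)

lemma sym_steps: "(x, y) \<in> step\<^sup>* \<Longrightarrow> (y, x) \<in> step\<^sup>*"
proof -
  have "sym step" by (auto simp: sym_def step_def)
  then show "(x, y) \<in> step\<^sup>* \<Longrightarrow> (y, x) \<in> step\<^sup>*" using sym_rtrancl symD by metis
qed

lemma rep_steps: "(x, rep x) \<in> step\<^sup>*"
  unfolding rep_def by (rule someI[of _ x]) simp

lemma rep_closed: "x \<in> base X \<Longrightarrow> rep x \<in> base X"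
  using step_closed rep_steps by blast

lemma rep_eq_iff: "rep x = rep y \<longleftrightarrow> (x, y) \<in> step\<^sup>*"
proof
  assume "rep x = rep y"
  then show "(x, y) \<in> step\<^sup>*" using rep_steps[of x] sym_steps[OF rep_steps[of y]] rtrancl_trans by metis
next
  assume "(x, y) \<in> step\<^sup>*"
  then have "(x, z) \<in> step\<^sup>* \<longleftrightarrow> (y, z) \<in> step\<^sup>*" for z using sym_steps rtrancl_trans by metis
  then show "rep x = rep y" by (simp add: rep_def)
qed

text \<open>The relations of \<open>join_model\<close> are the largest ones for which every partial homomorphism from
  \<open>image_sum\<close> into a finite model is still a partial homomorphism.\<close>

definition image_sum :: "('u, 's) struct" where
  "image_sum = \<lparr>base = rep ` base X, interp = (\<lambda>R. {map rep t | t. set t \<subseteq> base X \<and>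
     (map f1 t \<in> interp Y1 R \<or> map f2 t \<in> interp Y2 R)})\<rparr>"

definition join_model :: "('u, 's) struct" where
  "join_model = \<lparr>base = rep ` base X, interp = (\<lambda>R. if R \<in> \<Sigma> then {u \<in> tuples (rep ` base X) (ar R).
     \<forall>Z\<in>targets. \<forall>q w. partial_hom image_sum q Z \<longrightarrow> set w \<subseteq> q \<longrightarrow> map fst w = u \<longrightarrow> map snd w \<in> interp Z R} else {})\<rparr>"

lemma base_image_sum [simp]: "base image_sum = rep ` base X"
  by (simp add: image_sum_def)

lemma base_join [simp]: "base join_model = rep ` base X"
  by (simp add: join_model_def)

lemma interp_join: "u \<in> interp join_model R \<longleftrightarrow> R \<in> \<Sigma> \<and> set u \<subseteq> rep ` base X \<and> length u = ar R \<and>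
    (\<forall>Z\<in>targets. \<forall>q w. partial_hom image_sum q Z \<longrightarrow> set w \<subseteq> q \<longrightarrow> map fst w = u \<longrightarrow> map snd w \<in> interp Z R)"
  by (simp add: join_model_def tuples_def)

lemma image_sum_intro:
  assumes "set t \<subseteq> base X" "map f1 t \<in> interp Y1 R \<or> map f2 t \<in> interp Y2 R"
  shows "map rep t \<in> interp image_sum R"
  using assms by (auto simp: image_sum_def)

lemma image_sum_le_join:
  assumes u: "u \<in> interp image_sum R"
  shows "u \<in> interp join_model R"
proof -
  obtain t where t: "u = map rep t" "set t \<subseteq> base X" "map f1 t \<in> interp Y1 R \<or> map f2 t \<in> interp Y2 R"
    using u by (auto simp: image_sum_def)
  have "R \<in> \<Sigma> \<and> length t = ar R"
    using t(3) modelD(1,3)[OF homD(4)[OF f1], of "map f1 t" R] modelD(1,3)[OF homD(4)[OF f2], of "map f2 t" R]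
    by auto
  moreover have "map snd w \<in> interp Z R" if "partial_hom image_sum q Z" "set w \<subseteq> q" "map fst w = u" for Z :: "(nat, 's) struct" and q w
    using that u by (simp add: partial_hom_def)
  ultimately show ?thesis unfolding interp_join using t(1,2) by auto
qed

text \<open>Let \<open>q\<close> be a partial homomorphism from \<open>image_sum\<close> defined on
  the conclusion tuple. The premise variables occur in that tuple, so \<open>q\<close> is defined on
  the premises and, by definition of \<open>join_model\<close>, preserves them. The rule in the
  model \<open>Z\<close> then gives the conclusion for the values of \<open>q\<close>. As
  \<open>q\<close> was arbitrary, the conclusion holds in \<open>join_model\<close>.\<close>

lemma model_join: "model join_model"
proof (rule modelI)
  fix R t assume "t \<in> interp join_model R"
  then show "R \<in> \<Sigma> \<and> t \<in> tuples (base join_model) (ar R)" by (simp add: interp_join tuples_def)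
next
  fix r S ts \<sigma>
  assume r: "r \<in> \<H>" "concl r = (S, ts)"
    and \<sigma>: "\<sigma> ` set (context_vars r) \<subseteq> base join_model"
    and prems: "\<And>R ts'. (R, ts') \<in> set (prems r) \<Longrightarrow> map \<sigma> ts' \<in> interp join_model R"
  note c = wf_concl[OF r]
  have "map snd w \<in> interp Z S"
    if Z: "Z \<in> targets" and q: "partial_hom image_sum q Z" and w: "set w \<subseteq> q" "map fst w = map \<sigma> ts" for Z q w
  proof -
    have sv: "single_valued q" and qZ: "q \<subseteq> base image_sum \<times> base Z" using q by (auto simp: partial_hom_def)
    have len: "length w = length ts" using arg_cong[OF w(2), of length] by simp
    \<comment> \<open>Positive arity makes \<open>base Z\<close> nonempty. The point
      \<open>z\<close> serves as the value of those context variables that do not occur in the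
      conclusion, and so in no premise either.\<close>
    then have "w \<noteq> []" using c ar_pos[OF c(1)] by auto
    then obtain z where z: "z \<in> base Z" using w(1) qZ by (cases w) auto
    define \<alpha> where "\<alpha> v = (if v \<in> set ts then THE d. (\<sigma> v, d) \<in> q else z)" for v
    have \<alpha>_eq: "\<alpha> v = d" if "v \<in> set ts" "(\<sigma> v, d) \<in> q" for v d
      using that sv by (auto simp: \<alpha>_def single_valued_def intro!: the_equality)
    have nth: "(\<sigma> (ts ! i), snd (w ! i)) \<in> q" if i: "i < length ts" for i
    proof -
      have "fst (w ! i) = \<sigma> (ts ! i)" using arg_cong[OF w(2), of "\<lambda>l. l ! i"] i len by simp
      moreover have "w ! i \<in> q" using w(1) i len by auto
      ultimately show ?thesis by (metis prod.collapse)
    qed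
    have \<alpha>: "(\<sigma> v, \<alpha> v) \<in> q" if v: "v \<in> set ts" for v
    proof -
      obtain i where "i < length ts" "ts ! i = v" using v by (auto simp: in_set_conv_nth)
      then show ?thesis using nth[of i] \<alpha>_eq[OF v] by metis
    qed
    have "map \<alpha> ts \<in> interp Z S"
    proof (rule model_holds[OF _ r])
      show "model Z" using Z by (simp add: targets_def)
      show "\<alpha> ` set (context_vars r) \<subseteq> base Z" using \<alpha> qZ z by (auto simp: \<alpha>_def)
      fix R ts' assume p: "(R, ts') \<in> set (prems r)"
      have "set ts' \<subseteq> set ts" using prem_vars[OF r(1) p] r(2) by simp
      then have "set (map (\<lambda>v. (\<sigma> v, \<alpha> v)) ts') \<subseteq> q" using \<alpha> by auto
      moreover have "map fst (map (\<lambda>v. (\<sigma> v, \<alpha> v)) ts') = map \<sigma> ts'" by simp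
      ultimately have "map snd (map (\<lambda>v. (\<sigma> v, \<alpha> v)) ts') \<in> interp Z R"
        using prems[OF p] Z q unfolding interp_join by blast
      then show "map \<alpha> ts' \<in> interp Z R" by (simp add: comp_def)
    qed
    moreover have "map \<alpha> ts = map snd w"
      using len \<alpha>_eq nth by (intro nth_equalityI) auto
    ultimately show ?thesis by simp
  qed
  moreover have "set (map \<sigma> ts) \<subseteq> rep ` base X" using c(3) \<sigma> by auto
  ultimately show "map \<sigma> ts \<in> interp join_model S" unfolding interp_join using c(1,2) by auto
qed

lemma join_Obj: "join_model \<in> Obj M"
proof -
  have "base X \<in> U" using homD(1)[OF f1] by (simp add: Obj_M)
  moreover have "rep ` base X \<subseteq> base X" using rep_closed by blast
  ultimately have "rep ` base X \<in> U" using univ unfolding universe_def by blast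
  then show ?thesis using model_join by (simp add: Obj_M)
qed

text \<open>Passing from \<open>image_sum\<close> to \<open>join_model\<close> kills nothing: a
  relation is added only if every such \<open>q\<close> preserves it.\<close>

lemma partial_hom_join: "Z \<in> targets \<Longrightarrow> partial_hom image_sum q Z \<Longrightarrow> partial_hom join_model q Z"
  unfolding partial_hom_def[of join_model] by (auto simp: interp_join partial_hom_def[of image_sum])

definition quo :: "'u \<Rightarrow> 'u" where
  "quo = restrict rep (base X)"

lemma map_quo: "set t \<subseteq> base X \<Longrightarrow> map quo t = map rep t"
  by (auto simp: quo_def)

lemma hom_quo: "hom X join_model quo"
proof -
  have "map quo t \<in> interp join_model R" if t: "t \<in> interp X R" for R t
  proof -
    have "set t \<subseteq> base X" using modelD(2)[OF homD(3)[OF f1] t] .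
    then show ?thesis using homD(7)[OF f1 t] by (simp only: map_quo) (intro image_sum_le_join image_sum_intro; simp)
  qed
  then show ?thesis using homD(1)[OF f1] join_Obj by (auto simp: hom_def quo_def)
qed

lemma quo_eq: "x \<in> base X \<Longrightarrow> y \<in> base X \<Longrightarrow> f1 x = f1 y \<or> f2 x = f2 y \<Longrightarrow> quo x = quo y"
  by (auto simp: quo_def rep_eq_iff step_def)

section \<open>Congruence of generators modulo the sum of the two kernels\<close>

abbreviation kernels :: "(('u \<times> nat) set \<times> (nat, 's) struct) set set" where
  "kernels \<equiv> ssum (ker (X, f1, Y1)) (ker (X, f2, Y2))"

lemma ker1: "ker (X, f1, Y1) \<in> subspaces (gens X)" and ker2: "ker (X, f2, Y2) \<in> subspaces (gens X)"
  using ker_subspaces[of "(X, f1, Y1)"] ker_subspaces[of "(X, f2, Y2)"] by simp_all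

lemma kernels_subspaces: "kernels \<in> subspaces (gens X)"
  by (rule ssum_subspaces[OF ker1 ker2])

lemmas in_kernels = ssum_upper[OF ker1 ker2, THEN subsetD]

lemma kernels_trans:
  assumes "A \<oplus> B \<in> kernels" "B \<oplus> D \<in> kernels"
  shows "A \<oplus> D \<in> kernels"
proof -
  have "(A \<oplus> B) \<oplus> (B \<oplus> D) = A \<oplus> D" by (simp add: xor_assoc)
  then show ?thesis using subspacesD(3)[OF kernels_subspaces assms] by simp
qed

lemma kernels_sym: "A \<oplus> B \<in> kernels \<Longrightarrow> B \<oplus> A \<in> kernels"
  by (simp only: xor_commute[of B A])

text \<open>Along a chain of steps the new pair wanders from \<open>(x, c)\<close> to
  \<open>(y, c)\<close>, and each move stays within one of the two kernels. The induction needs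
  arbitrary \<open>p\<close>, since its hypothesis is also used for a larger relation.\<close>

lemma vec_steps:
  assumes "(x, y) \<in> step\<^sup>*" "finite p" "p \<subseteq> base X \<times> base Z" "(x, c) \<in> p"
  shows "vec X Z p \<oplus> vec X Z (insert (y, c) p) \<in> kernels"
  using assms
proof (induction arbitrary: p rule: rtrancl_induct)
  case base
  then show ?case using subspacesD(2)[OF kernels_subspaces] by (simp add: insert_absorb)
next
  case (step y z)
  have yz: "y \<in> base X" "z \<in> base X" "f1 y = f1 z \<or> f2 y = f2 z" using step.hyps(2) by (auto simp: step_def)
  have c: "c \<in> base Z" using step.prems by auto
  let ?p = "insert (y, c) p" and ?q = "insert (z, c) p"
  have p: "finite ?p" "?p \<subseteq> base X \<times> base Z" "(y, c) \<in> ?p" using step.prems yz c by auto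
  have fwd: "vec X Z ?p \<oplus> vec X Z (insert (z, c) ?p) \<in> kernels"
    using yz(3)
  proof
    assume "f1 y = f1 z"
    then show ?thesis by (rule in_kernels(1)[OF vec_step[OF f1 p yz(2)]])
  next
    assume "f2 y = f2 z"
    then show ?thesis by (rule in_kernels(2)[OF vec_step[OF f2 p yz(2)]])
  qed
  \<comment> \<open>After \<open>(z, c)\<close> has been added beside \<open>(y, c)\<close>, the
    auxiliary pair \<open>(y, c)\<close> is removed again by the induction hypothesis for
    \<open>insert (z, c) p\<close>.\<close>
  have "vec X Z ?q \<oplus> vec X Z (insert (y, c) ?q) \<in> kernels"
    using step.prems yz(2) c by (intro step.IH) auto
  then have bwd: "vec X Z (insert (z, c) ?p) \<oplus> vec X Z ?q \<in> kernels"
    unfolding insert_commute[of "(z, c)"] by (rule kernels_sym)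
  show ?case by (rule kernels_trans[OF kernels_trans[OF step.IH[OF step.prems] fwd] bwd])
qed

text \<open>Each pair of \<open>D\<close> is equivalent to a pair of \<open>p\<close> with the same
  value, so \<open>vec_steps\<close> adds the pairs of \<open>D\<close> one by one.\<close>

lemma vec_union:
  assumes "finite D" "finite p" "p \<subseteq> base X \<times> base Z" "D \<subseteq> base X \<times> base Z"
    "\<And>y c. (y, c) \<in> D \<Longrightarrow> (rep y, c) \<in> map_prod rep id ` p"
  shows "vec X Z p \<oplus> vec X Z (p \<union> D) \<in> kernels"
  using assms
proof (induction D)
  case empty
  then show ?case using subspacesD(2)[OF kernels_subspaces] by simp
next
  case (insert a D)
  obtain y c where a: "a = (y, c)" by (cases a)
  obtain x where x: "(x, c) \<in> p" "rep x = rep y" using insert.prems(4)[of y c] a by auto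
  have "finite (p \<union> D)" "p \<union> D \<subseteq> base X \<times> base Z" "(x, c) \<in> p \<union> D"
    using x(1) insert.prems(1-3) insert.hyps(1) by simp_all
  with x(2) have new: "vec X Z (p \<union> D) \<oplus> vec X Z (insert (y, c) (p \<union> D)) \<in> kernels"
    unfolding rep_eq_iff by (rule vec_steps)
  have "vec X Z p \<oplus> vec X Z (p \<union> D) \<in> kernels"
  proof (rule insert.IH[OF insert.prems(1,2)])
    show "D \<subseteq> base X \<times> base Z" using insert.prems(3) by simp
    show "(rep y, c) \<in> map_prod rep id ` p" if "(y, c) \<in> D" for y c
      by (rule insert.prems(4)) (simp add: that)
  qed
  from kernels_trans[OF this new] show ?case by (simp add: a)
qed

text \<open>The obstruction in the quotient may not be visible on \<open>p\<close> itself, only on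
  other representatives of the same classes. So \<open>p\<close> is first enlarged by such pairs,
  which changes its vector only modulo \<open>kernels\<close>, until the enlarged relation has
  vector zero or is killed by \<open>f1\<close> or \<open>f2\<close>. The claim \<open>*\<close>
  records this reduction.\<close>

lemma vec_kernels:
  assumes "Z \<in> targets" "finite p" "p \<subseteq> base X \<times> base Z"
    and no: "(map_prod rep id ` p, Z) \<notin> gens join_model"
  shows "vec X Z p \<in> kernels"
proof -
  have *: "vec X Z p \<in> kernels"
    if "finite D" "D \<subseteq> base X \<times> base Z" "\<And>y c. (y, c) \<in> D \<Longrightarrow> (rep y, c) \<in> map_prod rep id ` p"
      "vec X Z (p \<union> D) \<in> kernels" for D
    using subspacesD(3)[OF kernels_subspaces vec_union[OF that(1) assms(2,3) that(2,3)] that(4)]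
    by (simp add: xor_assoc)
  have sub: "map_prod rep id ` p \<subseteq> base image_sum \<times> base Z" using assms(3) by auto
  have "\<not> partial_hom join_model (map_prod rep id ` p) Z" using no assms(1) by (simp add: gens_def)
  then have "\<not> partial_hom image_sum (map_prod rep id ` p) Z" using partial_hom_join[OF assms(1)] by blast
  then consider "\<not> single_valued (map_prod rep id ` p)"
    | R w where "set w \<subseteq> map_prod rep id ` p" "map fst w \<in> interp image_sum R" "map snd w \<notin> interp Z R"
    using sub assms(2) unfolding partial_hom_def by blast
  then show ?thesis
  proof cases
    case 1
    then obtain x y c d where xy: "(x, c) \<in> p" "(y, d) \<in> p" "rep x = rep y" "c \<noteq> d"
      by (auto simp: single_valued_def)
    \<comment> \<open>The enlarged relation contains both \<open>(y, c)\<close> and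
      \<open>(y, d)\<close>, so it is no generator and its vector is zero by convention.\<close>
    then have "vec X Z (p \<union> {(y, c)}) = {}"
      using gensD(4)[of "p \<union> {(y, c)}" Z X] by (auto simp: vec_def single_valued_def)
    moreover have "(rep y, c) \<in> map_prod rep id ` p" using xy(1,3) by (auto intro: rev_image_eqI)
    ultimately show ?thesis
      using xy assms(3) subspacesD(2)[OF kernels_subspaces] by (intro *[of "{(y, c)}"]) auto
  next
    case 2
    obtain t where t: "map fst w = map rep t" "set t \<subseteq> base X"
      "map f1 t \<in> interp Y1 R \<or> map f2 t \<in> interp Y2 R"
      using 2(2) by (auto simp: image_sum_def)
    have len: "length t = length w" using arg_cong[OF t(1), of length] by simp
    \<comment> \<open>The values of \<open>w\<close> are moved to the tuple \<open>t\<close>, on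
      which the violated relation already holds after \<open>f1\<close> or after
      \<open>f2\<close>.\<close>
    define D where "D = set (zip t (map snd w))"
    have D: "(rep y, c) \<in> map_prod rep id ` p \<and> y \<in> base X" if yc: "(y, c) \<in> D" for y c
    proof -
      obtain i where i: "i < length w" "y = t ! i" "c = snd (w ! i)"
        using yc len by (auto simp: D_def set_zip)
      have "rep y = fst (w ! i)" using arg_cong[OF t(1), of "\<lambda>l. l ! i"] i len by simp
      then have "(rep y, c) = w ! i" using i by simp
      then show ?thesis using 2(1) i(1,2) t(2) len nth_mem by (metis subsetD)
    qed
    have fin: "finite (p \<union> D)" using assms(2) by (simp add: D_def)
    have DZ: "D \<subseteq> base X \<times> base Z" using D sub by fastforce
    then have pD: "p \<union> D \<subseteq> base X \<times> base Z" using assms(3) by blast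
    \<comment> \<open>If the image of \<open>p \<union> D\<close> were a generator over
      \<open>Y\<close>, it would carry the relation on \<open>map f t\<close> to one on
      \<open>map snd w\<close>, which fails in \<open>Z\<close>.\<close>
    have "vec X Z (p \<union> D) \<in> ker (X, f, Y)" if f: "hom X Y f" and ft: "map f t \<in> interp Y R" for f Y
    proof -
      have "set (map (map_prod f id) (zip t (map snd w))) \<subseteq> map_prod f id ` (p \<union> D)"
        by (auto simp: D_def)
      moreover have "map fst (map (map_prod f id) (zip t (map snd w))) = map f (map fst (zip t (map snd w)))"
        by simp
      then have "map fst (map (map_prod f id) (zip t (map snd w))) \<in> interp Y R" using ft len by simp
      moreover have "map snd (map (map_prod f id) (zip t (map snd w))) = map snd (zip t (map snd w))"
        by simp
      then have "map snd (map (map_prod f id) (zip t (map snd w))) \<notin> interp Z R" using 2(3) len by simp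
      ultimately have "(map_prod f id ` (p \<union> D), Z) \<notin> gens Y" using gensD(5) by blast
      then have "lin (act (X, f, Y)) (vec X Z (p \<union> D)) = {}"
        unfolding lin_vec[OF f fin pD] by (simp add: vec_def)
      then show ?thesis by (simp add: ker_def vec_Fpow)
    qed
    then have "vec X Z (p \<union> D) \<in> kernels" using t(3) in_kernels f1 f2 by blast
    then show ?thesis using D DZ fin by (intro *[of D]) auto
  qed
qed

lemma map_prod_quo: "p \<subseteq> base X \<times> V \<Longrightarrow> map_prod quo id ` p = map_prod rep id ` p"
  by (intro image_cong refl) (auto simp: quo_def)

text \<open>The sum of the kernels is below because \<open>quo\<close> factors through
  \<open>f1\<close> and through \<open>f2\<close>. Conversely, by \<open>kernel_lin_subset\<close>
  it is enough to treat generators killed by \<open>quo\<close>, which is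
  \<open>vec_kernels\<close>, and pairs of generators with the same image.\<close>

lemma ker_quo: "ker (X, quo, join_model) = kernels"
proof
  have rel: "map quo t \<in> interp join_model R"
    if "set t \<subseteq> base X" "map f1 t \<in> interp Y1 R \<or> map f2 t \<in> interp Y2 R" for t R
    using image_sum_le_join[OF image_sum_intro[OF that]] by (simp only: map_quo[OF that(1)])
  have "ker (X, f1, Y1) \<subseteq> ker (X, quo, join_model)"
  proof (rule ker_subset_hom[OF f1 surj1 hom_quo])
    show "quo x = quo y" if "x \<in> base X" "y \<in> base X" "f1 x = f1 y" for x y
      by (rule quo_eq[OF that(1,2)]) (simp add: that(3))
    show "map quo t \<in> interp join_model R" if "set t \<subseteq> base X" "map f1 t \<in> interp Y1 R" for R t
      by (rule rel[OF that(1)]) (simp only: that(2) simp_thms)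
  qed
  moreover have "ker (X, f2, Y2) \<subseteq> ker (X, quo, join_model)"
  proof (rule ker_subset_hom[OF f2 surj2 hom_quo])
    show "quo x = quo y" if "x \<in> base X" "y \<in> base X" "f2 x = f2 y" for x y
      by (rule quo_eq[OF that(1,2)]) (simp add: that(3))
    show "map quo t \<in> interp join_model R" if "set t \<subseteq> base X" "map f2 t \<in> interp Y2 R" for R t
      by (rule rel[OF that(1)]) (simp only: that(2) simp_thms)
  qed
  moreover have "ker (X, quo, join_model) \<in> subspaces (gens X)" using ker_subspaces[of "(X, quo, join_model)"] by simp
  ultimately show "kernels \<subseteq> ker (X, quo, join_model)" by (intro ssum_least)
next
  show "ker (X, quo, join_model) \<subseteq> kernels"
  proof
    fix A assume "A \<in> ker (X, quo, join_model)"
    then have A: "A \<in> Fpow (gens X)" "lin (act (X, quo, join_model)) A = {}" by (simp_all add: ker_def)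
    show "A \<in> kernels"
    proof (rule kernel_lin_subset[OF kernels_subspaces _ _ A])
      fix a assume a: "a \<in> gens X" "act (X, quo, join_model) a = None"
      obtain p Z where pZ: "a = (p, Z)" by (cases a)
      note p = gensD[OF a(1)[unfolded pZ]]
      have "vec X Z p \<in> kernels"
        using a(2) map_prod_quo[OF p(3)] by (intro vec_kernels[OF p(1-3)]) (simp add: pZ act_None)
      then show "{a} \<in> kernels" using a(1) by (simp add: vec_def pZ)
    next
      fix a b c assume *: "a \<in> gens X" "b \<in> gens X" "act (X, quo, join_model) a = Some c" "act (X, quo, join_model) b = Some c"
      obtain p Z q V where ab: "a = (p, Z)" "b = (q, V)" by (cases a, cases b) blast
      note p = gensD[OF *(1)[unfolded ab]] and q = gensD[OF *(2)[unfolded ab]]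
      have V: "V = Z" using *(3,4) ab by (simp add: act_Some)
      have eq: "map_prod rep id ` p = map_prod rep id ` q"
        using *(3,4) map_prod_quo[OF p(3)] map_prod_quo[OF q(3)] by (simp add: ab act_Some)
      have pq: "(rep y, c) \<in> map_prod rep id ` p" if "(y, c) \<in> p \<or> (y, c) \<in> q" for y c
      proof -
        have "(rep y, c) \<in> map_prod rep id ` p \<or> (rep y, c) \<in> map_prod rep id ` q"
          using that by (auto intro: rev_image_eqI)
        then show ?thesis using eq by simp
      qed
      \<comment> \<open>Generators with equal images are compared through
        \<open>p \<union> q\<close>: it adds to either of them only pairs equivalent to its own. The
        union itself may fail to be a generator.\<close>
      have "vec X Z p \<oplus> vec X Z (p \<union> q) \<in> kernels"
        using p(2,3) q(2,3) V pq by (intro vec_union) simp_all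
      moreover have "vec X Z q \<oplus> vec X Z (q \<union> p) \<in> kernels"
        using p(2,3) q(2,3) V pq eq by (intro vec_union) simp_all
      then have "vec X Z (p \<union> q) \<oplus> vec X Z q \<in> kernels"
        unfolding Un_commute[of q p] by (rule kernels_sym)
      ultimately have "vec X Z p \<oplus> vec X Z q \<in> kernels" by (rule kernels_trans)
      then show "{a} \<oplus> {b} \<in> kernels" using *(1,2) by (simp add: vec_def ab V)
    qed
  qed
qed

end

section \<open>Assembling the noetherian form\<close>

context horn_theory
begin

lemma form_normal_join:
  assumes X: "X \<in> Obj M" and K: "normal M F X K" and L: "normal M F X L"
  shows "normal M F X (K \<squnion>\<^bsub>Fib F X\<^esub> L)"
proof -
  obtain Y1 f1 where f1: "hom X Y1 f1" "f1 ` base X = base Y1" "K = code X (ker (X, f1, Y1))"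
    using K by (rule normal_surj)
  obtain Y2 f2 where f2: "hom X Y2 f2" "f2 ` base X = base Y2" "L = code X (ker (X, f2, Y2))"
    using L by (rule normal_surj)
  interpret q: quotient_pair U \<Sigma> ar \<H> X Y1 Y2 f1 f2
    using f1 f2 by unfold_locales
  have "K \<squnion>\<^bsub>Fib F X\<^esub> L = code X (ssum (ker (X, f1, Y1)) (ker (X, f2, Y2)))"
    unfolding f1(3) f2(3) by (rule join_Fib[OF X q.ker1 q.ker2])
  also have "\<dots> = Ker M F (X, q.quo, q.join_model)"
    by (simp only: q.ker_quo Ker_M[OF q.hom_quo])
  finally show ?thesis
    unfolding normal_def using q.hom_quo
    by (intro bexI[of _ "(X, q.quo, q.join_model)"]) (simp_all add: Arr_M)
qed

lemma noetherian_form_M: "noetherian_form M U F"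
  by (intro noetherian_form.intro orean noetherian_form_axioms.intro Inv_Dir Dir_Inv
      form_factorization form_normal_join form_conormal_meet)

lemma induces_factorization_system_M:
  "induces_factorization_system M F (surjective_homs M) (induced_embeddings \<Sigma> ar M)"
  unfolding induces_factorization_system_def
  using proper_factorization_system_M quotients_M embeddings_M by blast

end

theorem theorem4p36:
  fixes U :: "'u set set" and \<Sigma> :: "'s set" and ar :: "'s \<Rightarrow> nat"
    and \<H> :: "('s, 'v) horn_rule set"
  assumes "universe U"
    and "small U \<Sigma>"
    and "\<forall>R\<in>\<Sigma>. 0 < ar R"
    and "\<forall>r\<in>\<H>. wf_rule \<Sigma> ar r"
    and "\<forall>r\<in>\<H>. \<forall>(R, ts) \<in> set (prems r). set ts \<subseteq> set (snd (concl r))"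
  shows "\<exists>F :: (('u, 's) struct, ('u, 's) struct_arr, 'u) form.
     noetherian_form (Mod U \<Sigma> ar \<H>) U F \<and>
     induces_factorization_system (Mod U \<Sigma> ar \<H>) F
       (surjective_homs (Mod U \<Sigma> ar \<H>)) (induced_embeddings \<Sigma> ar (Mod U \<Sigma> ar \<H>)) \<and>
     (\<forall>X\<in>Obj (Mod U \<Sigma> ar \<H>).
        complete_algebraic_lattice (Fib F X) \<and> modular_lattice (Fib F X))"
proof -
  interpret horn_theory U \<Sigma> ar \<H>
    using assms by unfold_locales blast+
  show ?thesis
    using noetherian_form_M induces_factorization_system_M Fib_algebraic Fib_modular
    by (intro exI[of _ F] conjI ballI)
qed

end
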